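(* Let $1\le m\le n$ be integers, let $X$ be a metric space on which the Hausdorff measure $\mathcal{H}^m$ is $\sigma$-finite, and let $\Omega\subset\mathbb{R}^n$ be open. Let $f:\Omega\to X$ be a Lipschitz map such that $\operatorname{rank}\,\mathrm{md}(f,p)=m$ for almost every $p\in\Omega$. Let $\pi:\mathbb{R}^n=\mathbb{R}^m\times\mathbb{R}^{n-m}\to\mathbb{R}^m$, $\pi(x,y)=x$. Then there is a countable family $\{K_i\}$ of pairwise disjoint compact subsets of $\Omega$ with $\mathcal{L}^n(\Omega\setminus\bigcup_iK_i)=0$ such that for each $i$ there exist a $C^1$-diffeomorphism $G_i:\mathbb{R}^n\to\mathbb{R}^n=\mathbb{R}^m\times\mathbb{R}^{n-m}$ (onto $\mathbb{R}^n$) and a bi-Lipschitz map (onto its image) $\phi_i:\pi(G_i(K_i))\to X$ such that $$(f\circ G_i^{-1})(x,y)=(\phi_i\circ\pi)(x,y)=\phi_i(x)\qquad\text{for all }(x,y)\in G_i(K_i).$$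
   Context: A seminorm on $\mathbb{R}^n$ is a function $\sigma:\mathbb{R}^n\to[0,\infty)$ with $\sigma(\lambda v)=|\lambda|\sigma(v)$ and $\sigma(v+w)\le\sigma(v)+\sigma(w)$. Its rank is $\operatorname{rank}\sigma=n-\dim\{v:\sigma(v)=0\}$. A map $f:\Omega\to (X,d)$ is metrically differentiable at $x\in\Omega$ if there is a seminorm $\sigma_x$ on $\mathbb{R}^n$ with $\lim_{y\to x}\frac{d(f(y),f(x))-\sigma_x(y-x)}{|y-x|}=0$; such a $\sigma_x$ is unique and is denoted $\mathrm{md}(f,x)$. (By Kirchheim's theorem, a Lipschitz map is metrically differentiable at almost every point of $\Omega$.) $\mathcal{H}^m$ is the $m$-dimensional Hausdorff measure; it is $\sigma$-finite on $X$ if $X$ is a countable union of sets of finite $\mathcal{H}^m$-measure. $\mathcal{L}^n$ is Lebesgue measure. *)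

theory Defs
  imports "HOL-Analysis.Analysis"
begin

section \<open>Seminorms and metric differentiability\<close>

definition seminorm :: "('a::real_vector \<Rightarrow> real) \<Rightarrow> bool" where
  "seminorm \<sigma> \<longleftrightarrow>
     (\<forall>v. 0 \<le> \<sigma> v) \<and>
     (\<forall>c v. \<sigma> (c *\<^sub>R v) = \<bar>c\<bar> * \<sigma> v) \<and>
     (\<forall>v w. \<sigma> (v + w) \<le> \<sigma> v + \<sigma> w)"

definition seminorm_rank :: "('a::euclidean_space \<Rightarrow> real) \<Rightarrow> nat" where
  "seminorm_rank \<sigma> = DIM('a) - dim {v. \<sigma> v = 0}"

definition has_metric_differential ::
    "('a::euclidean_space \<Rightarrow> 'b::metric_space) \<Rightarrow> ('a \<Rightarrow> real) \<Rightarrow> 'a \<Rightarrow> 'a set \<Rightarrow> bool" where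
  "has_metric_differential f \<sigma> x \<Omega> \<longleftrightarrow>
     seminorm \<sigma> \<and>
     ((\<lambda>y. (dist (f y) (f x) - \<sigma> (y - x)) / norm (y - x)) \<longlongrightarrow> 0) (at x within \<Omega>)"

definition metrically_differentiable ::
    "('a::euclidean_space \<Rightarrow> 'b::metric_space) \<Rightarrow> 'a \<Rightarrow> 'a set \<Rightarrow> bool" where
  "metrically_differentiable f x \<Omega> \<longleftrightarrow> (\<exists>\<sigma>. has_metric_differential f \<sigma> x \<Omega>)"

definition md ::
    "('a::euclidean_space \<Rightarrow> 'b::metric_space) \<Rightarrow> 'a \<Rightarrow> 'a set \<Rightarrow> 'a \<Rightarrow> real" where
  "md f x \<Omega> = (THE \<sigma>. has_metric_differential f \<sigma> x \<Omega>)"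

lemma has_metric_differential_unique:
  fixes f :: "'a::euclidean_space \<Rightarrow> 'b::metric_space"
  assumes \<Omega>: "open \<Omega>" "x \<in> \<Omega>"
    and 1: "has_metric_differential f \<sigma> x \<Omega>"
    and 2: "has_metric_differential f \<tau> x \<Omega>"
  shows "\<sigma> = \<tau>"
proof
  fix v
  have hom: "\<sigma> (c *\<^sub>R w) = \<bar>c\<bar> * \<sigma> w" "\<tau> (c *\<^sub>R w) = \<bar>c\<bar> * \<tau> w" for c w
    using 1 2 by (auto simp: has_metric_differential_def seminorm_def)
  show "\<sigma> v = \<tau> v"
  proof (cases "v = 0")
    case True
    then show ?thesis using hom[of 0 v] by simp
  next
    case False
    let ?q = "\<lambda>y. (\<tau> (y - x) - \<sigma> (y - x)) / norm (y - x)"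
    have at: "at x within \<Omega> = at x"
      using \<Omega> by (rule at_within_open[OF _ _, rotated])
    have "((\<lambda>y. (dist (f y) (f x) - \<sigma> (y - x)) / norm (y - x)
              - (dist (f y) (f x) - \<tau> (y - x)) / norm (y - x)) \<longlongrightarrow> 0 - 0) (at x)"
      using 1 2 unfolding has_metric_differential_def at by (intro tendsto_diff) auto
    then have q: "(?q \<longlongrightarrow> 0) (at x)"
      by (simp add: diff_divide_distrib)
    have "((\<lambda>t. x + t *\<^sub>R v) \<longlongrightarrow> x + 0 *\<^sub>R v) (at_right (0::real))"
      by (intro tendsto_intros)
    moreover have "eventually (\<lambda>t. x + t *\<^sub>R v \<noteq> x) (at_right (0::real))"
      using False by (simp add: eventually_at_filter)
    ultimately have "filterlim (\<lambda>t. x + t *\<^sub>R v) (at x) (at_right (0::real))"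
      by (simp add: filterlim_at)
    then have "((\<lambda>t. ?q (x + t *\<^sub>R v)) \<longlongrightarrow> 0) (at_right (0::real))"
      by (rule filterlim_compose[OF q])
    moreover have "eventually (\<lambda>t. ?q (x + t *\<^sub>R v) = (\<tau> v - \<sigma> v) / norm v) (at_right (0::real))"
      unfolding eventually_at_filter
      by (rule always_eventually)
         (use False in \<open>auto simp: hom right_diff_distrib[symmetric]\<close>)
    ultimately have "((\<lambda>t. (\<tau> v - \<sigma> v) / norm v) \<longlongrightarrow> 0) (at_right (0::real))"
      by (rule Lim_transform_eventually)
    then have "(\<tau> v - \<sigma> v) / norm v = 0"
      by (simp add: tendsto_const_iff)
    then show ?thesis using False by simp
  qed
qed

lemma md_eq:
  assumes "open \<Omega>" "x \<in> \<Omega>" "has_metric_differential f \<sigma> x \<Omega>"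
  shows "md f x \<Omega> = \<sigma>"
  unfolding md_def
  using assms has_metric_differential_unique by (intro the_equality) blast+

section \<open>Hausdorff measure\<close>

text \<open>
  The covering sets are required to be bounded because the library's \<^const>\<open>diameter\<close> is not
  meaningful for unbounded sets. The empty set has weight 0 for every \<open>m\<close>, including \<open>m = 0\<close>, so
  sequences of sets also represent finite covers.
\<close>

definition hausdorff_content :: "nat \<Rightarrow> real \<Rightarrow> 'a::metric_space set \<Rightarrow> ennreal" where
  "hausdorff_content m \<delta> A =
     (INF C \<in> {C :: nat \<Rightarrow> 'a set.
                 A \<subseteq> (\<Union>i. C i) \<and> (\<forall>i. bounded (C i) \<and> diameter (C i) \<le> \<delta>)}.
        \<Sum>i. if C i = {} then 0
             else ennreal (unit_ball_vol (real m) * (diameter (C i) / 2) ^ m))"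

definition hausdorff_measure :: "nat \<Rightarrow> 'a::metric_space set \<Rightarrow> ennreal" where
  "hausdorff_measure m A = (SUP \<delta>\<in>{0<..}. hausdorff_content m \<delta> A)"

definition hausdorff_sigma_finite :: "nat \<Rightarrow> 'a::metric_space set \<Rightarrow> bool" where
  "hausdorff_sigma_finite m X \<longleftrightarrow>
     (\<exists>A :: nat \<Rightarrow> 'a set. X = (\<Union>i. A i) \<and> (\<forall>i. hausdorff_measure m (A i) < \<infinity>))"

section \<open>Diffeomorphisms, bi-Lipschitz maps, projections\<close>

definition C1_map :: "('a::real_normed_vector \<Rightarrow> 'b::real_normed_vector) \<Rightarrow> bool" where
  "C1_map G \<longleftrightarrow>
     (\<exists>G' :: 'a \<Rightarrow> 'a \<Rightarrow>\<^sub>L 'b.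
        (\<forall>x. (G has_derivative blinfun_apply (G' x)) (at x)) \<and> continuous_on UNIV G')"

definition C1_diffeomorphism :: "('a::real_normed_vector \<Rightarrow> 'b::real_normed_vector) \<Rightarrow> bool" where
  "C1_diffeomorphism G \<longleftrightarrow> bij G \<and> C1_map G \<and> C1_map (inv G)"

definition bi_lipschitz_on :: "'a::metric_space set \<Rightarrow> ('a \<Rightarrow> 'b::metric_space) \<Rightarrow> bool" where
  "bi_lipschitz_on S \<phi> \<longleftrightarrow>
     (\<exists>L\<ge>1. \<forall>x\<in>S. \<forall>y\<in>S. dist x y / L \<le> dist (\<phi> x) (\<phi> y) \<and> dist (\<phi> x) (\<phi> y) \<le> L * dist x y)"

text \<open>
  A product \<open>\<real>\<^sup>m \<times> \<real>\<^sup>n\<^sup>-\<^sup>m\<close> of type-indexed spaces would exclude \<open>m = n\<close>, as index types are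
  nonempty. An injection \<open>\<iota>\<close> of the \<open>m\<close> indices into the \<open>n\<close> indices singles out the coordinates
  forming the \<open>\<real>\<^sup>m\<close> factor; the remaining ones form the other factor.
\<close>

definition coord_proj :: "('m::finite \<Rightarrow> 'n::finite) \<Rightarrow> real ^ 'n \<Rightarrow> real ^ 'm" where
  "coord_proj \<iota> v = (\<chi> j. v $ \<iota> j)"

end

theory Submission
  imports Defs
begin

text \<open>
  By exhaustion it suffices to find, inside every non-null measurable \<open>S \<subseteq> \<Omega>\<close>, one non-null compact
  set on which \<open>f\<close> factors. Where the metric differential has rank \<open>m\<close>, it is a norm on some
  coordinate \<open>m\<close>-plane \<open>P\<close>, so on a non-null compact \<open>K \<subseteq> S\<close> the map \<open>f\<close> is bi-Lipschitz on each
  slice of \<open>K\<close> parallel to \<open>P\<close>. Compact non-null pieces of slices with pairwise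
  disjoint images form a countable family, as \<open>\<H>\<^sup>m\<close> is \<open>\<sigma>\<close>-finite on the target. Taking a maximal such
  family, Fubini yields a single slice \<open>\<Sigma>\<close> for which \<open>{p \<in> K. f p \<in> f (K \<inter> \<Sigma>)}\<close> is not null. There
  \<open>f = \<phi> \<circ> g\<close>, with \<open>\<phi>\<close> the bi-Lipschitz restriction of \<open>f\<close> to the slice and \<open>g = \<phi>\<^sup>-\<^sup>1 \<circ> f\<close> Lipschitz with
  values in \<open>\<real>\<^sup>m\<close>. At almost every point, \<open>Dg\<close> is injective on \<open>P\<close>. The Lusin-type approximation
  of \<open>g\<close> by a \<open>C\<^sup>1\<close> map, applied to \<open>g\<close> minus a linear map that is close to \<open>Dg\<close>, makes \<open>g\<close> agree on a
  non-null compact set with the first \<open>m\<close> coordinates of a small \<open>C\<^sup>1\<close> perturbation of a linear isomorphism,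
  which is a global diffeomorphism.
\<close>

section \<open>Lipschitz functions of one real variable\<close>

text \<open>The values of \<open>f\<close> lie in a bare metric space, so nothing can be
  differentiated until a slice supplies a chart; \<open>g\<close> is \<open>f\<close> read in this
  chart. Sigma-finiteness is the source of the collapse of the remaining n - m directions: it forces
  one slice to share its values with a non-null set. The compact sets met on the way may have empty
  interior, while \<open>Dg\<close> involves all points nearby. Hence
  \<open>noncollapsed_set\<close> compares \<open>f p\<close> with \<open>f\<close> at points of
  \<open>\<Omega>\<close>, and density points carry that estimate over to \<open>Dg\<close>.
  Subtracting a nearby linear map before the Lusin approximation makes the gradient of the C^1
  correction small on the whole space, which yields a diffeomorphism onto R^n and not merely a local
  one. Rademacher's theorem and the Lusin approximation are proved for real-valued functions and
  applied to the coordinates of \<open>g\<close>.\<close>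

lemma AE_lebesgue_iff_negligible: "(AE x in lebesgue. P x) \<longleftrightarrow> negligible {x. \<not> P x}"
  by (simp add: negligible_iff_null_sets completion.AE_iff_null_sets)

text \<open>Neither the exceptional sets of difference quotients nor the preimages of the pieces of
  the target are shown to be measurable, so null sets are detected through outer measure.\<close>

lemma negligible_if_outer_measure_0:
  fixes S :: "'a::euclidean_space set"
  assumes "outer_measure_of lebesgue S = 0"
  shows "negligible S"
proof -
  obtain E where "E \<in> sets lebesgue" "S \<subseteq> E" "emeasure lebesgue E = 0"
    using outer_measure_of_attain[of S lebesgue] assms by auto
  then show ?thesis by (meson negligible_iff_null_sets negligible_subset null_setsI)
qed

lemma outer_measure_open_approx:
  assumes "outer_measure_of lebesgue S < \<infinity>" "0 < e"
  obtains U where "open U" "S \<subseteq> U" "emeasure lebesgue U \<le> outer_measure_of lebesgue S + ennreal e"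
proof -
  obtain E where E: "E \<in> sets lebesgue" "S \<subseteq> E" "outer_measure_of lebesgue S = emeasure lebesgue E"
    using outer_measure_of_attain[of S lebesgue] by auto
  obtain U where U: "open U" "E \<subseteq> U" "U - E \<in> lmeasurable" "emeasure lebesgue (U - E) < ennreal e"
    using sets_lebesgue_outer_open[OF E(1) assms(2)] by metis
  have "emeasure lebesgue U \<le> emeasure lebesgue E + emeasure lebesgue (U - E)"
    using emeasure_subadditive[of E lebesgue "U - E"] E U by (simp add: Un_absorb1 fmeasurableD)
  also have "\<dots> \<le> emeasure lebesgue E + ennreal e"
    using U by (intro add_left_mono) auto
  finally show ?thesis using U E by (intro that[of U]) auto
qed

text \<open>By Vitali, disjoint intervals between \<open>v x\<close> and \<open>v y\<close> with
  small quotient cover almost all of the image of \<open>S\<close>. Since \<open>v\<close> is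
  increasing, the intervals between \<open>x\<close> and \<open>y\<close> are disjoint as well; they
  lie in \<open>U\<close>, and each image interval is at most \<open>a\<close> times as long as its
  source.\<close>

lemma outer_measure_image_le:
  fixes v :: "real \<Rightarrow> real"
  assumes v: "strict_mono v" "continuous_on UNIV v" and U: "open U" "S \<subseteq> U" and a: "0 < a"
    and S: "\<And>x e. x \<in> S \<Longrightarrow> 0 < e \<Longrightarrow> \<exists>y. y \<noteq> x \<and> \<bar>y - x\<bar> < e \<and> \<bar>v y - v x\<bar> \<le> a * \<bar>y - x\<bar>"
  shows "outer_measure_of lebesgue (v ` S) \<le> ennreal a * emeasure lebesgue U"
proof -
  define K where "K = {(x, y). x \<noteq> y \<and> closed_segment x y \<subseteq> U \<and> \<bar>v y - v x\<bar> \<le> a * \<bar>y - x\<bar>}"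
  \<comment> \<open>\<open>c g\<close> and \<open>r g\<close> are centre and radius of the interval
    between \<open>g x\<close> and \<open>g y\<close>: \<open>g = v\<close> gives the image
    intervals, \<open>g = id\<close> the original ones.\<close>
  define c where "c = (\<lambda>g (x::real, y). (g x + g y) / 2 :: real)"
  define r where "r = (\<lambda>g (x::real, y). \<bar>g x - g y\<bar> / 2 :: real)"
  have inj: "v x = v y \<longleftrightarrow> x = y" for x y using v(1) by (simp add: strict_mono_eq)
  have cb: "cball (c g (x, y)) (r g (x, y)) = {min (g x) (g y) .. max (g x) (g y)}" for g x y
    unfolding c_def r_def cball_eq_atLeastAtMost by (auto simp: min_def max_def abs_if field_simps)
  have cov: "\<exists>i. i \<in> K \<and> z \<in> cball (c v i) (r v i) \<and> r v i < d" if z: "z \<in> v ` S" and d: "0 < d" for z d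
  proof -
    obtain x where x: "x \<in> S" "z = v x" using z by auto
    obtain e1 where e1: "e1 > 0" "ball x e1 \<subseteq> U" using U x by (meson openE subsetD)
    have "isCont v x" using v(2) continuous_on_eq_continuous_at by blast
    then obtain e2 where e2: "e2 > 0" "\<And>y. \<bar>y - x\<bar> < e2 \<Longrightarrow> \<bar>v y - v x\<bar> < d"
      using d unfolding continuous_at_eps_delta dist_real_def by metis
    obtain y where y: "y \<noteq> x" "\<bar>y - x\<bar> < min e1 e2" "\<bar>v y - v x\<bar> \<le> a * \<bar>y - x\<bar>"
      using S[OF x(1), of "min e1 e2"] e1 e2 by auto
    have "closed_segment x y \<subseteq> ball x e1"
      using y e1 by (intro closed_segment_subset) (auto simp: dist_real_def)
    then have "(x, y) \<in> K" using y e1 by (auto simp: K_def)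
    moreover have "z \<in> cball (c v (x, y)) (r v (x, y))" using x by (simp add: cb)
    moreover have "r v (x, y) < d" using e2(2)[of y] y d by (auto simp: r_def abs_if split: if_splits)
    ultimately show ?thesis by blast
  qed
  have pos: "0 < r v i" if "i \<in> K" for i
    using that by (auto simp: K_def r_def inj)
  obtain C where C: "countable C" "C \<subseteq> K"
      "pairwise (\<lambda>i j. disjnt (cball (c v i) (r v i)) (cball (c v j) (r v j))) C"
      "negligible (v ` S - (\<Union>i \<in> C. cball (c v i) (r v i)))"
    by (rule Vitali_covering_theorem_cballs[where K = K and r = "r v" and a = "c v" and S = "v ` S", OF pos cov])
  let ?N = "v ` S - (\<Union>i \<in> C. cball (c v i) (r v i))"
  have N: "?N \<in> null_sets lebesgue" using C(4) by (simp add: negligible_iff_null_sets)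
  have dv: "disjoint_family_on (\<lambda>i. cball (c v i) (r v i)) C"
    using C(3) by (auto simp: disjoint_family_on_def pairwise_def disjnt_def)
  have sub: "v ` cball (c id i) (r id i) \<subseteq> cball (c v i) (r v i)" for i
    by (cases i) (auto simp: cb min_def max_def strict_mono_less_eq[OF v(1)])
  have did: "disjoint_family_on (\<lambda>i. cball (c id i) (r id i)) C"
    using dv sub unfolding disjoint_family_on_def by blast
  have em: "emeasure lebesgue (cball (c g i) (r g i)) = ennreal (2 * r g i)" for g i
  proof -
    have "r g i \<ge> 0" by (cases i) (simp add: r_def)
    then show ?thesis by (simp add: cball_eq_atLeastAtMost)
  qed
  have le: "2 * r v i \<le> a * (2 * r id i)" if "i \<in> C" for i
    using that C(2) by (auto simp: K_def r_def abs_minus_commute)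
  have "outer_measure_of lebesgue (v ` S) \<le> outer_measure_of lebesgue (?N \<union> (\<Union>i \<in> C. cball (c v i) (r v i)))"
    by (intro outer_measure_of_mono) auto
  also have "\<dots> = emeasure lebesgue (?N \<union> (\<Union>i \<in> C. cball (c v i) (r v i)))"
    using N C(1) by (intro outer_measure_of_eq sets.Un sets.countable_UN') auto
  also have "\<dots> = emeasure lebesgue (\<Union>i \<in> C. cball (c v i) (r v i))"
    using C(1) N by (intro emeasure_Un_null_set[of _ _ ?N, unfolded Un_commute[of _ ?N]] sets.countable_UN') auto
  also have "\<dots> = (\<integral>\<^sup>+i. ennreal (2 * r v i) \<partial>count_space C)"
    using emeasure_UN_countable[OF _ C(1) dv, of lebesgue] by (simp add: em)
  also have "\<dots> \<le> (\<integral>\<^sup>+i. ennreal a * ennreal (2 * r id i) \<partial>count_space C)"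
    using a by (intro nn_integral_mono) (auto simp: ennreal_mult'[symmetric] intro!: ennreal_leI le)
  also have "\<dots> = ennreal a * (\<integral>\<^sup>+i. ennreal (2 * r id i) \<partial>count_space C)"
    by (rule nn_integral_cmult) auto
  also have "(\<integral>\<^sup>+i. ennreal (2 * r id i) \<partial>count_space C) = emeasure lebesgue (\<Union>i \<in> C. cball (c id i) (r id i))"
    using emeasure_UN_countable[OF _ C(1) did, of lebesgue] by (simp add: em)
  also have "ennreal a * \<dots> \<le> ennreal a * emeasure lebesgue U"
  proof (intro mult_left_mono emeasure_mono)
    show "(\<Union>i \<in> C. cball (c id i) (r id i)) \<subseteq> U"
    proof
      fix t assume "t \<in> (\<Union>i \<in> C. cball (c id i) (r id i))"
      then obtain x y where "(x, y) \<in> C" "t \<in> cball (c id (x, y)) (r id (x, y))" by auto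
      then have "t \<in> closed_segment x y" "(x, y) \<in> K"
        using C(2) by (auto simp: cb closed_segment_eq_real_ivl)
      then show "t \<in> U" by (auto simp: K_def)
    qed
  qed (use U in auto)
  finally show ?thesis .
qed

lemma outer_measure_image_le':
  fixes v :: "real \<Rightarrow> real"
  assumes v: "strict_mono v" "continuous_on UNIV v" and fin: "outer_measure_of lebesgue S < \<infinity>" and a: "0 < a"
    and S: "\<And>x e. x \<in> S \<Longrightarrow> 0 < e \<Longrightarrow> \<exists>y. y \<noteq> x \<and> \<bar>y - x\<bar> < e \<and> \<bar>v y - v x\<bar> \<le> a * \<bar>y - x\<bar>"
  shows "outer_measure_of lebesgue (v ` S) \<le> ennreal a * outer_measure_of lebesgue S"
proof (rule ennreal_le_epsilon)
  fix e :: real assume e: "0 < e"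
  obtain U where U: "open U" "S \<subseteq> U" "emeasure lebesgue U \<le> outer_measure_of lebesgue S + ennreal (e / a)"
    using outer_measure_open_approx[OF fin, of "e / a"] a e by auto
  have "outer_measure_of lebesgue (v ` S) \<le> ennreal a * emeasure lebesgue U"
    by (rule outer_measure_image_le[OF v U(1,2) a S])
  also have "\<dots> \<le> ennreal a * (outer_measure_of lebesgue S + ennreal (e / a))"
    by (intro mult_left_mono U) auto
  also have "\<dots> = ennreal a * outer_measure_of lebesgue S + ennreal e"
    using a e by (simp add: distrib_left ennreal_mult'[symmetric])
  finally show "outer_measure_of lebesgue (v ` S) \<le> ennreal a * outer_measure_of lebesgue S + ennreal e" .
qed

text \<open>Adding \<open>(L + 1) x\<close> turns \<open>u\<close> into an increasing bi-Lipschitz \<open>v\<close>, so that the preceding estimate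
  applies to \<open>v\<close> and to its inverse and shrinks the outer measure of the exceptional set.\<close>

lemma negligible_dini:
  fixes u :: "real \<Rightarrow> real"
  assumes lip: "L-lipschitz_on UNIV u" and ab: "a < b"
  defines "q \<equiv> \<lambda>x y. (u y - u x) / (y - x)"
  shows "negligible {x. (\<exists>\<^sub>F y in at x. q x y < a) \<and> (\<exists>\<^sub>F y in at x. b < q x y)}" (is "negligible ?N")
proof -
  have L: "L \<ge> 0" using lip lipschitz_on_nonneg by blast
  have lipu: "\<bar>u x - u y\<bar> \<le> L * \<bar>x - y\<bar>" for x y
    using lipschitz_onD[OF lip, of x y] by (simp add: dist_real_def)
  define v where "v = (\<lambda>x. u x + (L + 1) * x)"
  have v_less: "y - x \<le> v y - v x \<and> v y - v x \<le> (2 * L + 1) * (y - x)" if "x \<le> y" for x y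
    using lipu[of x y] that by (auto simp: v_def abs_if algebra_simps split: if_splits)
  have v: "strict_mono v"
    unfolding strict_mono_def using v_less by (smt (verit))
  have cu: "continuous_on UNIV u" using lip lipschitz_on_continuous_on by blast
  have cv: "continuous_on UNIV v"
    unfolding v_def by (intro continuous_intros cu)
  have "surj v"
  proof (rule surjI)
    fix z show "v (SOME x. v x = z) = z"
    proof (rule someI_ex)
      \<comment> \<open>As \<open>v\<close> grows with slope at least 1, moving by \<open>R\<close>
        away from 0 changes its value enough to pass \<open>z\<close> on either side.\<close>
      define R where "R = \<bar>z\<bar> + \<bar>v 0\<bar>"
      have R: "R \<ge> 0" by (simp add: R_def)
      have "v (- R) \<le> z" "z \<le> v R"
        using v_less[of "-R" 0] v_less[of 0 R] R unfolding R_def by linarith+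
      then show "\<exists>x. v x = z"
        using IVT'[of v "-R" z R] R continuous_on_subset[OF cv] by auto
    qed
  qed
  define w where "w = inv v"
  have wv: "w (v x) = x" and vw: "v (w z) = z" for x z
    using v \<open>surj v\<close> by (auto simp: w_def strict_mono_imp_inj_on surj_f_inv_f)
  have w: "strict_mono w"
    using v vw by (metis strict_mono_def linorder_neqE not_less_iff_gr_or_eq)
  have "1-lipschitz_on UNIV w"
  proof (rule lipschitz_onI)
    fix x y show "dist (w x) (w y) \<le> 1 * dist x y"
      using v_less[of "w x" "w y"] v_less[of "w y" "w x"] vw by (auto simp: dist_real_def abs_if)
  qed simp
  then have cw: "continuous_on UNIV w" by (rule lipschitz_on_continuous_on)
  define a' b' where "a' = a + L + 1" and "b' = b + L + 1"
  have quot: "(v y - v x) / (y - x) = q x y + L + 1" if "y \<noteq> x" for x y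
    using that by (simp add: v_def q_def field_simps)
  have vq: "1 \<le> (v y - v x) / (y - x)" if "y \<noteq> x" for x y
    using v_less[of x y] v_less[of y x] that by (cases "x \<le> y") (auto simp: field_simps)
  have abs_quot: "\<bar>v y - v x\<bar> = (v y - v x) / (y - x) * \<bar>y - x\<bar>" if "y \<noteq> x" for x y
    using that v_less[of x y] v_less[of y x] by (cases "x \<le> y") (auto simp: field_simps abs_if)
  \<comment> \<open>Cutting by a ball makes the outer measure finite, so that an estimate by a
    multiple of itself with factor \<open>a' / b' < 1\<close> forces it to be 0.\<close>
  have null: "outer_measure_of lebesgue (?N \<inter> cball 0 r) = 0" (is "outer_measure_of lebesgue ?S = 0") for r
  proof (cases "?N = {}")
    case False
    \<comment> \<open>The quotients of \<open>v\<close> are at least 1 and one of them lies below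
      \<open>a'\<close>, whence \<open>a' > 1\<close>.\<close>
    then obtain x where x: "\<exists>\<^sub>F y in at x. q x y < a" by auto
    then obtain y where "y \<noteq> x" "q x y < a"
      using x[unfolded frequently_at, rule_format, of 1] by auto
    with vq[of y x] quot[of y x] have a': "a' > 1" by (simp add: a'_def)
    have b': "b' > a'" using ab by (simp add: a'_def b'_def)
    have "outer_measure_of lebesgue ?S \<le> outer_measure_of lebesgue (cball (0::real) r)"
      by (rule outer_measure_of_mono) simp
    also have "\<dots> = emeasure lborel (cball (0::real) r)" by simp
    also have "\<dots> < \<infinity>" by (rule emeasure_lborel_cball_finite)
    finally have fin: "outer_measure_of lebesgue ?S < \<infinity>" .
    have 1: "outer_measure_of lebesgue (v ` ?S) \<le> ennreal a' * outer_measure_of lebesgue ?S"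
    proof (rule outer_measure_image_le'[OF v cv fin])
      fix x e :: real assume "x \<in> ?S" "0 < e"
      then obtain y where y: "y \<noteq> x" "\<bar>y - x\<bar> < e" "q x y < a"
        by (auto simp: frequently_at dist_real_def)
      have "(v y - v x) / (y - x) \<le> a'" using y quot[of y x] by (simp add: a'_def)
      then show "\<exists>y. y \<noteq> x \<and> \<bar>y - x\<bar> < e \<and> \<bar>v y - v x\<bar> \<le> a' * \<bar>y - x\<bar>"
        using y mult_right_mono[of "(v y - v x) / (y - x)" a' "\<bar>y - x\<bar>"] abs_quot[of y x]
        by (intro exI[of _ y]) linarith
    qed (use a' in simp)
    have 2: "outer_measure_of lebesgue (w ` v ` ?S) \<le> ennreal (1 / b') * outer_measure_of lebesgue (v ` ?S)"
    proof (rule outer_measure_image_le'[OF w cw])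
      note 1
      also have "ennreal a' * outer_measure_of lebesgue ?S < \<infinity>"
        using fin by (simp add: ennreal_mult_less_top)
      finally show "outer_measure_of lebesgue (v ` ?S) < \<infinity>" .
      fix z e :: real assume "z \<in> v ` ?S" and e: "0 < e"
      then obtain x where x: "x \<in> ?S" "z = v x" by auto
      then have "isCont v x" using cv continuous_on_eq_continuous_at by blast
      then obtain d where d: "d > 0" "\<And>y. \<bar>y - x\<bar> < d \<Longrightarrow> \<bar>v y - v x\<bar> < e"
        using e unfolding continuous_at_eps_delta dist_real_def by metis
      obtain y where y: "y \<noteq> x" "\<bar>y - x\<bar> < d" "b < q x y"
        using x d(1) by (auto simp: frequently_at dist_real_def)
      have "b' \<le> (v y - v x) / (y - x)" using y quot[of y x] by (simp add: b'_def)
      then have "b' * \<bar>y - x\<bar> \<le> \<bar>v y - v x\<bar>"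
        using abs_quot[of y x] y mult_right_mono[of b' "(v y - v x) / (y - x)" "\<bar>y - x\<bar>"] by linarith
      then have "\<bar>w (v y) - w z\<bar> \<le> 1 / b' * \<bar>v y - z\<bar>"
        using a' b' by (simp add: x wv field_simps)
      moreover have "v y \<noteq> z" using y(1) x(2) wv by metis
      ultimately show "\<exists>t. t \<noteq> z \<and> \<bar>t - z\<bar> < e \<and> \<bar>w t - w z\<bar> \<le> 1 / b' * \<bar>t - z\<bar>"
        using d(2)[of y] y x by blast
    qed (use a' b' in simp)
    have "w ` v ` ?S = ?S" by (simp add: image_image wv)
    then have "outer_measure_of lebesgue ?S \<le> ennreal (1 / b') * (ennreal a' * outer_measure_of lebesgue ?S)"
      using 2 mult_left_mono[OF 1, of "ennreal (1 / b')"] by simp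
    also have "\<dots> = ennreal (a' / b') * outer_measure_of lebesgue ?S"
      using a' b' by (simp add: mult.assoc[symmetric] ennreal_mult'[symmetric])
    finally have le: "outer_measure_of lebesgue ?S \<le> ennreal (a' / b') * outer_measure_of lebesgue ?S" .
    obtain t where t: "outer_measure_of lebesgue ?S = ennreal t" "t \<ge> 0"
      using fin by (cases "outer_measure_of lebesgue ?S") auto
    have "t \<le> a' / b' * t"
      using le t a' b' by (simp add: ennreal_mult'[symmetric])
    then have "b' * t \<le> a' * t" using a' b' by (simp add: field_simps)
    then have "t = 0" using t(2) b' by (simp add: mult_le_cancel_right)
    then show ?thesis using t by simp
  next
    case True
    then have "?S = {}" by blast
    then show ?thesis by (simp only: outer_measure_of_eq[OF sets.empty_sets] emeasure_empty)
  qed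
  have "negligible (\<Union>n::nat. ?N \<inter> cball 0 (real n))"
    by (intro negligible_Union_nat negligible_if_outer_measure_0 null)
  moreover have "?N = (\<Union>n::nat. ?N \<inter> cball 0 (real n))"
    using real_arch_simple by auto
  ultimately show ?thesis by simp
qed

text \<open>Off the null sets of \<open>negligible_dini\<close> for rational \<open>a < b\<close>,
  no two rationals separate the lower from the upper limit of the difference quotients.\<close>

theorem lipschitz_AE_has_real_derivative:
  fixes u :: "real \<Rightarrow> real"
  assumes lip: "L-lipschitz_on UNIV u"
  shows "AE x in lebesgue. \<exists>D. (u has_real_derivative D) (at x)"
proof -
  define q where "q = (\<lambda>x y. (u y - u x) / (y - x))"
  let ?N = "\<lambda>a b. {x. (\<exists>\<^sub>F y in at x. q x y < a) \<and> (\<exists>\<^sub>F y in at x. b < q x y)}"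
  have "AE x in lebesgue. x \<notin> ?N a b" if "a < b" for a b
    using negligible_dini[OF lip that] by (simp add: AE_lebesgue_iff_negligible q_def)
  then have "AE x in lebesgue. \<forall>a\<in>\<rat>. \<forall>b\<in>\<rat>. a < b \<longrightarrow> x \<notin> ?N a b"
    by (simp add: AE_ball_countable countable_rat)
  then show ?thesis
  proof (rule eventually_mono)
    fix x assume x: "\<forall>a\<in>\<rat>. \<forall>b\<in>\<rat>. a < b \<longrightarrow> x \<notin> ?N a b"
    have bnd: "\<bar>q x y\<bar> \<le> L" for y
      using lipschitz_onD[OF lip, of y x] lipschitz_on_nonneg[OF lip]
      by (cases "y = x") (auto simp: q_def dist_real_def field_simps)
    \<comment> \<open>\<open>Sup A\<close> is the lower limit of the quotients. Above it, some
      rational \<open>a\<close> is undercut frequently, so a larger rational \<open>b\<close> cannot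
      be exceeded frequently.\<close>
    define A where "A = {a. \<forall>\<^sub>F y in at x. a \<le> q x y}"
    have "-L \<in> A" using bnd by (auto simp: A_def abs_le_iff minus_le_iff)
    have ub: "a \<le> L" if aA: "a \<in> A" for a
    proof -
      obtain y where "a \<le> q x y"
        using aA eventually_happens'[of "at x" "\<lambda>y. a \<le> q x y"] unfolding A_def by auto
      then show ?thesis using bnd[of y] by simp
    qed
    then have bdd: "bdd_above A" by (auto simp: bdd_above_def)
    have "(q x \<longlongrightarrow> Sup A) (at x)"
    proof (rule order_tendstoI)
      fix c assume "c < Sup A"
      then obtain a where "a \<in> A" "c < a"
        using less_cSup_iff[OF _ bdd] \<open>-L \<in> A\<close> by blast
      then show "\<forall>\<^sub>F y in at x. c < q x y"
        unfolding A_def by (auto elim: eventually_mono)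
    next
      fix c assume c: "Sup A < c"
      obtain b where b: "b \<in> \<rat>" "Sup A < b" "b < c" using Rats_dense_in_real[OF c] by auto
      obtain a where a: "a \<in> \<rat>" "Sup A < a" "a < b" using Rats_dense_in_real[OF b(2)] by auto
      have "a \<notin> A" using a cSup_upper[OF _ bdd] by force
      then have "\<exists>\<^sub>F y in at x. q x y < a" by (simp add: A_def frequently_def not_less)
      then have "\<not> (\<exists>\<^sub>F y in at x. b < q x y)" using x a b by auto
      then show "\<forall>\<^sub>F y in at x. q x y < c"
        using b by (auto simp: frequently_def elim: eventually_mono)
    qed
    then show "\<exists>D. (u has_real_derivative D) (at x)"
      unfolding has_field_derivative_iff q_def by blast
  qed
qed

section \<open>Rademacher's theorem\<close>

text \<open>Tonelli for the sheared set \<open>F\<close>: integrating over the slices first gives 0,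
  while the other order gives the measure of \<open>E\<close> times that of the whole parameter
  space, by translation invariance. The shear replaces a splitting of the space into the range of
  \<open>T\<close> and a complement.\<close>

lemma negligible_if_negligible_slices:
  fixes T :: "'a::euclidean_space \<Rightarrow> 'b::euclidean_space"
  assumes E: "E \<in> sets borel" and T: "continuous_on UNIV T"
    and null: "\<And>p. negligible {x. p + T x \<in> E}"
  shows "negligible E"
proof -
  define F where "F = {z :: 'a \<times> 'b. snd z + T (fst z) \<in> E}"
  have [measurable]: "T \<in> borel_measurable borel"
    using T by (rule borel_measurable_continuous_onI)
  have F: "F \<in> sets (lborel \<Otimes>\<^sub>M lborel)"
  proof -
    have "(\<lambda>z. snd z + T (fst z)) \<in> borel_measurable (lborel \<Otimes>\<^sub>M lborel)" by measurable
    from measurable_sets[OF this E] show ?thesis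
      by (simp add: F_def vimage_def space_pair_measure)
  qed
  have slice: "{x. p + T x \<in> E} \<in> sets borel" for p
    using E by measurable
  have slice0: "emeasure lborel ((\<lambda>x. (x, p)) -` F) = 0" for p
    using null[of p] slice[of p] by (auto simp: F_def vimage_def negligible_iff_null_sets null_sets_def)
  have "emeasure (lborel \<Otimes>\<^sub>M lborel) F = (\<integral>\<^sup>+p. emeasure lborel ((\<lambda>x. (x, p)) -` F) \<partial>lborel)"
    by (rule lborel_pair.emeasure_pair_measure_alt2[OF F])
  also have "\<dots> = 0" by (simp add: slice0)
  finally have "emeasure (lborel \<Otimes>\<^sub>M lborel) F = 0" .
  moreover have "emeasure (lborel \<Otimes>\<^sub>M lborel) F = (\<integral>\<^sup>+x. emeasure lborel (Pair x -` F) \<partial>lborel)"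
    by (rule lborel.emeasure_pair_measure_alt[OF F])
  moreover have "emeasure lborel (Pair x -` F) = emeasure lborel E" for x
  proof -
    have "emeasure lborel E = emeasure (distr lborel borel ((+) (T x))) E"
      by (simp add: lborel_distr_plus)
    also have "\<dots> = emeasure lborel ((+) (T x) -` E)"
      using E by (subst emeasure_distr) auto
    also have "(+) (T x) -` E = Pair x -` F"
      by (auto simp: F_def add.commute)
    finally show ?thesis by simp
  qed
  ultimately have "emeasure lborel E * emeasure lborel (UNIV :: 'a set) = 0"
    by simp
  then have "emeasure lborel E = 0" by simp
  then show ?thesis
    using E by (simp add: negligible_iff_null_sets null_sets_def)
qed

section \<open>Directional derivatives\<close>

definition has_dir_derivative :: "('a::real_normed_vector \<Rightarrow> real) \<Rightarrow> 'a \<Rightarrow> 'a \<Rightarrow> real \<Rightarrow> bool" where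
  "has_dir_derivative u p v D \<longleftrightarrow> ((\<lambda>t. u (p + t *\<^sub>R v)) has_real_derivative D) (at 0)"

lemma has_dir_derivative_iff:
  "has_dir_derivative u p v D \<longleftrightarrow>
   (\<forall>e>0. \<exists>d>0. \<forall>t. \<bar>t\<bar> < d \<longrightarrow> \<bar>u (p + t *\<^sub>R v) - u p - t * D\<bar> \<le> e * \<bar>t\<bar>)"
proof -
  have eq: "((\<lambda>t. u (p + t *\<^sub>R v)) has_real_derivative D) (at 0) \<longleftrightarrow>
     ((\<lambda>t. u (p + t *\<^sub>R v)) has_derivative (\<lambda>t. D * t)) (at 0)"
    by (simp add: has_field_derivative_def mult_commute_abs)
  show ?thesis
    unfolding has_dir_derivative_def eq has_derivative_at_alt
    by (simp add: bounded_linear_mult_right mult.commute)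
qed

text \<open>The scale \<open>d\<close> is common to all points, which makes the set closed for
  continuous \<open>u\<close>. Differentiability in direction \<open>v\<close> then becomes a
  countable combination of such sets with rational parameters.\<close>

definition uniform_slope_set :: "('a::real_normed_vector \<Rightarrow> real) \<Rightarrow> 'a \<Rightarrow> real \<Rightarrow> real \<Rightarrow> real \<Rightarrow> 'a set" where
  "uniform_slope_set u v D e d = {p. \<forall>t. \<bar>t\<bar> < d \<longrightarrow> \<bar>u (p + t *\<^sub>R v) - u p - t * D\<bar> \<le> e * \<bar>t\<bar>}"

lemma continuous_on_shift:
  assumes "continuous_on UNIV u"
  shows "continuous_on UNIV (\<lambda>p :: 'a::real_normed_vector. u (p + s))"
  by (rule continuous_on_compose2[OF assms]) (auto intro!: continuous_intros)

lemma closed_uniform_slope_set: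
  assumes u: "continuous_on UNIV u"
  shows "closed (uniform_slope_set u v D e d)"
  unfolding uniform_slope_set_def
  by (intro closed_Collect_all closed_Collect_imp open_Collect_const closed_Collect_le continuous_intros
      continuous_on_shift u)

lemma dir_derivative_in_slope_set:
  assumes "has_dir_derivative u p v D" "0 < e"
  obtains a d where "a \<in> \<rat>" "\<bar>a - D\<bar> < e" "d \<in> \<rat>" "0 < d" "p \<in> uniform_slope_set u v a e d"
proof -
  obtain a where a: "a \<in> \<rat>" "D < a" "a < D + e / 2"
    using Rats_dense_in_real[of D "D + e / 2"] assms(2) by auto
  obtain d0 where d0: "d0 > 0" "\<And>t. \<bar>t\<bar> < d0 \<Longrightarrow> \<bar>u (p + t *\<^sub>R v) - u p - t * D\<bar> \<le> e / 2 * \<bar>t\<bar>"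
    using assms unfolding has_dir_derivative_iff by (meson half_gt_zero)
  obtain d where d: "d \<in> \<rat>" "0 < d" "d < d0" using Rats_dense_in_real[OF d0(1)] by auto
  have "p \<in> uniform_slope_set u v a e d"
    unfolding uniform_slope_set_def
  proof (intro CollectI allI impI)
    fix t assume "\<bar>t\<bar> < d"
    then have "\<bar>u (p + t *\<^sub>R v) - u p - t * D\<bar> \<le> e / 2 * \<bar>t\<bar>" using d0(2) d by simp
    moreover have "e / 2 * \<bar>t\<bar> + e / 2 * \<bar>t\<bar> = e * \<bar>t\<bar>" by simp
    moreover have "\<bar>t * D - t * a\<bar> \<le> e / 2 * \<bar>t\<bar>"
      using a mult_left_mono[of "\<bar>D - a\<bar>" "e / 2" "\<bar>t\<bar>"]
      by (simp add: abs_mult mult.commute[of e] flip: right_diff_distrib)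
    ultimately show "\<bar>u (p + t *\<^sub>R v) - u p - t * a\<bar> \<le> e * \<bar>t\<bar>" by linarith
  qed
  moreover have "\<bar>a - D\<bar> < e" using a assms(2) by simp
  ultimately show ?thesis using a(1) d(1,2) that by blast
qed

text \<open>The slopes \<open>a\<close> for different \<open>e\<close> may differ, but each one
  confines the difference quotients near 0 to an interval of length \<open>2 * e\<close>, so the
  quotients form a Cauchy filter.\<close>

lemma has_dir_derivative_if_slopes:
  assumes slopes: "\<And>e. e \<in> \<rat> \<Longrightarrow> 0 < e \<Longrightarrow> \<exists>a d. 0 < d \<and> p \<in> uniform_slope_set u v a e d"
  shows "\<exists>D. has_dir_derivative u p v D"
proof -
  define q where "q = (\<lambda>t. (u (p + t *\<^sub>R v) - u p) / t)"
  have "cauchy_filter (filtermap q (at 0))"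
    unfolding cauchy_filter_metric_filtermap
  proof (intro allI impI)
    fix \<epsilon> :: real assume "0 < \<epsilon>"
    then obtain e where e: "e \<in> \<rat>" "0 < e" "e < \<epsilon> / 2" using Rats_dense_in_real[of 0 "\<epsilon> / 2"] by auto
    obtain a d where d: "0 < d" "p \<in> uniform_slope_set u v a e d" using slopes[OF e(1,2)] by blast
    have q: "\<bar>q t - a\<bar> \<le> e" if "0 < \<bar>t\<bar>" "\<bar>t\<bar> < d" for t
    proof -
      have "q t - a = (u (p + t *\<^sub>R v) - u p - t * a) / t" using that by (simp add: q_def field_simps)
      moreover have "\<bar>u (p + t *\<^sub>R v) - u p - t * a\<bar> \<le> e * \<bar>t\<bar>"
        using d(2) that(2) unfolding uniform_slope_set_def by blast
      ultimately show ?thesis using that(1) by (simp add: abs_divide pos_divide_le_eq)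
    qed
    have "eventually (\<lambda>t. 0 < \<bar>t\<bar> \<and> \<bar>t\<bar> < d) (at 0)"
      unfolding eventually_at using d(1) by (intro exI[of _ d]) (simp add: dist_real_def)
    moreover have "dist (q s) (q t) < \<epsilon>" if "0 < \<bar>s\<bar> \<and> \<bar>s\<bar> < d" "0 < \<bar>t\<bar> \<and> \<bar>t\<bar> < d" for s t
      using q[of s] q[of t] that e(3) unfolding dist_real_def by linarith
    ultimately show "\<exists>P. eventually P (at 0) \<and> (\<forall>x y. P x \<and> P y \<longrightarrow> dist (q x) (q y) < \<epsilon>)"
      by blast
  qed
  then obtain D where "(q \<longlongrightarrow> D) (at 0)"
    using cauchy_filter_complete_converges[OF _ complete_UNIV, of "filtermap q (at 0)"]
    by (auto simp: filterlim_def filtermap_bot_iff)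
  then show ?thesis
    unfolding has_dir_derivative_def has_field_derivative_iff q_def by auto
qed

lemma borel_has_dir_derivative:
  assumes u: "continuous_on UNIV u"
  shows "{p. \<exists>D. has_dir_derivative u p v D} \<in> sets borel"
proof -
  have "{p. \<exists>D. has_dir_derivative u p v D} =
      (\<Inter>e\<in>\<rat> \<inter> {0<..}. \<Union>a\<in>\<rat>. \<Union>d\<in>\<rat> \<inter> {0<..}. uniform_slope_set u v a e d)" (is "?L = ?R")
  proof (intro set_eqI iffI)
    fix p assume "p \<in> ?L"
    then obtain D where D: "has_dir_derivative u p v D" by blast
    have "p \<in> (\<Union>a\<in>\<rat>. \<Union>d\<in>\<rat> \<inter> {0<..}. uniform_slope_set u v a e d)" if "0 < e" for e
      using dir_derivative_in_slope_set[OF D that] by (metis IntI UN_I greaterThan_iff)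
    then show "p \<in> ?R" by blast
  next
    fix p assume p: "p \<in> ?R"
    have "\<exists>a d. 0 < d \<and> p \<in> uniform_slope_set u v a e d" if "e \<in> \<rat>" "0 < e" for e
      using p that by fastforce
    then show "p \<in> ?L" using has_dir_derivative_if_slopes by blast
  qed
  \<comment> \<open>A rational between 0 and 1 shows that the countable intersection over
    \<open>e\<close> has a nonempty index set.\<close>
  moreover have "?R \<in> sets borel"
    using Rats_dense_in_real[of 0 1]
    by (intro sets.countable_INT' sets.countable_UN' image_subsetI borel_closed closed_uniform_slope_set u
        countable_Int1 countable_rat) auto
  ultimately show ?thesis by simp
qed

text \<open>The one-variable theorem holds on every line parallel to \<open>v\<close>;
  \<open>negligible_if_negligible_slices\<close> assembles the lines.\<close>

lemma lipschitz_AE_has_dir_derivative: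
  fixes u :: "'a::euclidean_space \<Rightarrow> real"
  assumes u: "L-lipschitz_on UNIV u"
  shows "AE p in lebesgue. \<exists>D. has_dir_derivative u p v D"
  unfolding AE_lebesgue_iff_negligible
proof (rule negligible_if_negligible_slices[where T = "\<lambda>t::real. t *\<^sub>R v"])
  have "{p. \<exists>D. has_dir_derivative u p v D} \<in> sets borel"
    using u by (intro borel_has_dir_derivative lipschitz_on_continuous_on)
  then have "- {p. \<exists>D. has_dir_derivative u p v D} \<in> sets borel"
    by (rule borel_comp)
  then show "{p. \<nexists>D. has_dir_derivative u p v D} \<in> sets borel"
    by (simp only: Collect_neg_eq[symmetric])
  show "continuous_on UNIV (\<lambda>t::real. t *\<^sub>R v)" by (intro continuous_intros)
  fix p
  have lip: "(L * norm v)-lipschitz_on UNIV (\<lambda>t. u (p + t *\<^sub>R v))"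
  proof (rule lipschitz_onI)
    fix s t :: real
    have "dist (u (p + s *\<^sub>R v)) (u (p + t *\<^sub>R v)) \<le> L * dist (p + s *\<^sub>R v) (p + t *\<^sub>R v)"
      by (rule lipschitz_onD[OF u]) auto
    also have "dist (p + s *\<^sub>R v) (p + t *\<^sub>R v) = norm v * dist s t"
      by (simp add: dist_norm scaleR_diff_left[symmetric])
    finally show "dist (u (p + s *\<^sub>R v)) (u (p + t *\<^sub>R v)) \<le> L * norm v * dist s t" by simp
  qed (use lipschitz_on_nonneg[OF u] in simp)
  have "has_dir_derivative u (p + t *\<^sub>R v) v D"
    if "((\<lambda>t. u (p + t *\<^sub>R v)) has_real_derivative D) (at t)" for t D
  proof -
    have "((\<lambda>s. u (p + (s + t) *\<^sub>R v)) has_real_derivative D) (at 0)"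
      using that DERIV_shift[of "\<lambda>t. u (p + t *\<^sub>R v)" D 0 t] by simp
    then show ?thesis by (simp add: has_dir_derivative_def algebra_simps)
  qed
  then show "negligible {t. p + t *\<^sub>R v \<in> {p. \<nexists>D. has_dir_derivative u p v D}}"
    using lipschitz_AE_has_real_derivative[OF lip]
    unfolding AE_lebesgue_iff_negligible by (elim negligible_subset) auto
qed

lemma has_dir_derivative_scaleR:
  assumes "has_dir_derivative u p v D"
  shows "has_dir_derivative u p (c *\<^sub>R v) (c * D)"
proof -
  have "((\<lambda>t. c * t) has_real_derivative c) (at 0)"
    by (auto intro!: derivative_eq_intros)
  from DERIV_chain2[OF _ this, of "\<lambda>t. u (p + t *\<^sub>R v)" D] assms show ?thesis
    by (simp add: has_dir_derivative_def mult.commute)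
qed

text \<open>A substitute for Lebesgue's density theorem: \<open>infdist \<cdot> E\<close> has a minimum at every point of \<open>E\<close>, so its
  derivatives there vanish.\<close>

lemma AE_infdist_small:
  fixes E :: "'a::euclidean_space set"
  shows "AE p in lebesgue. p \<in> E \<longrightarrow> has_dir_derivative (\<lambda>x. infdist x E) p v 0"
proof (cases "E = {}")
  case False
  have "1-lipschitz_on UNIV (\<lambda>x. infdist x E)"
    by (rule lipschitz_onI) (auto simp: dist_real_def infdist_triangle_abs)
  from lipschitz_AE_has_dir_derivative[OF this, of v] show ?thesis
  proof (rule eventually_mono, intro impI)
    fix p assume "\<exists>D. has_dir_derivative (\<lambda>x. infdist x E) p v D" and p: "p \<in> E"
    then obtain D where D: "has_dir_derivative (\<lambda>x. infdist x E) p v D" by blast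
    have "D = 0"
      using D[unfolded has_dir_derivative_def]
      by (rule DERIV_local_min[where d = 1]) (auto simp: p infdist_nonneg)
    then show "has_dir_derivative (\<lambda>x. infdist x E) p v 0" using D by simp
  qed
qed simp

lemma infdist_small_obtain:
  fixes E :: "'a::euclidean_space set"
  assumes "closed E" "E \<noteq> {}" "has_dir_derivative (\<lambda>x. infdist x E) p v 0" "p \<in> E" "0 < e"
  obtains d where "d > 0" "\<And>t. \<bar>t\<bar> < d \<Longrightarrow> \<exists>q\<in>E. dist (p + t *\<^sub>R v) q \<le> e * \<bar>t\<bar>"
proof -
  obtain d where d: "d > 0" "\<And>t. \<bar>t\<bar> < d \<Longrightarrow> \<bar>infdist (p + t *\<^sub>R v) E\<bar> \<le> e * \<bar>t\<bar>"
    using assms(3,4,5) unfolding has_dir_derivative_iff by auto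
  show ?thesis
  proof (rule that[OF d(1)])
    fix t assume "\<bar>t\<bar> < d"
    moreover obtain q where "q \<in> E" "infdist (p + t *\<^sub>R v) E = dist (p + t *\<^sub>R v) q"
      using infdist_attains_inf[OF assms(1,2)] by blast
    ultimately show "\<exists>q\<in>E. dist (p + t *\<^sub>R v) q \<le> e * \<bar>t\<bar>"
      using d(2)[of t] by auto
  qed
qed

text \<open>The point \<open>p + t w\<close> is \<open>o(t)\<close>-close to points at which the difference quotients in direction \<open>v\<close> are
  controlled at a scale independent of \<open>t\<close>.\<close>

lemma dir_derivative_add:
  fixes u :: "'a::euclidean_space \<Rightarrow> real"
  assumes u: "L-lipschitz_on UNIV u"
    and v: "has_dir_derivative u p v Dv" and w: "has_dir_derivative u p w Dw"
    and vw: "has_dir_derivative u p (v + w) D"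
    and dens: "\<And>a e d. a \<in> \<rat> \<Longrightarrow> e \<in> \<rat> \<Longrightarrow> d \<in> \<rat> \<Longrightarrow> p \<in> uniform_slope_set u v a e d \<Longrightarrow>
       has_dir_derivative (\<lambda>x. infdist x (uniform_slope_set u v a e d)) p w 0"
  shows "D = Dv + Dw"
proof -
  have L: "L \<ge> 0" using lipschitz_on_nonneg[OF u] .
  \<comment> \<open>\<open>\<epsilon>\<close> is rational because \<open>dens\<close> speaks of
    rational parameters. The 4 counts the errors of three difference quotients and of replacing
    \<open>Dv\<close> by \<open>a\<close>; the \<open>2 * L\<close> counts the two moves from
    \<open>p + t *\<^sub>R w\<close> to the nearby point \<open>q\<close>.\<close>
  have "\<bar>D - (Dv + Dw)\<bar> \<le> (4 + 2 * L) * \<epsilon>" if \<epsilon>: "\<epsilon> > 0" "\<epsilon> \<in> \<rat>" for \<epsilon>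
  proof -
    obtain a d where a: "a \<in> \<rat>" "\<bar>a - Dv\<bar> < \<epsilon>" and d: "d \<in> \<rat>" "0 < d"
      and pE: "p \<in> uniform_slope_set u v a \<epsilon> d"
      by (rule dir_derivative_in_slope_set[OF v \<epsilon>(1)])
    let ?E = "uniform_slope_set u v a \<epsilon> d"
    have "closed ?E" using u by (intro closed_uniform_slope_set lipschitz_on_continuous_on)
    then obtain d1 where d1: "d1 > 0" "\<And>t. \<bar>t\<bar> < d1 \<Longrightarrow> \<exists>q\<in>?E. dist (p + t *\<^sub>R w) q \<le> \<epsilon> * \<bar>t\<bar>"
      using infdist_small_obtain[OF _ _ dens[OF a(1) \<epsilon>(2) d(1) pE] pE \<epsilon>(1)] pE by blast
    obtain d2 where d2: "d2 > 0" "\<And>t. \<bar>t\<bar> < d2 \<Longrightarrow> \<bar>u (p + t *\<^sub>R w) - u p - t * Dw\<bar> \<le> \<epsilon> * \<bar>t\<bar>"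
      using w \<epsilon>(1) unfolding has_dir_derivative_iff by blast
    obtain d3 where d3: "d3 > 0" "\<And>t. \<bar>t\<bar> < d3 \<Longrightarrow> \<bar>u (p + t *\<^sub>R (v + w)) - u p - t * D\<bar> \<le> \<epsilon> * \<bar>t\<bar>"
      using vw \<epsilon>(1) unfolding has_dir_derivative_iff by blast
    define t where "t = Min {d, d1, d2, d3} / 2"
    have t: "t > 0" "\<bar>t\<bar> < d" "\<bar>t\<bar> < d1" "\<bar>t\<bar> < d2" "\<bar>t\<bar> < d3"
      unfolding t_def using d(2) d1(1) d2(1) d3(1) by (auto simp: min_def)
    obtain q where q: "q \<in> ?E" "dist (p + t *\<^sub>R w) q \<le> \<epsilon> * \<bar>t\<bar>" using d1(2)[OF t(3)] by blast
    have 1: "\<bar>u (q + t *\<^sub>R v) - u q - t * a\<bar> \<le> \<epsilon> * t"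
    proof -
      have "\<bar>u (q + t *\<^sub>R v) - u q - t * a\<bar> \<le> \<epsilon> * \<bar>t\<bar>"
        using q(1) t(2) unfolding uniform_slope_set_def by blast
      then show ?thesis using t(1) by simp
    qed
    have lip: "\<bar>u x - u y\<bar> \<le> L * (\<epsilon> * t)" if "dist x y \<le> \<epsilon> * t" for x y
      using lipschitz_onD[OF u, of x y] mult_left_mono[OF that L] by (simp add: dist_real_def)
    have 2: "\<bar>u (p + t *\<^sub>R w) - u q\<bar> \<le> L * (\<epsilon> * t)" using q(2) t by (intro lip) simp
    have 3: "\<bar>u (p + t *\<^sub>R (v + w)) - u (q + t *\<^sub>R v)\<bar> \<le> L * (\<epsilon> * t)"
      using q(2) t by (intro lip) (simp add: dist_norm algebra_simps)
    have 4: "\<bar>u (p + t *\<^sub>R w) - u p - t * Dw\<bar> \<le> \<epsilon> * t" using d2(2)[OF t(4)] t by simp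
    have 5: "\<bar>u (p + t *\<^sub>R (v + w)) - u p - t * D\<bar> \<le> \<epsilon> * t" using d3(2)[OF t(5)] t by simp
    have 6: "\<bar>t * a - t * Dv\<bar> \<le> \<epsilon> * t"
      using a t \<epsilon> mult_left_mono[of "\<bar>a - Dv\<bar>" "\<epsilon>" "\<bar>t\<bar>"]
      by (simp add: abs_mult mult.commute[of \<epsilon>] flip: right_diff_distrib)
    have *: "\<bar>t * D - (t * Dv + t * Dw)\<bar> \<le> 4 * (\<epsilon> * t) + 2 * (L * (\<epsilon> * t))"
      using 1 2 3 4 5 6 by linarith
    have "t * \<bar>D - (Dv + Dw)\<bar> \<le> t * ((4 + 2 * L) * \<epsilon>)"
    proof -
      have "t * \<bar>D - (Dv + Dw)\<bar> = \<bar>t * D - (t * Dv + t * Dw)\<bar>"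
        using t(1) by (simp add: abs_mult flip: distrib_left right_diff_distrib)
      moreover have "4 * (\<epsilon> * t) + 2 * (L * (\<epsilon> * t)) = t * ((4 + 2 * L) * \<epsilon>)"
        by (simp add: algebra_simps)
      ultimately show ?thesis using * by simp
    qed
    then show ?thesis using t(1) by simp
  qed note bound = this
  have "\<bar>D - (Dv + Dw)\<bar> \<le> 0"
  proof (rule field_le_epsilon)
    fix e :: real assume e: "e > 0"
    obtain \<epsilon> where \<epsilon>: "\<epsilon> \<in> \<rat>" "0 < \<epsilon>" "\<epsilon> < e / (4 + 2 * L)"
      using Rats_dense_in_real[of 0 "e / (4 + 2 * L)"] e L by auto
    have "(4 + 2 * L) * \<epsilon> \<le> e" using \<epsilon>(3) L by (simp add: field_simps)
    then show "\<bar>D - (Dv + Dw)\<bar> \<le> 0 + e" using bound[OF \<epsilon>(2,1)] by simp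
  qed
  then show ?thesis by simp
qed

text \<open>For fixed \<open>v\<close> and \<open>w\<close> the density condition concerns one set
  per rational triple, hence countably many null sets.\<close>

lemma AE_dir_derivative_add:
  fixes u :: "'a::euclidean_space \<Rightarrow> real"
  assumes u: "L-lipschitz_on UNIV u"
  shows "AE p in lebesgue. \<forall>Dv Dw. has_dir_derivative u p v Dv \<longrightarrow> has_dir_derivative u p w Dw \<longrightarrow>
           has_dir_derivative u p (v + w) (Dv + Dw)"
proof -
  have "AE p in lebesgue. \<forall>a\<in>\<rat>. \<forall>e\<in>\<rat>. \<forall>d\<in>\<rat>. p \<in> uniform_slope_set u v a e d \<longrightarrow>
       has_dir_derivative (\<lambda>x. infdist x (uniform_slope_set u v a e d)) p w 0"
    by (simp add: AE_ball_countable countable_rat AE_infdist_small)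
  with lipschitz_AE_has_dir_derivative[OF u, of "v + w"] show ?thesis
  proof eventually_elim
    fix p
    assume ex: "\<exists>D. has_dir_derivative u p (v + w) D"
      and p: "\<forall>a\<in>\<rat>. \<forall>e\<in>\<rat>. \<forall>d\<in>\<rat>. p \<in> uniform_slope_set u v a e d \<longrightarrow>
       has_dir_derivative (\<lambda>x. infdist x (uniform_slope_set u v a e d)) p w 0"
    show "\<forall>Dv Dw. has_dir_derivative u p v Dv \<longrightarrow> has_dir_derivative u p w Dw \<longrightarrow>
           has_dir_derivative u p (v + w) (Dv + Dw)"
    proof (intro allI impI)
      fix Dv Dw assume D: "has_dir_derivative u p v Dv" "has_dir_derivative u p w Dw"
      obtain D' where D': "has_dir_derivative u p (v + w) D'" using ex by blast
      have "D' = Dv + Dw"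
        by (rule dir_derivative_add[OF u D D']) (use p in blast)
      then show "has_dir_derivative u p (v + w) (Dv + Dw)" using D' by simp
    qed
  qed
qed

text \<open>Additivity is known almost everywhere only for a fixed pair of directions, so the
  induction runs through the partial sums of the coordinate expansion of the given
  \<open>v\<close>.\<close>

lemma AE_dir_derivative_linear:
  fixes u :: "'a::euclidean_space \<Rightarrow> real"
  assumes u: "L-lipschitz_on UNIV u"
  shows "AE p in lebesgue. \<forall>D. (\<forall>i\<in>Basis. has_dir_derivative u p i (D i)) \<longrightarrow>
           has_dir_derivative u p v (\<Sum>i\<in>Basis. (v \<bullet> i) * D i)"
proof -
  have "AE p in lebesgue. \<forall>D. (\<forall>i\<in>F. has_dir_derivative u p i (D i)) \<longrightarrow>
           has_dir_derivative u p (\<Sum>i\<in>F. (v \<bullet> i) *\<^sub>R i) (\<Sum>i\<in>F. (v \<bullet> i) * D i)" if "finite F" for F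
    using that
  proof induction
    case empty
    then show ?case by (simp add: has_dir_derivative_def)
  next
    case (insert j F)
    from insert.IH AE_dir_derivative_add[OF u, of "(v \<bullet> j) *\<^sub>R j" "\<Sum>i\<in>F. (v \<bullet> i) *\<^sub>R i"]
    show ?case
    proof eventually_elim
      case (elim p)
      then show ?case using insert.hyps has_dir_derivative_scaleR by fastforce
    qed
  qed
  from this[OF finite_Basis] show ?thesis by (simp add: euclidean_representation)
qed

text \<open>Linearity holds simultaneously for a countable dense set of directions. Compactness of
  the unit sphere leaves finitely many of them at accuracy \<open>e\<close>, so their scales have a
  positive minimum, and the Lipschitz bound handles the directions in between.\<close>

theorem lipschitz_AE_has_derivative_real:
  fixes u :: "'a::euclidean_space \<Rightarrow> real"
  assumes u: "L-lipschitz_on UNIV u"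
  shows "AE p in lebesgue. \<exists>A. (u has_derivative A) (at p)"
proof -
  obtain V :: "'a set" where V: "countable V" "\<And>X. open X \<Longrightarrow> X \<noteq> {} \<Longrightarrow> \<exists>v\<in>V. v \<in> X"
    using countable_dense_setE by blast
  have L: "L \<ge> 0" using lipschitz_on_nonneg[OF u] .
  have "AE p in lebesgue. \<forall>v\<in>V. \<forall>D. (\<forall>i\<in>Basis. has_dir_derivative u p i (D i)) \<longrightarrow>
           has_dir_derivative u p v (\<Sum>i\<in>Basis. (v \<bullet> i) * D i)"
    using V(1) by (simp add: AE_ball_countable AE_dir_derivative_linear[OF u])
  moreover have "AE p in lebesgue. \<forall>i\<in>Basis. \<exists>D. has_dir_derivative u p i D"
    using lipschitz_AE_has_dir_derivative[OF u]
    by (simp add: AE_ball_countable countable_finite)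
  ultimately show ?thesis
  proof eventually_elim
    case (elim p)
    obtain D where D: "\<forall>i\<in>Basis. has_dir_derivative u p i (D i)" using elim(2) by metis
    define A where "A = (\<lambda>v. \<Sum>i\<in>Basis. (v \<bullet> i) * D i)"
    have A: "bounded_linear A"
      unfolding A_def by (intro bounded_linear_intros)
    have dA: "has_dir_derivative u p v (A v)" if "v \<in> V" for v
      using elim(1) D that by (auto simp: A_def)
    obtain B where B: "B > 0" "\<And>x. norm (A x) \<le> norm x * B"
      using bounded_linear.pos_bounded[OF A] by blast
    have "\<exists>d>0. \<forall>y. norm (y - p) < d \<longrightarrow> norm (u y - u p - A (y - p)) \<le> \<epsilon> * norm (y - p)" if \<epsilon>: "\<epsilon> > 0" for \<epsilon>
    proof -
      \<comment> \<open>In the denominator, 1 accounts for the difference quotient in direction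
        \<open>v\<close>, \<open>L\<close> and \<open>B\<close> for changing the direction from
        \<open>\<theta>\<close> to \<open>v\<close> in \<open>u\<close> and in
        \<open>A\<close>.\<close>
      define e where "e = \<epsilon> / (L + B + 1)"
      have e: "e > 0" using \<epsilon> L B by (simp add: e_def)
      have "sphere 0 1 \<subseteq> (\<Union>v\<in>V. ball v e)"
      proof
        fix x :: 'a
        obtain v where "v \<in> V" "v \<in> ball x e" using V(2)[of "ball x e"] e by auto
        then show "x \<in> (\<Union>v\<in>V. ball v e)" by (auto simp: dist_commute)
      qed
      then obtain F where F: "F \<subseteq> V" "finite F" "sphere 0 1 \<subseteq> (\<Union>v\<in>F. ball v e)"
        using compactE_image[OF compact_sphere, of V "\<lambda>v. ball v e" 0 1] by auto
      have "\<forall>v\<in>F. \<exists>d>0. \<forall>t. \<bar>t\<bar> < d \<longrightarrow> \<bar>u (p + t *\<^sub>R v) - u p - t * A v\<bar> \<le> e * \<bar>t\<bar>"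
        using dA F(1) e unfolding has_dir_derivative_iff by blast
      then obtain \<delta> where \<delta>: "\<And>v. v \<in> F \<Longrightarrow> \<delta> v > 0"
        "\<And>v t. v \<in> F \<Longrightarrow> \<bar>t\<bar> < \<delta> v \<Longrightarrow> \<bar>u (p + t *\<^sub>R v) - u p - t * A v\<bar> \<le> e * \<bar>t\<bar>"
        by metis
      define d where "d = Min (insert 1 (\<delta> ` F))"
      have d: "d > 0" using F(2) \<delta>(1) by (auto simp: d_def)
      have d': "d \<le> \<delta> v" if "v \<in> F" for v using F(2) that by (auto simp: d_def)
      show ?thesis
      proof (intro exI[of _ d] conjI d allI impI)
        fix y assume y: "norm (y - p) < d"
        show "norm (u y - u p - A (y - p)) \<le> \<epsilon> * norm (y - p)"
        proof (cases "y = p")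
          case True
          then show ?thesis using linear_0[OF bounded_linear.linear[OF A]] by simp
        next
          case False
          define t where "t = norm (y - p)"
          define \<theta> where "\<theta> = (y - p) /\<^sub>R t"
          have t: "t > 0" using False by (simp add: t_def)
          have y': "y = p + t *\<^sub>R \<theta>" using t by (simp add: \<theta>_def)
          have "\<theta> \<in> sphere 0 1" using t by (simp add: \<theta>_def t_def)
          then obtain v where v: "v \<in> F" "dist v \<theta> < e" using F(3) by auto
          have 1: "\<bar>u (p + t *\<^sub>R v) - u p - t * A v\<bar> \<le> e * t"
            using \<delta>(2)[OF v(1), of t] d'[OF v(1)] y t by (simp add: t_def)
          have "dist (p + t *\<^sub>R \<theta>) (p + t *\<^sub>R v) = t * dist v \<theta>"
            using t by (simp add: dist_norm scaleR_diff_right[symmetric] norm_minus_commute)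
          then have "\<bar>u y - u (p + t *\<^sub>R v)\<bar> \<le> L * (t * dist v \<theta>)"
            using lipschitz_onD[OF u, of y "p + t *\<^sub>R v"] by (simp add: dist_real_def y')
          also have "\<dots> \<le> L * (t * e)" using v t L by (intro mult_left_mono) auto
          finally have 2: "\<bar>u y - u (p + t *\<^sub>R v)\<bar> \<le> L * (e * t)" by (simp add: mult.commute)
          have "t * A v - A (y - p) = t * A (v - \<theta>)"
            using t by (simp add: y' bounded_linear.linear[OF A] linear_scale linear_diff right_diff_distrib)
          then have "\<bar>t * A v - A (y - p)\<bar> \<le> t * (dist v \<theta> * B)"
            using B(2)[of "v - \<theta>"] t by (simp add: abs_mult dist_norm)
          also have "\<dots> \<le> t * (e * B)" using v t B by (intro mult_left_mono mult_right_mono) auto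
          finally have 3: "\<bar>t * A v - A (y - p)\<bar> \<le> B * (e * t)" by (simp add: mult_ac)
          have "\<bar>u y - u p - A (y - p)\<bar> \<le> (L + B + 1) * (e * t)"
            using 1 2 3 by (simp add: algebra_simps)
          also have "\<dots> = \<epsilon> * norm (y - p)" using L B by (simp add: e_def t_def)
          finally show ?thesis by simp
        qed
      qed
    qed
    then have "(u has_derivative A) (at p)"
      using A unfolding has_derivative_at_alt by blast
    then show ?case by blast
  qed
qed

section \<open>Mollification\<close>

lemma lborel_distr_reflect: "distr lborel borel (\<lambda>z. x - z) = (lborel :: 'a::euclidean_space measure)"
proof -
  have "density (distr lborel borel (\<lambda>z. x + (-1) *\<^sub>R z)) (\<lambda>_. ennreal (\<bar>-1\<bar> ^ DIM('a))) = (lborel :: 'a measure)"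
    by (rule lborel_affine[symmetric]) simp
  then show ?thesis by (simp add: density_1)
qed

lemma lborel_integral_reflect:
  fixes f :: "'a::euclidean_space \<Rightarrow> real"
  assumes "f \<in> borel_measurable borel"
  shows "(\<integral>z. f (x - z) \<partial>lborel) = (\<integral>z. f z \<partial>lborel)"
proof -
  have "(\<integral>z. f z \<partial>lborel) = (\<integral>z. f z \<partial>distr lborel borel (\<lambda>z. x - z))"
    by (simp only: lborel_distr_reflect)
  also have "\<dots> = (\<integral>z. f (x - z) \<partial>lborel)"
    using assms by (intro integral_distr) auto
  finally show ?thesis by simp
qed

lemma integrable_continuous_compact_support:
  fixes f :: "'a::euclidean_space \<Rightarrow> real"
  assumes "continuous_on UNIV f" "compact S" "\<And>x. x \<notin> S \<Longrightarrow> f x = 0"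
  shows "integrable lborel f"
proof -
  have "integrable lborel (\<lambda>x. indicator S x *\<^sub>R f x)"
    using assms(1,2) by (intro borel_integrable_compact) (auto intro: continuous_on_subset)
  also have "(\<lambda>x. indicator S x *\<^sub>R f x) = f"
    using assms(3) by (auto simp: indicator_def fun_eq_iff)
  finally show ?thesis .
qed

text \<open>Unnormalised kernel supported in the ball of radius \<open>r\<close>. Squaring the
  positive part makes it C^1 with an explicit gradient, and it is even.\<close>

definition bump :: "real \<Rightarrow> 'a::euclidean_space \<Rightarrow> real" where
  "bump r z = (max 0 (r\<^sup>2 - z \<bullet> z))\<^sup>2"

lemma bump_nonneg: "0 \<le> bump r z"
  by (simp add: bump_def)

lemma bump_minus: "bump r (- z) = bump r z"
  by (simp add: bump_def)

lemma bump_eq_0: "0 \<le> r \<Longrightarrow> r \<le> norm z \<Longrightarrow> bump r z = 0"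
  using power_mono[of r "norm z" 2] by (simp add: bump_def power2_norm_eq_inner max_def)

lemma continuous_on_bump [continuous_intros]:
  "continuous_on S f \<Longrightarrow> continuous_on S (\<lambda>x. bump r (f x))"
  unfolding bump_def by (intro continuous_intros)

lemma measurable_bump [measurable]: "bump r \<in> borel_measurable borel"
  by (intro borel_measurable_continuous_onI continuous_intros)

text \<open>The remainder of the first-order expansion is at most \<open>(y - s)\<^sup>2\<close> for
  all signs of \<open>y\<close> and \<open>s\<close>, so the squared positive part is differentiable
  at 0 as well.\<close>

lemma has_real_derivative_max_square:
  "((\<lambda>s. (max 0 s)\<^sup>2) has_real_derivative 2 * max 0 s) (at s)"
proof -
  have "\<bar>(max 0 y)\<^sup>2 - (max 0 s)\<^sup>2 - (y - s) * (2 * max 0 s)\<bar> \<le> (y - s) * (y - s)" for y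
  proof -
    have "(max 0 y)\<^sup>2 - (max 0 s)\<^sup>2 - (y - s) * (2 * max 0 s) =
        (if 0 \<le> y then if 0 \<le> s then y * y - 2 * (s * y) + s * s else y * y
         else if 0 \<le> s then s * s - 2 * (s * y) else 0)"
      by (simp add: max_def power2_eq_square algebra_simps)
    moreover have "(y - s) * (y - s) = y * y - 2 * (s * y) + s * s" by (simp add: algebra_simps)
    moreover have "s * y \<le> 0" if "(0 \<le> s) \<noteq> (0 \<le> y)" using that by (auto simp: mult_le_0_iff)
    ultimately show ?thesis by (smt (verit) zero_le_square)
  qed
  then have quad: "\<bar>(max 0 y)\<^sup>2 - (max 0 s)\<^sup>2 - (y - s) * (2 * max 0 s)\<bar> \<le> \<bar>y - s\<bar> * \<bar>y - s\<bar>" for y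
    by simp
  show ?thesis
    unfolding has_field_derivative_def has_derivative_at_alt
  proof (intro conjI allI impI)
    show "bounded_linear ((*) (2 * max 0 s))" by (rule bounded_linear_mult_right)
    fix e :: real assume "e > 0"
    then show "\<exists>d>0. \<forall>y. norm (y - s) < d \<longrightarrow> norm ((max 0 y)\<^sup>2 - (max 0 s)\<^sup>2 - 2 * max 0 s * (y - s)) \<le> e * norm (y - s)"
      using quad order_trans[OF quad mult_right_mono]
      by (intro exI[of _ e]) (auto simp: mult_ac)
  qed
qed

lemma has_derivative_bump:
  "(bump r has_derivative (\<lambda>h. (- (4 * max 0 (r\<^sup>2 - z \<bullet> z)) *\<^sub>R z) \<bullet> h)) (at z)"
proof -
  have "((\<lambda>z. r\<^sup>2 - z \<bullet> z) has_derivative (\<lambda>h. - 2 * (z \<bullet> h))) (at z)"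
    by (auto intro!: derivative_eq_intros simp: inner_commute)
  from has_derivative_compose[OF this has_real_derivative_max_square[unfolded has_field_derivative_def]]
  have *: "((\<lambda>z. (max 0 (r\<^sup>2 - z \<bullet> z))\<^sup>2) has_derivative (\<lambda>h. 2 * max 0 (r\<^sup>2 - z \<bullet> z) * (- 2 * (z \<bullet> h)))) (at z)" .
  have eq: "bump r = (\<lambda>z. (max 0 (r\<^sup>2 - z \<bullet> z))\<^sup>2)" by (simp add: bump_def fun_eq_iff)
  show ?thesis
    unfolding eq by (rule has_derivative_eq_rhs[OF *]) (simp add: fun_eq_iff)
qed

text \<open>The gradient has norm \<open>4 * (r\<^sup>2 - z \<bullet> z) * norm z\<close> inside the
  ball, where both factors are bounded by powers of \<open>r\<close>, and vanishes outside.\<close>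

lemma bump_lipschitz:
  assumes r: "0 \<le> r"
  shows "\<bar>bump r x - bump r y\<bar> \<le> 4 * r ^ 3 * norm (x - y)"
proof -
  have "norm (bump r x - bump r y) \<le> 4 * r ^ 3 * norm (x - y)"
  proof (rule differentiable_bound[where S = UNIV])
    fix z :: 'a
    show "(bump r has_derivative (\<lambda>h. (- (4 * max 0 (r\<^sup>2 - z \<bullet> z)) *\<^sub>R z) \<bullet> h)) (at z within UNIV)"
      by (rule has_derivative_bump)
    have "norm ((4 * max 0 (r\<^sup>2 - z \<bullet> z)) *\<^sub>R z) \<le> 4 * r ^ 3"
    proof (cases "norm z \<le> r")
      case True
      have "max 0 (r\<^sup>2 - z \<bullet> z) \<le> r\<^sup>2" by simp
      then have "max 0 (r\<^sup>2 - z \<bullet> z) * norm z \<le> r\<^sup>2 * r" using True by (intro mult_mono) auto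
      then show ?thesis by (simp add: power3_eq_cube power2_eq_square)
    next
      case False
      then have "r\<^sup>2 \<le> z \<bullet> z" using power_mono[of r "norm z" 2] r by (simp add: power2_norm_eq_inner)
      then show ?thesis using r by simp
    qed
    then have "norm ((- (4 * max 0 (r\<^sup>2 - z \<bullet> z)) *\<^sub>R z) \<bullet> h) \<le> 4 * r ^ 3 * norm h" for h
      using order_trans[OF Cauchy_Schwarz_ineq2[of "- (4 * max 0 (r\<^sup>2 - z \<bullet> z)) *\<^sub>R z" h] mult_right_mono]
      by simp
    then show "onorm (\<lambda>h. (- (4 * max 0 (r\<^sup>2 - z \<bullet> z)) *\<^sub>R z) \<bullet> h) \<le> 4 * r ^ 3"
      by (intro onorm_le) simp
  qed auto
  then show ?thesis by simp
qed

lemma integrable_times_bump: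
  fixes f :: "'a::euclidean_space \<Rightarrow> real"
  assumes "continuous_on UNIV f" "0 \<le> r"
  shows "integrable lborel (\<lambda>z. f z * bump r (x - z))"
proof (rule integrable_continuous_compact_support)
  show "continuous_on UNIV (\<lambda>z. f z * bump r (x - z))" using assms by (intro continuous_intros)
  show "compact (cball x r)" by simp
  fix z assume "z \<notin> cball x r"
  then show "f z * bump r (x - z) = 0" using assms bump_eq_0[of r "x - z"] by (simp add: dist_norm)
qed

definition bump_mass :: "'a::euclidean_space itself \<Rightarrow> real \<Rightarrow> real" where
  "bump_mass _ r = (\<integral>z. bump r (z :: 'a) \<partial>lborel)"

lemma integral_bump_shift:
  fixes x :: "'a::euclidean_space"
  shows "(\<integral>z. bump r (x - z) \<partial>lborel) = bump_mass TYPE('a) r"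
  unfolding bump_mass_def by (rule lborel_integral_reflect) measurable

text \<open>On the ball of radius \<open>r / 2\<close> the kernel is at least
  \<open>(3 / 4 * r\<^sup>2)\<^sup>2\<close>. The power \<open>r ^ 4\<close> later cancels against
  \<open>bump_lipschitz\<close>, leaving a constant independent of \<open>r\<close>.\<close>

lemma bump_mass_ge:
  assumes r: "0 < r"
  shows "9 / 16 * r ^ 4 * measure lborel (cball (0::'a::euclidean_space) (r / 2)) \<le> bump_mass TYPE('a) r"
proof -
  have "(\<integral>z. 9 / 16 * r ^ 4 * indicator (cball (0::'a) (r / 2)) z \<partial>lborel) \<le> (\<integral>z. bump r (z :: 'a) \<partial>lborel)"
  proof (rule integral_mono)
    show "integrable lborel (\<lambda>z. 9 / 16 * r ^ 4 * indicator (cball (0::'a) (r / 2)) z)"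
      by (intro integrable_mult_right integrable_real_indicator) (use emeasure_lborel_cball_finite[of "0::'a" "r / 2"] in auto)
    show "integrable lborel (bump r :: 'a \<Rightarrow> real)"
      using integrable_times_bump[of "\<lambda>_. 1" r 0] r by (simp add: bump_minus)
    fix z :: 'a
    show "9 / 16 * r ^ 4 * indicator (cball (0::'a) (r / 2)) z \<le> bump r z"
    proof (cases "z \<in> cball 0 (r / 2)")
      case True
      then have "z \<bullet> z \<le> (r / 2)\<^sup>2"
        using power_mono[of "norm z" "r / 2" 2] by (simp add: power2_norm_eq_inner)
      then have "3 / 4 * r\<^sup>2 \<le> max 0 (r\<^sup>2 - z \<bullet> z)" by (simp add: power_divide le_max_iff_disj)
      then have "(3 / 4 * r\<^sup>2)\<^sup>2 \<le> bump r z" unfolding bump_def by (intro power_mono) auto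
      then show ?thesis using True by (simp add: power_mult_distrib power_divide)
    qed (simp add: bump_nonneg)
  qed
  then show ?thesis by (simp add: bump_mass_def)
qed

lemma bump_mass_pos: "0 < r \<Longrightarrow> 0 < bump_mass TYPE('a::euclidean_space) r"
  by (rule less_le_trans[OF _ bump_mass_ge]) (simp add: content_cball_gt_0_iff)

section \<open>The mollified function and its error\<close>

definition mollify :: "real \<Rightarrow> ('a::euclidean_space \<Rightarrow> real) \<Rightarrow> 'a \<Rightarrow> real" where
  "mollify r u x = (\<integral>z. u z * bump r (x - z) \<partial>lborel) / bump_mass TYPE('a) r"

text \<open>The derivative falls on the kernel. The support in a box turns the Lebesgue integral
  into an integral over the box, where the Leibniz rule applies and the gradient depends
  continuously on the parameter.\<close>

lemma mollify_C1:
  fixes u :: "'a::euclidean_space \<Rightarrow> real"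
  assumes u: "continuous_on UNIV u" and supp: "\<And>z. z \<notin> cbox a b \<Longrightarrow> u z = 0" and r: "0 < r"
  obtains g :: "'a \<Rightarrow> 'a" where "continuous_on UNIV g" "\<And>x. (mollify r u has_derivative (\<lambda>h. g x \<bullet> h)) (at x)"
proof -
  define k where "k = (\<lambda>z. - (4 * max 0 (r\<^sup>2 - z \<bullet> z)) *\<^sub>R z :: 'a)"
  define F where "F = (\<lambda>x z. u z *\<^sub>R k (x - z))"
  define c where "c = bump_mass TYPE('a) r"
  have cu: "continuous_on S u" for S using u continuous_on_subset by blast
  have contF: "continuous_on (UNIV \<times> cbox a b) (\<lambda>(x, z). F x z)"
    unfolding F_def k_def split_beta
    by (intro continuous_intros continuous_on_compose2[OF u]) auto
  have inner: "bounded_linear (\<lambda>v::'a. blinfun_inner_right v)"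
    by (rule bounded_linear_blinfun_inner_right)
  have eq: "mollify r u x = integral (cbox a b) (\<lambda>z. u z * bump r (x - z)) / c" for x
  proof -
    have "(\<integral>z. u z * bump r (x - z) \<partial>lborel) = integral UNIV (\<lambda>z. u z * bump r (x - z))"
      using integrable_times_bump[OF u, of r x] r by (intro integral_lborel[symmetric]) auto
    also have "\<dots> = integral (cbox a b) (\<lambda>z. u z * bump r (x - z))"
      by (subst integral_restrict_UNIV[symmetric], rule integral_cong) (auto simp: supp)
    finally show ?thesis by (simp add: mollify_def c_def)
  qed
  have der: "((\<lambda>x. integral (cbox a b) (\<lambda>z. u z * bump r (x - z))) has_derivative
      blinfun_apply (integral (cbox a b) (\<lambda>z. blinfun_inner_right (F x z)))) (at x)" for x
  proof -
    have "((\<lambda>x. integral (cbox a b) (\<lambda>z. u z * bump r (x - z))) has_derivative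
      blinfun_apply (integral (cbox a b) (\<lambda>z. blinfun_inner_right (F x z)))) (at x within UNIV)"
    proof (rule leibniz_rule[where fx = "\<lambda>x z. blinfun_inner_right (F x z)"])
      fix x z :: 'a
      have "((\<lambda>x. x - z) has_derivative (\<lambda>h. h)) (at x)" by (auto intro!: derivative_eq_intros)
      from has_derivative_compose[OF this has_derivative_bump]
      have "((\<lambda>x. u z * bump r (x - z)) has_derivative (\<lambda>h. u z * (k (x - z) \<bullet> h))) (at x)"
        unfolding k_def by (intro has_derivative_mult_right) simp
      then show "((\<lambda>x. u z * bump r (x - z)) has_derivative blinfun_apply (blinfun_inner_right (F x z))) (at x within UNIV)"
        by (auto elim!: has_derivative_eq_rhs simp: F_def fun_eq_iff)
    next
      fix x :: 'a
      show "(\<lambda>z. u z * bump r (x - z)) integrable_on cbox a b"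
        by (intro integrable_continuous continuous_intros cu)
    next
      show "continuous_on (UNIV \<times> cbox a b) (\<lambda>(x, z). blinfun_inner_right (F x z))"
        using bounded_linear.continuous_on[OF inner contF] by (simp add: split_beta)
    qed auto
    then show ?thesis by simp
  qed
  have cF: "F x integrable_on cbox a b" for x
    unfolding F_def k_def by (intro integrable_continuous continuous_intros cu)
  have blin: "blinfun_apply (integral (cbox a b) (\<lambda>z. blinfun_inner_right (F x z))) h = integral (cbox a b) (F x) \<bullet> h" for x h
  proof -
    have "integral (cbox a b) (\<lambda>z. blinfun_inner_right (F x z)) = blinfun_inner_right (integral (cbox a b) (F x))"
      using integral_linear[OF cF inner] by (simp add: o_def)
    then show ?thesis by simp
  qed
  show ?thesis
  proof (rule that[of "\<lambda>x. integral (cbox a b) (F x) /\<^sub>R c"])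
    show "continuous_on UNIV (\<lambda>x. integral (cbox a b) (F x) /\<^sub>R c)"
      by (intro continuous_intros integral_continuous_on_param contF)
    fix x
    have "((\<lambda>x. integral (cbox a b) (\<lambda>z. u z * bump r (x - z)) / c) has_derivative
       (\<lambda>h. blinfun_apply (integral (cbox a b) (\<lambda>z. blinfun_inner_right (F x z))) h / c)) (at x)"
      by (intro bounded_linear.has_derivative[OF bounded_linear_divide] der)
    then show "(mollify r u has_derivative (\<lambda>h. (integral (cbox a b) (F x) /\<^sub>R c) \<bullet> h)) (at x)"
      by (simp add: eq[abs_def] blin divide_inverse mult.commute)
  qed
qed

text \<open>In this form the mollification is an average of translates of \<open>u\<close>, all with
  the Lipschitz constant of \<open>u\<close>.\<close>

lemma mollify_translate:
  fixes u :: "'a::euclidean_space \<Rightarrow> real"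
  assumes "continuous_on UNIV u"
  shows "mollify r u x = (\<integral>z. u (x - z) * bump r z \<partial>lborel) / bump_mass TYPE('a) r"
proof -
  have "(\<lambda>z. u z * bump r (x - z)) \<in> borel_measurable borel"
    by (intro borel_measurable_continuous_onI continuous_intros assms)
  from lborel_integral_reflect[OF this, of x] show ?thesis
    by (simp add: mollify_def)
qed

lemma integrable_times_bump':
  fixes f :: "'a::euclidean_space \<Rightarrow> real"
  assumes "continuous_on UNIV f" "0 \<le> r"
  shows "integrable lborel (\<lambda>z. f z * bump r z)"
  using integrable_times_bump[OF assms, of 0] by (simp add: bump_minus)

lemma mollify_lipschitz:
  fixes u :: "'a::euclidean_space \<Rightarrow> real"
  assumes u: "L-lipschitz_on UNIV u" and r: "0 < r"
  shows "L-lipschitz_on UNIV (mollify r u)"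
proof (rule lipschitz_onI)
  fix x y :: 'a
  define c where "c = bump_mass TYPE('a) r"
  have c: "c > 0" using bump_mass_pos[OF r] by (simp add: c_def)
  have cu: "continuous_on UNIV u" using u by (rule lipschitz_on_continuous_on)
  have cu': "continuous_on UNIV (\<lambda>z. u (x - z))" for x
    by (rule continuous_on_compose2[OF cu]) (auto intro!: continuous_intros)
  note int = integrable_times_bump'[OF cu', of r]
  have "\<bar>(\<integral>z. u (x - z) * bump r z \<partial>lborel) - (\<integral>z. u (y - z) * bump r z \<partial>lborel)\<bar>
      = \<bar>\<integral>z. (u (x - z) - u (y - z)) * bump r z \<partial>lborel\<bar>"
    using int r by (simp add: left_diff_distrib)
  also have "\<dots> \<le> (\<integral>z. L * dist x y * bump r (z :: 'a) \<partial>lborel)"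
  proof (rule integral_abs_bound[THEN order_trans], rule integral_mono)
    show "integrable lborel (\<lambda>z. \<bar>(u (x - z) - u (y - z)) * bump r z\<bar>)"
      using int[of x] int[of y] r by (auto simp: left_diff_distrib)
    show "integrable lborel (\<lambda>z::'a. L * dist x y * bump r z)"
      using integrable_times_bump'[of "\<lambda>_. L * dist x y" r] r by simp
    fix z
    have "\<bar>u (x - z) - u (y - z)\<bar> \<le> L * dist x y"
      using lipschitz_onD[OF u, of "x - z" "y - z"] by (simp add: dist_norm)
    then show "\<bar>(u (x - z) - u (y - z)) * bump r z\<bar> \<le> L * dist x y * bump r z"
      by (simp add: abs_mult bump_nonneg mult_right_mono)
  qed
  also have "\<dots> = L * dist x y * c" by (simp add: c_def bump_mass_def)
  finally show "dist (mollify r u x) (mollify r u y) \<le> L * dist x y"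
    using c by (simp add: mollify_translate[OF cu] c_def[symmetric] dist_real_def field_simps
        flip: diff_divide_distrib)
qed (rule lipschitz_on_nonneg[OF u])

lemma integral_odd_bump: "(\<integral>z. (A \<bullet> (z - x)) * bump r (x - z) \<partial>lborel) = (0::real)"
  for A x :: "'a::euclidean_space"
proof -
  let ?I = "\<integral>z. (A \<bullet> z) * bump r z \<partial>lborel"
  have m: "(\<lambda>z. (A \<bullet> z) * bump r z) \<in> borel_measurable borel" by measurable
  have m': "(\<lambda>z. (A \<bullet> (- z)) * bump r z) \<in> borel_measurable borel" by measurable
  have "?I = (\<integral>z. (A \<bullet> (- z)) * bump r z \<partial>lborel)"
    using lborel_integral_reflect[OF m, of 0] by (simp add: bump_minus)
  also have "\<dots> = - ?I" by simp
  finally have "?I = 0" by simp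
  moreover have "(\<integral>z. (A \<bullet> (z - x)) * bump r (x - z) \<partial>lborel) = (\<integral>z. (A \<bullet> (- z)) * bump r z \<partial>lborel)"
    using lborel_integral_reflect[OF m', of x] by simp
  ultimately show ?thesis by simp
qed

text \<open>The kernel is even and hence reproduces affine functions.\<close>

lemma mollify_affine_error:
  fixes u :: "'a::euclidean_space \<Rightarrow> real"
  assumes u: "continuous_on UNIV u" and r: "0 < r"
  shows "mollify r u x - u p - A \<bullet> (x - p) =
    (\<integral>z. (u z - u p - A \<bullet> (z - p)) * bump r (x - z) \<partial>lborel) / bump_mass TYPE('a) r"
proof -
  define c where "c = bump_mass TYPE('a) r"
  have c: "c > 0" using bump_mass_pos[OF r] by (simp add: c_def)
  have i1: "integrable lborel (\<lambda>z. u z * bump r (x - z))"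
    using integrable_times_bump[OF u] r by simp
  have i2: "integrable lborel (\<lambda>z. (u p + A \<bullet> (x - p)) * bump r (x - z))"
    using integrable_times_bump[of "\<lambda>_. u p + A \<bullet> (x - p)" r x] r by simp
  have i3: "integrable lborel (\<lambda>z. (A \<bullet> (z - x)) * bump r (x - z))"
    using integrable_times_bump[of "\<lambda>z. A \<bullet> (z - x)" r x] r by (simp add: continuous_intros)
  have "(\<lambda>z. (u z - u p - A \<bullet> (z - p)) * bump r (x - z)) =
    (\<lambda>z. u z * bump r (x - z) - (u p + A \<bullet> (x - p)) * bump r (x - z) - (A \<bullet> (z - x)) * bump r (x - z))"
    by (simp add: algebra_simps)
  then have "(\<integral>z. (u z - u p - A \<bullet> (z - p)) * bump r (x - z) \<partial>lborel) =
     (\<integral>z. u z * bump r (x - z) \<partial>lborel) - (\<integral>z. (u p + A \<bullet> (x - p)) * bump r (x - z) \<partial>lborel)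
     - (\<integral>z. (A \<bullet> (z - x)) * bump r (x - z) \<partial>lborel)"
    using i1 i2 i3 by simp
  also have "\<dots> = c * mollify r u x - c * (u p + A \<bullet> (x - p))"
    using c by (simp add: integral_odd_bump mollify_def c_def[symmetric] integral_bump_shift)
  finally show ?thesis using c by (simp add: c_def[symmetric] field_simps)
qed

text \<open>Counterpart of \<open>uniform_slope_set\<close> for the full derivative: one gradient
  \<open>A\<close> and one scale \<open>d\<close> serve all points of the set.\<close>

definition slope_set :: "('a::euclidean_space \<Rightarrow> real) \<Rightarrow> 'a \<Rightarrow> real \<Rightarrow> real \<Rightarrow> 'a set" where
  "slope_set u A e d = {p. \<forall>h. norm h \<le> d \<longrightarrow> \<bar>u (p + h) - u p - A \<bullet> h\<bar> \<le> e * norm h}"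

lemma slope_setD:
  "p \<in> slope_set u A e d \<Longrightarrow> norm (z - p) \<le> d \<Longrightarrow> \<bar>u z - u p - A \<bullet> (z - p)\<bar> \<le> e * norm (z - p)"
  unfolding slope_set_def by (auto dest!: spec[of _ "z - p"])

lemma mollify_error_pointwise:
  fixes u :: "'a::euclidean_space \<Rightarrow> real"
  assumes u: "continuous_on UNIV u" and r: "0 < r" and p: "p \<in> slope_set u A e (2 * r)" and e: "0 \<le> e"
  shows "\<bar>mollify r u p - u p\<bar> \<le> e * r"
proof -
  define c where "c = bump_mass TYPE('a) r"
  have c: "c > 0" using bump_mass_pos[OF r] by (simp add: c_def)
  have ca: "continuous_on UNIV (\<lambda>z. u z - u p - A \<bullet> (z - p))" by (intro continuous_intros u)
  define I where "I = (\<integral>z. (u z - u p - A \<bullet> (z - p)) * bump r (p - z) \<partial>lborel)"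
  have "\<bar>I\<bar> \<le> (\<integral>z. e * r * bump r (p - z) \<partial>lborel)"
    unfolding I_def
  proof (rule integral_abs_bound[THEN order_trans], rule integral_mono)
    show "integrable lborel (\<lambda>z. \<bar>(u z - u p - A \<bullet> (z - p)) * bump r (p - z)\<bar>)"
      using integrable_times_bump[OF ca, of r p] r by (intro integrable_abs) simp
    show "integrable lborel (\<lambda>z. e * r * bump r (p - z))"
      using integrable_times_bump[of "\<lambda>_. e * r" r p] r by simp
    fix z
    show "\<bar>(u z - u p - A \<bullet> (z - p)) * bump r (p - z)\<bar> \<le> e * r * bump r (p - z)"
    proof (cases "norm (z - p) \<le> r")
      case True
      then have "\<bar>u z - u p - A \<bullet> (z - p)\<bar> \<le> e * norm (z - p)" using slope_setD[OF p, of z] r by simp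
      also have "\<dots> \<le> e * r" using True e by (rule mult_left_mono)
      finally show ?thesis by (simp add: abs_mult bump_nonneg mult_right_mono)
    next
      case False
      then show ?thesis using bump_eq_0[of r "p - z"] r by (simp add: norm_minus_commute)
    qed
  qed
  also have "\<dots> = e * r * c" by (simp add: c_def integral_bump_shift)
  finally have "\<bar>I / c\<bar> \<le> e * r" using c by (simp add: abs_divide pos_divide_le_eq)
  moreover have "mollify r u p - u p = I / c"
    using mollify_affine_error[OF u r, of p p A, folded I_def c_def] by simp
  ultimately show ?thesis by simp
qed

text \<open>Differencing the kernels, and not the errors, produces the factor
  \<open>norm (q - p)\<close>. Both kernels live in the ball of radius \<open>2 * r\<close> about
  \<open>p\<close>, where the affine error is at most \<open>e * (2 * r)\<close>. The constant
  combines this 2, the 4 of \<open>bump_lipschitz\<close>, the 16/9 of \<open>bump_mass_ge\<close>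
  and the volume ratio \<open>4 ^ DIM('a)\<close> of the balls of radii \<open>2 * r\<close> and
  \<open>r / 2\<close>; and 128/9 is below 15.\<close>

lemma mollify_error_difference:
  fixes u :: "'a::euclidean_space \<Rightarrow> real"
  assumes u: "continuous_on UNIV u" and r: "0 < r" and p: "p \<in> slope_set u A e (2 * r)" and e: "0 \<le> e"
    and q: "norm (q - p) \<le> r"
  shows "\<bar>mollify r u q - mollify r u p - A \<bullet> (q - p)\<bar> \<le> 15 * 4 ^ DIM('a) * e * norm (q - p)"
proof -
  define c where "c = bump_mass TYPE('a) r"
  have c: "c > 0" using bump_mass_pos[OF r] by (simp add: c_def)
  define a where "a = (\<lambda>z. u z - u p - A \<bullet> (z - p))"
  have ca: "continuous_on UNIV a" unfolding a_def by (intro continuous_intros u)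
  note int = integrable_times_bump[OF ca, of r]
  define I where "I = (\<lambda>x. \<integral>z. a z * bump r (x - z) \<partial>lborel)"
  have err: "mollify r u x - u p - A \<bullet> (x - p) = I x / c" for x
    unfolding I_def a_def c_def by (rule mollify_affine_error[OF u r])
  have "mollify r u q - mollify r u p - A \<bullet> (q - p) = I q / c - I p / c"
    using err[of q] err[of p] by simp
  then have "(mollify r u q - mollify r u p - A \<bullet> (q - p)) * c = I q - I p"
    using c by (simp add: left_diff_distrib)
  also have "\<dots> = (\<integral>z. a z * (bump r (q - z) - bump r (p - z)) \<partial>lborel)"
    using int[of p] int[of q] r by (simp add: I_def right_diff_distrib)
  finally have eq: "(mollify r u q - mollify r u p - A \<bullet> (q - p)) * c =
      (\<integral>z. a z * (bump r (q - z) - bump r (p - z)) \<partial>lborel)" .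
  define M where "M = e * (2 * r) * (4 * r ^ 3 * norm (q - p))"
  define V where "V = measure lborel (cball (0::'a) (r / 2))"
  have V2: "measure lborel (cball p (2 * r)) = 4 ^ DIM('a) * V"
  proof -
    have "measure lborel (cball p (2 * r)) = unit_ball_vol (real DIM('a)) * (2 * r) ^ DIM('a)"
      using r by (intro content_cball) simp
    moreover have "V = unit_ball_vol (real DIM('a)) * (r / 2) ^ DIM('a)"
      unfolding V_def using r by (intro content_cball) simp
    moreover have "4 ^ DIM('a) * (r / 2) ^ DIM('a) = (2 * r) ^ DIM('a)"
      using power_mult_distrib[of 4 "r / 2" "DIM('a)"] by simp
    ultimately show ?thesis by simp
  qed
  have "\<bar>\<integral>z. a z * (bump r (q - z) - bump r (p - z)) \<partial>lborel\<bar> \<le> (\<integral>z. M * indicator (cball p (2 * r)) z \<partial>lborel)"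
  proof (rule integral_abs_bound[THEN order_trans], rule integral_mono)
    show "integrable lborel (\<lambda>z. \<bar>a z * (bump r (q - z) - bump r (p - z))\<bar>)"
      using int[of p] int[of q] r by (auto simp: right_diff_distrib)
    show "integrable lborel (\<lambda>z. M * indicator (cball p (2 * r)) z)"
      by (intro integrable_mult_right integrable_real_indicator) (use emeasure_lborel_cball_finite[of p "2 * r"] in auto)
    fix z
    show "\<bar>a z * (bump r (q - z) - bump r (p - z))\<bar> \<le> M * indicator (cball p (2 * r)) z"
    proof (cases "norm (z - p) \<le> 2 * r")
      case True
      then have "\<bar>a z\<bar> \<le> e * norm (z - p)" using slope_setD[OF p True] by (simp add: a_def)
      also have "\<dots> \<le> e * (2 * r)" using True e by (rule mult_left_mono)
      finally have "\<bar>a z\<bar> * \<bar>bump r (q - z) - bump r (p - z)\<bar> \<le> e * (2 * r) * (4 * r ^ 3 * norm (q - p))"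
        using bump_lipschitz[of r "q - z" "p - z"] r e by (intro mult_mono) auto
      then show ?thesis using True by (simp add: abs_mult M_def dist_norm norm_minus_commute)
    next
      case False
      have "norm (z - p) \<le> norm (z - q) + norm (q - p)"
        using norm_triangle_ineq[of "z - q" "q - p"] by simp
      then have "bump r (q - z) = 0" "bump r (p - z) = 0"
        using False q r by (auto intro!: bump_eq_0 simp: norm_minus_commute)
      then show ?thesis using False by (simp add: dist_norm norm_minus_commute)
    qed
  qed
  also have "\<dots> = M * (4 ^ DIM('a) * V)" by (simp add: V2)
  also have "\<dots> = (8 * 4 ^ DIM('a) * e * norm (q - p)) * (r ^ 4 * V)"
    by (simp add: M_def power4_eq_xxxx power3_eq_cube)
  also have "\<dots> \<le> (8 * 4 ^ DIM('a) * e * norm (q - p)) * (16 / 9 * c)"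
    using bump_mass_ge[OF r, where 'a = 'a] e by (intro mult_left_mono) (auto simp: V_def c_def)
  also have "\<dots> = (128 / 9 * 4 ^ DIM('a) * e * norm (q - p)) * c" by simp
  also have "\<dots> \<le> (15 * 4 ^ DIM('a) * e * norm (q - p)) * c"
    using c e by (intro mult_right_mono) auto
  finally have "\<bar>mollify r u q - mollify r u p - A \<bullet> (q - p)\<bar> * c \<le> (15 * 4 ^ DIM('a) * e * norm (q - p)) * c"
    using c by (simp add: eq[symmetric] abs_mult)
  then show ?thesis using c by simp
qed

section \<open>Lusin approximation\<close>

text \<open>McShane's extension, clamped between \<open>- T\<close> and \<open>T\<close> for a
  compactly supported tent \<open>T\<close>. The constant \<open>L\<close> is preserved exactly, as
  the halving in \<open>lusin_C1\<close> requires, and the support condition is the one in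
  \<open>mollify_C1\<close>.\<close>

lemma lipschitz_extension_compact_support:
  fixes u :: "'a::euclidean_space \<Rightarrow> real"
  assumes u: "L-lipschitz_on E u" and E: "bounded E" and L: "0 < L"
  obtains v a b where "L-lipschitz_on UNIV v" "\<And>x. x \<in> E \<Longrightarrow> v x = u x" "\<And>z. z \<notin> cbox a b \<Longrightarrow> v z = 0"
proof (cases "E = {}")
  case True
  show ?thesis by (rule that[of "\<lambda>_. 0" 0 0]) (use True L in \<open>auto intro: lipschitz_onI\<close>)
next
  case False
  then obtain x0 where x0: "x0 \<in> E" by auto
  obtain R where R: "\<And>x. x \<in> E \<Longrightarrow> norm x \<le> R" using E unfolding bounded_iff by blast
  have lip: "\<bar>u x - u y\<bar> \<le> L * dist x y" if "x \<in> E" "y \<in> E" for x y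
    using lipschitz_onD[OF u that] by (simp add: dist_real_def)
  define M where "M = \<bar>u x0\<bar> + L * (2 * R)"
  have M: "\<bar>u x\<bar> \<le> M" if x: "x \<in> E" for x
  proof -
    have "dist x x0 \<le> 2 * R" using R[OF x] R[OF x0] norm_triangle_ineq4[of x x0] by (simp add: dist_norm)
    then have "L * dist x x0 \<le> L * (2 * R)" using L by (intro mult_left_mono) auto
    then show ?thesis using lip[OF x x0] unfolding M_def by linarith
  qed
  define ext where "ext = (\<lambda>x. INF e\<in>E. u e + L * dist x e)"
  have bdd: "bdd_below ((\<lambda>e. u e + L * dist x e) ` E)" for x
  proof (rule bdd_belowI2)
    fix e assume e: "e \<in> E"
    have "L * dist x0 e \<le> L * (dist x x0 + dist x e)"
      using dist_triangle[of x0 e x] L by (intro mult_left_mono) (auto simp: dist_commute)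
    then show "u x0 - L * dist x x0 \<le> u e + L * dist x e"
      using lip[OF x0 e] by (simp add: distrib_left abs_le_iff)
  qed
  have ext_le: "ext x \<le> ext y + L * dist x y" for x y
  proof -
    have "ext x - L * dist x y \<le> ext y"
      unfolding ext_def
    proof (rule cINF_greatest[OF False])
      fix e assume e: "e \<in> E"
      have "(INF e\<in>E. u e + L * dist x e) \<le> u e + L * dist x e" by (rule cINF_lower[OF bdd e])
      moreover have "L * dist x e \<le> L * (dist x y + dist y e)"
        using dist_triangle[of x e y] L by (intro mult_left_mono) auto
      ultimately show "(INF e\<in>E. u e + L * dist x e) - L * dist x y \<le> u e + L * dist y e"
        by (simp add: distrib_left)
    qed
    then show ?thesis by simp
  qed
  have ext_lip: "\<bar>ext x - ext y\<bar> \<le> L * dist x y" for x y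
    using ext_le[of x y] ext_le[of y x] by (simp add: dist_commute abs_le_iff)
  have ext_eq: "ext x = u x" if x: "x \<in> E" for x
  proof (rule antisym)
    show "ext x \<le> u x" using cINF_lower[OF bdd[of x] x] by (simp add: ext_def)
    show "u x \<le> ext x"
      unfolding ext_def
    proof (rule cINF_greatest[OF False])
      fix e assume "e \<in> E"
      then show "u x \<le> u e + L * dist x e" using lip[OF x, of e] by (simp add: abs_le_iff)
    qed
  qed
  \<comment> \<open>The tent is at least \<open>M\<close> on \<open>E\<close>, where
    \<open>M\<close> bounds \<open>u\<close>, and descends with slope \<open>L\<close> to reach 0 at
    norm \<open>R + M / L\<close>.\<close>
  define T where "T = (\<lambda>x::'a. max 0 (M + L * (R - norm x)))"
  have T_lip: "\<bar>T x - T y\<bar> \<le> L * dist x y" for x y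
  proof -
    have "\<bar>T x - T y\<bar> \<le> \<bar>L * (R - norm x) - L * (R - norm y)\<bar>" by (auto simp: T_def max_def)
    also have "\<dots> = L * \<bar>norm y - norm x\<bar>"
      using L by (simp add: abs_mult flip: right_diff_distrib)
    also have "\<dots> \<le> L * dist x y"
      using L norm_triangle_ineq3[of y x] by (intro mult_left_mono) (auto simp: dist_norm norm_minus_commute)
    finally show ?thesis .
  qed
  define v where "v = (\<lambda>x. max (- T x) (min (T x) (ext x)))"
  have "L-lipschitz_on UNIV v"
  proof (rule lipschitz_onI)
    fix x y
    show "dist (v x) (v y) \<le> L * dist x y"
      using T_lip[of x y] ext_lip[of x y] unfolding v_def dist_real_def by linarith
  qed (use L in simp)
  moreover have "v x = u x" if x: "x \<in> E" for x
  proof -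
    have "0 \<le> L * (R - norm x)" using R[OF x] L by simp
    then have "M \<le> T x" by (simp add: T_def)
    then show ?thesis using M[OF x] by (simp add: v_def ext_eq[OF x] abs_le_iff)
  qed
  moreover obtain c :: 'a where c: "cball 0 (R + M / L) \<subseteq> cbox (- c) c"
    using bounded_subset_cbox_symmetric[OF bounded_cball] by metis
  have "v z = 0" if "z \<notin> cbox (- c) c" for z
  proof -
    have "z \<notin> cball 0 (R + M / L)" using that c by blast
    then have "R + M / L < norm z" by simp
    then have "M + L * (R - norm z) \<le> 0" using L by (simp add: field_simps)
    then have "T z = 0" by (simp add: T_def)
    then show ?thesis by (simp add: v_def)
  qed
  ultimately show ?thesis using that by blast
qed

section \<open>Sets of almost constant slope and one approximation step\<close>

lemma closed_slope_set:
  assumes u: "continuous_on UNIV u"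
  shows "closed (slope_set u A e d)"
  unfolding slope_set_def
  by (intro closed_Collect_all closed_Collect_imp open_Collect_const closed_Collect_le continuous_intros
      continuous_on_shift u)

lemma linear_functional_inner:
  fixes A :: "'a::euclidean_space \<Rightarrow> real"
  assumes "linear A"
  shows "A h = (\<Sum>i\<in>Basis. A i *\<^sub>R i) \<bullet> h"
proof -
  have "A h = A (\<Sum>i\<in>Basis. (h \<bullet> i) *\<^sub>R i)" by (simp add: euclidean_representation)
  also have "\<dots> = (\<Sum>i\<in>Basis. (h \<bullet> i) * A i)" by (simp add: linear_sum[OF assms] linear_scale[OF assms])
  finally show ?thesis by (simp add: inner_sum_left inner_commute[of h] mult.commute)
qed

text \<open>Gradients from a countable dense set and scales \<open>1 / real (Suc k)\<close> leave
  countably many slope sets to consider. Half of \<open>e\<close> pays for differentiability, half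
  for moving the gradient into \<open>D\<close>.\<close>

lemma differentiable_in_slope_set:
  fixes u :: "'a::euclidean_space \<Rightarrow> real"
  assumes "(u has_derivative A) (at p)" and e: "0 < e" and D: "\<And>X. open X \<Longrightarrow> X \<noteq> {} \<Longrightarrow> \<exists>a\<in>D. a \<in> X"
  obtains a k where "a \<in> D" "p \<in> slope_set u a e (1 / real (Suc k))" "\<And>h. \<bar>A h - a \<bullet> h\<bar> \<le> e * norm h"
proof -
  have lin: "linear A" using assms(1) by (rule has_derivative_linear)
  define c where "c = (\<Sum>i\<in>Basis. A i *\<^sub>R i)"
  have A: "A h = c \<bullet> h" for h unfolding c_def by (rule linear_functional_inner[OF lin])
  obtain a where a: "a \<in> D" "dist c a < e / 2" using D[of "ball c (e / 2)"] e by auto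
  obtain d where d: "d > 0" "\<And>z. norm (z - p) < d \<Longrightarrow> \<bar>u z - u p - c \<bullet> (z - p)\<bar> \<le> e / 2 * norm (z - p)"
    using assms(1) e unfolding has_derivative_at_alt A real_norm_def by (meson half_gt_zero)
  obtain k where k: "1 / real (Suc k) < d" using nat_approx_posE[OF d(1)] by metis
  have "p \<in> slope_set u a e (1 / real (Suc k))"
    unfolding slope_set_def
  proof (intro CollectI allI impI)
    fix h :: 'a assume "norm h \<le> 1 / real (Suc k)"
    then have 1: "\<bar>u (p + h) - u p - c \<bullet> h\<bar> \<le> e / 2 * norm h" using k d(2)[of "p + h"] by simp
    have "\<bar>(c - a) \<bullet> h\<bar> \<le> norm (c - a) * norm h" by (rule Cauchy_Schwarz_ineq2)
    also have "\<dots> \<le> e / 2 * norm h" using a by (intro mult_right_mono) (auto simp: dist_norm)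
    finally have 2: "\<bar>c \<bullet> h - a \<bullet> h\<bar> \<le> e / 2 * norm h" by (simp add: inner_diff_left)
    have "e / 2 * norm h + e / 2 * norm h = e * norm h" by simp
    then show "\<bar>u (p + h) - u p - a \<bullet> h\<bar> \<le> e * norm h" using 1 2 by linarith
  qed
  moreover have "\<bar>A h - a \<bullet> h\<bar> \<le> e * norm h" for h
  proof -
    have "\<bar>(c - a) \<bullet> h\<bar> \<le> norm (c - a) * norm h" by (rule Cauchy_Schwarz_ineq2)
    also have "\<dots> \<le> e * norm h" using a e by (intro mult_right_mono) (auto simp: dist_norm)
    finally show ?thesis by (simp add: A inner_diff_left)
  qed
  ultimately show ?thesis using a(1) that by blast
qed

lemma slope_set_mono: "d' \<le> d \<Longrightarrow> slope_set u A e d \<subseteq> slope_set u A e d'"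
  by (auto simp: slope_set_def)

text \<open>Up to measure \<open>\<eta>\<close>, one scale \<open>2 * r\<close> works at all points
  of \<open>B\<close>. After mollification at radius \<open>r\<close>, good points at distance at
  most \<open>r\<close> are compared through \<open>mollify_error_difference\<close>, the others
  through the pointwise error, which is small against \<open>r\<close>.\<close>

lemma lusin_step:
  fixes u :: "'a::euclidean_space \<Rightarrow> real"
  assumes u: "L-lipschitz_on UNIV u" and supp: "\<And>z. z \<notin> cbox a b \<Longrightarrow> u z = 0"
    and \<delta>: "0 < \<delta>" and B: "B \<in> lmeasurable" and \<eta>: "0 < \<eta>"
  obtains E w g where "E \<in> sets borel" "emeasure lebesgue (B - E) < ennreal \<eta>"
    "continuous_on UNIV g" "\<And>x. (w has_derivative (\<lambda>h. g x \<bullet> h)) (at x)" "L-lipschitz_on UNIV w"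
    "\<delta>-lipschitz_on E (\<lambda>x. u x - w x)" "\<And>x. x \<in> E \<Longrightarrow> \<bar>u x - w x\<bar> \<le> \<delta>"
proof -
  have cu: "continuous_on UNIV u" using u by (rule lipschitz_on_continuous_on)
  obtain D :: "'a set" where D: "countable D" "\<And>X. open X \<Longrightarrow> X \<noteq> {} \<Longrightarrow> \<exists>v\<in>D. v \<in> X"
    using countable_dense_setE by blast
  \<comment> \<open>The 1 is the slope error of \<open>u\<close>, the other term that of its
    mollification; \<open>C \<ge> 2\<close> also absorbs the two pointwise errors at points further
    than \<open>r\<close> apart.\<close>
  define C where "C = 1 + 15 * (4 :: real) ^ DIM('a)"
  have C: "C \<ge> 2" using one_le_power[of "4 :: real" "DIM('a)"] unfolding C_def by linarith
  define e where "e = \<delta> / C"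
  have e: "0 < e" "C * e = \<delta>" using \<delta> C by (auto simp: e_def)
  define U where "U = (\<lambda>k. \<Union>A\<in>D. slope_set u A e (1 / real (Suc k)))"
  have U: "U k \<in> sets borel" for k
    unfolding U_def using D(1) by (intro sets.countable_UN') (auto intro: borel_closed closed_slope_set[OF cu])
  have "AE p in lebesgue. p \<in> (\<Union>k. U k)"
    using lipschitz_AE_has_derivative_real[OF u]
  proof (rule eventually_mono)
    fix p assume "\<exists>A. (u has_derivative A) (at p)"
    then obtain A where "(u has_derivative A) (at p)" by blast
    then obtain a k where "a \<in> D" "p \<in> slope_set u a e (1 / real (Suc k))"
      by (rule differentiable_in_slope_set[OF _ e(1) D(2)])
    then show "p \<in> (\<Union>k. U k)" unfolding U_def by blast
  qed
  then have null: "negligible (- (\<Union>k. U k))" by (simp add: AE_lebesgue_iff_negligible Compl_eq)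
  have mono: "U k \<subseteq> U l" if "k \<le> l" for k l
    unfolding U_def using that by (intro UN_mono slope_set_mono) (auto simp: field_simps)
  \<comment> \<open>The sets \<open>U k\<close> increase and exhaust almost everything; continuity
    from above on \<open>B\<close>, of finite measure, yields a single good scale.\<close>
  have "(\<lambda>k. emeasure lebesgue (B - U k)) \<longlonglongrightarrow> emeasure lebesgue (\<Inter>k. B - U k)"
  proof (rule Lim_emeasure_decseq)
    show "range (\<lambda>k. B - U k) \<subseteq> sets lebesgue" using B U by auto
    show "decseq (\<lambda>k. B - U k)" unfolding decseq_def using mono by blast
    fix k
    have "emeasure lebesgue (B - U k) \<le> emeasure lebesgue B" using B by (intro emeasure_mono) auto
    then show "emeasure lebesgue (B - U k) \<noteq> \<infinity>" using B by (auto simp: fmeasurable_def top_unique)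
  qed
  moreover have "emeasure lebesgue (\<Inter>k. B - U k) = 0"
  proof -
    have "negligible (\<Inter>k. B - U k)" by (rule negligible_subset[OF null]) auto
    then show ?thesis by (auto simp: negligible_iff_null_sets)
  qed
  ultimately have "\<forall>\<^sub>F k in sequentially. emeasure lebesgue (B - U k) < ennreal \<eta>"
    using \<eta> by (auto intro: order_tendstoD(2))
  then obtain k where k: "emeasure lebesgue (B - U k) < ennreal \<eta>"
    using eventually_happens' sequentially_bot by blast
  define r where "r = 1 / (2 * real (Suc k))"
  have r: "0 < r" "2 * r = 1 / real (Suc k)" "r \<le> 1" by (auto simp: r_def field_simps)
  define w where "w = mollify r u"
  obtain g where g: "continuous_on UNIV g" "\<And>x. (w has_derivative (\<lambda>h. g x \<bullet> h)) (at x)"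
    using mollify_C1[OF cu supp r(1)] unfolding w_def by blast
  have close: "\<bar>u p - w p\<bar> \<le> e * r" if pU: "p \<in> U k" for p
  proof -
    obtain A where "p \<in> slope_set u A e (2 * r)" using pU unfolding U_def r by auto
    from mollify_error_pointwise[OF cu r(1) this] e show ?thesis by (simp add: w_def abs_minus_commute)
  qed
  show ?thesis
  proof (rule that[OF U k g])
    show "L-lipschitz_on UNIV w" unfolding w_def by (rule mollify_lipschitz[OF u r(1)])
    show "\<bar>u x - w x\<bar> \<le> \<delta>" if "x \<in> U k" for x
    proof -
      have "e * r \<le> C * e" using r e C by (smt (verit) mult.commute mult_left_mono)
      then show ?thesis using close[OF that] e by simp
    qed
    show "\<delta>-lipschitz_on (U k) (\<lambda>x. u x - w x)"
    proof (rule lipschitz_onI)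
      fix q p assume qp: "q \<in> U k" "p \<in> U k"
      show "dist (u q - w q) (u p - w p) \<le> \<delta> * dist q p"
      proof (cases "norm (q - p) \<le> r")
        case True
        obtain A where p: "p \<in> slope_set u A e (2 * r)" using qp(2) unfolding U_def r by auto
        have "\<bar>w q - w p - A \<bullet> (q - p)\<bar> \<le> 15 * 4 ^ DIM('a) * e * norm (q - p)"
          unfolding w_def using e by (intro mollify_error_difference[OF cu r(1) p _ True]) simp
        moreover have "\<bar>u q - u p - A \<bullet> (q - p)\<bar> \<le> e * norm (q - p)"
          using slope_setD[OF p, of q] True r by simp
        ultimately have "\<bar>(u q - w q) - (u p - w p)\<bar> \<le> e * norm (q - p) + 15 * 4 ^ DIM('a) * e * norm (q - p)"
          by linarith
        also have "\<dots> = C * e * norm (q - p)" by (simp add: C_def algebra_simps)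
        finally show ?thesis by (simp add: e dist_norm)
      next
        case False
        have "\<bar>(u q - w q) - (u p - w p)\<bar> \<le> 2 * (e * r)" using close[OF qp(1)] close[OF qp(2)] by linarith
        also have "\<dots> \<le> C * (e * r)" using C e r by (intro mult_right_mono) auto
        also have "\<dots> \<le> C * (e * norm (q - p))" using False C e by (intro mult_left_mono) auto
        also have "\<dots> = C * e * norm (q - p)" by simp
        finally show ?thesis by (simp add: e dist_norm)
      qed
    qed (use \<delta> in simp)
  qed
qed

text \<open>The slope inequality is tested at distance exactly \<open>d\<close> in the direction of
  \<open>a\<close>. This bounds the candidate slopes uniformly in
  \<open>straightening_piece\<close>.\<close>

lemma norm_slope_le:
  fixes u :: "'a::euclidean_space \<Rightarrow> real"
  assumes lip: "L-lipschitz_on UNIV u" and p: "p \<in> slope_set u a e d" and "0 < d" "0 \<le> e"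
  shows "norm a \<le> L + e"
proof (cases "a = 0")
  case False
  define h where "h = (d / norm a) *\<^sub>R a"
  have h: "norm h = d" "a \<bullet> h = d * norm a"
    using False \<open>0 < d\<close> by (simp_all add: h_def power2_norm_eq_inner[symmetric] power2_eq_square)
  have "\<bar>u (p + h) - u p - a \<bullet> h\<bar> \<le> e * norm h" using p h(1) unfolding slope_set_def by (blast intro: eq_refl)
  moreover have "\<bar>u (p + h) - u p\<bar> \<le> L * norm h"
    using lipschitz_onD[OF lip, of "p + h" p] by (simp add: dist_norm)
  ultimately have "d * norm a \<le> d * (L + e)" unfolding h by (simp add: algebra_simps)
  then show ?thesis using \<open>0 < d\<close> by simp
qed (use lipschitz_on_nonneg[OF lip] \<open>0 \<le> e\<close> in simp)

lemma norm_gradient_le: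
  fixes w :: "'a::euclidean_space \<Rightarrow> real"
  assumes lip: "L-lipschitz_on UNIV w" and der: "(w has_derivative (\<lambda>h. g \<bullet> h)) (at x)"
  shows "norm g \<le> L"
proof (rule field_le_epsilon)
  fix e :: real assume e: "0 < e"
  obtain d where d: "d > 0" "\<And>y. norm (y - x) < d \<Longrightarrow> \<bar>w y - w x - g \<bullet> (y - x)\<bar> \<le> e * norm (y - x)"
    using der e unfolding has_derivative_at_alt real_norm_def by blast
  have "x \<in> slope_set w g e (d / 2)"
    unfolding slope_set_def
  proof (intro CollectI allI impI)
    fix h :: 'a assume "norm h \<le> d / 2"
    then show "\<bar>w (x + h) - w x - g \<bullet> h\<bar> \<le> e * norm h" using d(2)[of "x + h"] d(1) by simp
  qed
  then show "norm g \<le> L + e" by (rule norm_slope_le[OF lip]) (use d(1) e in auto)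
qed

text \<open>Iterating the previous lemma on the errors \<open>u - w\<close>, extended from the good set, with Lipschitz constants
  \<open>L / 2 ^ k\<close>, represents \<open>u\<close> off a small set as a series that converges in \<open>C\<^sup>1\<close>.\<close>

theorem lusin_C1:
  fixes u :: "'a::euclidean_space \<Rightarrow> real"
  assumes u: "L-lipschitz_on B u" and L: "0 < L" and B: "B \<in> lmeasurable" "bounded B" and \<eta>: "0 < \<eta>"
  obtains h g where "continuous_on UNIV g" "\<And>x. (h has_derivative (\<lambda>v. g x \<bullet> v)) (at x)"
    "\<And>x. norm (g x) \<le> 2 * L" and "\<exists>N\<in>sets lebesgue. {x \<in> B. h x \<noteq> u x} \<subseteq> N \<and> emeasure lebesgue N \<le> ennreal \<eta>"
proof -
  \<comment> \<open>\<open>P k v\<close> makes \<open>v\<close> a possible error at stage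
    \<open>k\<close>. \<open>R\<close> records one use of \<open>lusin_step\<close> with
    approximation \<open>w\<close>, gradient \<open>g\<close> and good set \<open>E\<close>;
    \<open>Q\<close> relates \<open>v\<close> to the next error, prescribed only on
    \<open>B \<inter> E\<close>.\<close>
  define P where "P = (\<lambda>k (v :: 'a \<Rightarrow> real). (L / 2 ^ k)-lipschitz_on UNIV v \<and> (\<exists>a b. \<forall>z. z \<notin> cbox a b \<longrightarrow> v z = (0::real)))"
  define R where "R = (\<lambda>k v w (E :: 'a set) g. E \<in> sets borel \<and> emeasure lebesgue (B - E) < ennreal (\<eta> / 2 ^ Suc k) \<and>
    continuous_on UNIV (g :: 'a \<Rightarrow> 'a) \<and> (\<forall>x. (w has_derivative (\<lambda>h. g x \<bullet> h)) (at x)) \<and> (L / 2 ^ k)-lipschitz_on UNIV w \<and>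
    (\<forall>x\<in>B \<inter> E. \<bar>v x - w x\<bar> \<le> L / 2 ^ Suc k))"
  define Q where "Q = (\<lambda>k v v'. \<exists>w E g. R k v w E g \<and> (\<forall>x\<in>B \<inter> E. v' x = v x - w x))"
  obtain u0 a b where u0: "L-lipschitz_on UNIV u0" "\<And>x. x \<in> B \<Longrightarrow> u0 x = u x" "\<And>z. z \<notin> cbox a b \<Longrightarrow> u0 z = 0"
    using lipschitz_extension_compact_support[OF u B(2) L] by metis
  have step: "\<exists>v'. P (Suc k) v' \<and> Q k v v'" if v: "P k v" for k v
  proof -
    obtain a b where supp: "\<And>z. z \<notin> cbox a b \<Longrightarrow> v z = 0" using v by (auto simp: P_def)
    have lv: "(L / 2 ^ k)-lipschitz_on UNIV v" using v by (auto simp: P_def)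
    have pos: "0 < L / 2 ^ Suc k" "0 < \<eta> / 2 ^ Suc k" using L \<eta> by auto
    obtain E w g where
      E: "E \<in> sets borel" "emeasure lebesgue (B - E) < ennreal (\<eta> / 2 ^ Suc k)"
      "continuous_on UNIV g" "\<And>x. (w has_derivative (\<lambda>h. g x \<bullet> h)) (at x)" "(L / 2 ^ k)-lipschitz_on UNIV w"
      "(L / 2 ^ Suc k)-lipschitz_on E (\<lambda>x. v x - w x)" "\<And>x. x \<in> E \<Longrightarrow> \<bar>v x - w x\<bar> \<le> L / 2 ^ Suc k"
      by (rule lusin_step[where a = a and b = b, OF lv supp pos(1) B(1) pos(2)]; blast)
    have R: "R k v w E g" unfolding R_def using E by auto
    have "(L / 2 ^ Suc k)-lipschitz_on (B \<inter> E) (\<lambda>x. v x - w x)"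
      using E(6) by (rule lipschitz_on_subset) auto
    moreover have "bounded (B \<inter> E)" using B(2) by auto
    moreover have "0 < L / 2 ^ Suc k" using L by simp
    ultimately obtain v' a' b' where "(L / 2 ^ Suc k)-lipschitz_on UNIV v'" "\<And>x. x \<in> B \<inter> E \<Longrightarrow> v' x = v x - w x"
        "\<And>z. z \<notin> cbox a' b' \<Longrightarrow> v' z = 0"
      by (rule lipschitz_extension_compact_support) blast
    then have "P (Suc k) v'" "Q k v v'" unfolding P_def Q_def using R by blast+
    then show ?thesis by blast
  qed
  have "P 0 u0" using u0 by (auto simp: P_def)
  \<comment> \<open>The clause for \<open>k = 0\<close> makes the dependent choice start at
    \<open>u0\<close>.\<close>
  then obtain U where U: "\<And>k. P k (U k)" "\<And>k. Q k (U k) (U (Suc k))" "U 0 = u0"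
    using dependent_nat_choice[of "\<lambda>k v. P k v \<and> (k = 0 \<longrightarrow> v = u0)" Q] step by (metis nat.distinct(1))
  from U(2) obtain w E g where R: "\<And>k. R k (U k) (w k) (E k) (g k)"
    and Un: "\<And>k x. x \<in> B \<inter> E k \<Longrightarrow> U (Suc k) x = U k x - w k x"
    unfolding Q_def by metis
  define N where "N = (\<Union>k. B - E k)"
  have N: "N \<in> sets lebesgue" unfolding N_def using R B by (intro sets.countable_UN) (auto simp: R_def)
  have "emeasure lebesgue N \<le> (\<Sum>k. emeasure lebesgue (B - E k))"
    unfolding N_def using R B by (intro emeasure_subadditive_countably) (auto simp: R_def)
  also have "\<dots> \<le> (\<Sum>k. ennreal (\<eta> * (1 / 2) ^ Suc k))"
  proof (intro suminf_le)
    fix k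
    have "\<eta> / 2 ^ Suc k = \<eta> * (1 / 2) ^ Suc k" by (simp add: power_one_over)
    then show "emeasure lebesgue (B - E k) \<le> ennreal (\<eta> * (1 / 2) ^ Suc k)"
      using R[of k] unfolding R_def by (metis less_imp_le)
  qed auto
  also have "\<dots> = ennreal \<eta>"
  proof (rule suminf_ennreal_eq)
    show "(\<lambda>k. \<eta> * (1 / 2) ^ Suc k) sums \<eta>" using sums_mult[OF power_half_series, of \<eta>] by simp
  qed (use \<eta> in simp)
  finally have eN: "emeasure lebesgue N \<le> ennreal \<eta>" .
  have ng: "norm (g k x) \<le> L * (1 / 2) ^ k" for k x
    using norm_gradient_le[of "L / 2 ^ k" "w k" "g k x" x] R[of k] by (simp add: R_def power_one_over)
  have summ: "summable (\<lambda>k. L * (1 / 2 :: real) ^ k)" by (intro summable_mult summable_geometric) simp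
  have unif: "uniform_limit UNIV (\<lambda>n x. \<Sum>k<n. g k x) (\<lambda>x. \<Sum>k. g k x) sequentially"
    by (rule Weierstrass_m_test[OF _ summ]) (rule ng)
  define G where "G = (\<lambda>x. \<Sum>k. g k x)"
  have cG: "continuous_on UNIV G"
    unfolding G_def
    by (rule uniform_limit_theorem[OF _ unif])
       (use R in \<open>auto intro!: always_eventually continuous_on_sum simp: R_def\<close>)
  have nG: "norm (G x) \<le> 2 * L" for x
  proof -
    have "norm (G x) \<le> (\<Sum>k. L * (1 / 2) ^ k)"
      unfolding G_def by (rule norm_suminf_le[OF ng summ])
    also have "\<dots> = 2 * L" using suminf_mult[of "\<lambda>k. (1 / 2 :: real) ^ k" L] by (simp add: suminf_geometric)
    finally show ?thesis .
  qed
  show ?thesis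
  proof (cases "B - N = {}")
    \<comment> \<open>With no good point there is nowhere to start the series; \<open>h = 0\<close>
      will do, as all of \<open>B\<close> lies in the exceptional set.\<close>
    case True
    show ?thesis
    proof (rule that[of "\<lambda>_. 0" "\<lambda>_. 0"])
      show "\<exists>N\<in>sets lebesgue. {x \<in> B. 0 \<noteq> u x} \<subseteq> N \<and> emeasure lebesgue N \<le> ennreal \<eta>"
        using N eN True by auto
    qed (use L in auto)
  next
    case False
    have sums: "(\<lambda>k. w k x) sums u x" if x: "x \<in> B - N" for x
    proof -
      have xE: "x \<in> B \<inter> E k" for k using x by (auto simp: N_def)
      \<comment> \<open>Telescoping: at points good for all stages the partial sums miss
        \<open>u x\<close> by the current error \<open>U n x\<close>, which tends to 0.\<close>
      have part: "(\<Sum>k<n. w k x) = u x - U n x" for n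
        by (induction n) (use u0(2)[of x] U(3) x Un[OF xE] in auto)
      have bd: "norm (U (Suc n) x) \<le> L * (1 / 2) ^ Suc n" for n
        using R[of n] xE[of n] Un[OF xE[of n]] by (auto simp: R_def power_one_over)
      have "(\<lambda>n. L * (1 / 2 :: real) ^ Suc n) \<longlonglongrightarrow> 0"
        using LIMSEQ_Suc[OF summable_LIMSEQ_zero[OF summ]] .
      then have "(\<lambda>n. U (Suc n) x) \<longlonglongrightarrow> 0"
        by (rule Lim_null_comparison[rotated]) (use bd in auto)
      then have "(\<lambda>n. U n x) \<longlonglongrightarrow> 0" by (rule LIMSEQ_imp_Suc)
      then have "(\<lambda>n. u x - U n x) \<longlonglongrightarrow> u x - 0" by (intro tendsto_intros)
      then show ?thesis by (simp add: sums_def part)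
    qed
    obtain x0 where x0: "x0 \<in> B - N" using False by auto
    have "\<exists>h. \<forall>x\<in>UNIV. (\<lambda>n. w n x) sums h x \<and> (h has_derivative (\<lambda>v. G x \<bullet> v)) (at x within UNIV)"
    proof (rule has_derivative_series[where x = x0 and l = "u x0" and f' = "\<lambda>n x v. g n x \<bullet> v"])
      show "(\<lambda>n. w n x0) sums u x0" by (rule sums[OF x0])
      show "(w n has_derivative (\<lambda>v. g n x \<bullet> v)) (at x within UNIV)" for n x
        using R[of n] by (simp add: R_def)
      fix e :: real assume "0 < e"
      with unif have "\<forall>\<^sub>F n in sequentially. \<forall>x\<in>UNIV. dist (\<Sum>k<n. g k x) (G x) < e"
        unfolding uniform_limit_iff G_def by blast
      then show "\<forall>\<^sub>F n in sequentially. \<forall>x\<in>UNIV. \<forall>v. norm ((\<Sum>i<n. g i x \<bullet> v) - G x \<bullet> v) \<le> e * norm v"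
      proof (rule eventually_mono, intro ballI allI)
        fix n and x v :: 'a assume "\<forall>x\<in>UNIV. dist (\<Sum>k<n. g k x) (G x) < e"
        then have "norm ((\<Sum>k<n. g k x) - G x) \<le> e" by (auto simp: dist_norm less_imp_le)
        then have "norm ((\<Sum>k<n. g k x) - G x) * norm v \<le> e * norm v" by (rule mult_right_mono) simp
        then have "\<bar>((\<Sum>k<n. g k x) - G x) \<bullet> v\<bar> \<le> e * norm v" using Cauchy_Schwarz_ineq2 order_trans by blast
        then show "norm ((\<Sum>i<n. g i x \<bullet> v) - G x \<bullet> v) \<le> e * norm v"
          by (simp add: inner_diff_left inner_sum_left)
      qed
    qed auto
    then obtain h where h: "\<And>x. (\<lambda>n. w n x) sums h x" "\<And>x. (h has_derivative (\<lambda>v. G x \<bullet> v)) (at x)" by auto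
    show ?thesis
    proof (rule that[OF cG h(2) nG])
      have "{x \<in> B. h x \<noteq> u x} \<subseteq> N" using sums h(1) sums_unique2 by blast
      then show "\<exists>N\<in>sets lebesgue. {x \<in> B. h x \<noteq> u x} \<subseteq> N \<and> emeasure lebesgue N \<le> ennreal \<eta>"
        using N eN by blast
    qed
  qed
qed

section \<open>Slices and Hausdorff measure\<close>

text \<open>Serves both for slice pieces with disjoint images and for the final disjoint compact
  sets. The relation is not assumed symmetric, hence the test in both orders.\<close>

lemma maximal_pairwise_family:
  shows "\<exists>M\<subseteq>A. pairwise R M \<and> (\<forall>x\<in>A. (\<forall>y\<in>M. R x y \<and> R y x) \<longrightarrow> x \<in> M)"
proof -
  let ?F = "{M. M \<subseteq> A \<and> pairwise R M}"
  have "\<exists>M\<in>?F. \<forall>X\<in>?F. M \<subseteq> X \<longrightarrow> X = M"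
  proof (rule subset_Zorn')
    fix C assume C: "subset.chain ?F C"
    have "pairwise R (\<Union>C)"
    proof (rule pairwiseI)
      fix x y assume xy: "x \<in> \<Union>C" "y \<in> \<Union>C" "x \<noteq> y"
      then obtain X Y where XY: "X \<in> C" "x \<in> X" "Y \<in> C" "y \<in> Y" by auto
      then have "X \<subseteq> Y \<or> Y \<subseteq> X" using C by (auto simp: subset_chain_def)
      then obtain Z where "Z \<in> C" "x \<in> Z" "y \<in> Z" using XY by blast
      then show "R x y" using C xy(3) by (auto simp: subset_chain_def pairwise_def)
    qed
    then show "\<Union>C \<in> ?F" using C by (auto simp: subset_chain_def)
  qed
  then obtain M where M: "M \<subseteq> A" "pairwise R M" "\<forall>X\<in>?F. M \<subseteq> X \<longrightarrow> X = M"
    by blast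
  have "x \<in> M" if "x \<in> A" "\<forall>y\<in>M. R x y \<and> R y x" for x
  proof -
    have "pairwise R (insert x M)" using M(2) that(2) by (simp add: pairwise_insert)
    then show "x \<in> M" using M(1,3) that(1) by blast
  qed
  then show ?thesis using M(1,2) by blast
qed

text \<open>Each \<open>i\<close> offers a finite budget \<open>C i\<close>, so only finitely many
  elements weigh at least \<open>1 / real (Suc n)\<close> there, and every element does so for some
  \<open>i\<close> and \<open>n\<close>.\<close>

lemma countable_if_bounded_weights:
  fixes w :: "nat \<Rightarrow> 's \<Rightarrow> ennreal"
  assumes bound: "\<And>i F. finite F \<Longrightarrow> F \<subseteq> M \<Longrightarrow> (\<Sum>x\<in>F. w i x) \<le> C i" and C: "\<And>i. C i < \<infinity>"
    and pos: "\<And>x. x \<in> M \<Longrightarrow> \<exists>i. w i x \<noteq> 0"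
  shows "countable M"
proof -
  define S where "S = (\<lambda>i n. {x \<in> M. ennreal (1 / real (Suc n)) \<le> w i x})"
  have "finite (S i n)" for i n
  proof (rule ccontr)
    assume inf: "infinite (S i n)"
    obtain c where c: "C i = ennreal c" "c \<ge> 0" using C[of i] by (cases "C i") auto
    obtain N :: nat where N: "c * real (Suc n) < real N" using reals_Archimedean2 by blast
    obtain F where F: "F \<subseteq> S i n" "finite F" "card F = N" using infinite_arbitrarily_large[OF inf] by blast
    have "ennreal (real N * (1 / real (Suc n))) = (\<Sum>x\<in>F. ennreal (1 / real (Suc n)))"
      using F(3) by (simp add: ennreal_of_nat_eq_real_of_nat flip: ennreal_mult')
    also have "\<dots> \<le> (\<Sum>x\<in>F. w i x)" using F(1) by (intro sum_mono) (auto simp: S_def)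
    also have "\<dots> \<le> ennreal c" using bound[of F i] F c by (auto simp: S_def)
    finally have "real N * (1 / real (Suc n)) \<le> c" using c by (simp add: ennreal_le_iff)
    then show False using N by (simp add: field_simps)
  qed
  moreover have "M \<subseteq> (\<Union>i. \<Union>n. S i n)"
  proof
    fix x assume x: "x \<in> M"
    then obtain i where i: "w i x \<noteq> 0" using pos by blast
    obtain n where "ennreal (1 / real (Suc n)) \<le> w i x"
    proof (cases "w i x")
      case (real r)
      then have "r > 0" using i by (cases "r = 0") auto
      then obtain n where "1 / real (Suc n) < r" using nat_approx_posE by metis
      then show ?thesis using that[of n] real by (simp add: ennreal_leI)
    qed (use that in auto)
    then show "x \<in> (\<Union>i. \<Union>n. S i n)" using x by (auto simp: S_def)
  qed
  moreover have "countable (\<Union>i. \<Union>n. S i n)"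
    using calculation(1) by (simp add: countable_finite)
  ultimately show ?thesis using countable_subset by blast
qed

lemma nonnegligible_compact_subset:
  fixes S :: "'a::euclidean_space set"
  assumes "S \<in> sets lebesgue" "\<not> negligible S"
  obtains K where "compact K" "K \<subseteq> S" "\<not> negligible K"
proof -
  obtain C T where CT: "fsigma C" "T \<in> null_sets lebesgue" "C \<union> T = S"
    using lebesgue_set_almost_fsigma[OF assms(1)] by metis
  obtain F :: "nat \<Rightarrow> 'a set" where F: "range F \<subseteq> Collect compact" "C = \<Union>(range F)"
    using CT(1) fsigma_Union_compact by metis
  have "\<not> negligible C"
    using CT assms(2) by (auto simp: negligible_iff_null_sets)
  then obtain n where "\<not> negligible (F n)" using F(2) negligible_Union_nat by blast
  then show ?thesis using that[of "F n"] F CT by auto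
qed

lemma nonnegligible_AE_Union:
  assumes "\<not> negligible S" "countable I" "AE p in lebesgue. p \<in> S \<longrightarrow> p \<in> (\<Union>i\<in>I. A i)"
  obtains i where "i \<in> I" "\<not> negligible (S \<inter> A i)"
proof -
  have "\<exists>i\<in>I. \<not> negligible (S \<inter> A i)"
  proof (rule ccontr)
    assume "\<not> ?thesis"
    then have "negligible (\<Union>((\<lambda>i. S \<inter> A i) ` I))" using assms(2) by (intro negligible_countable_Union) auto
    moreover have "negligible {p. \<not> (p \<in> S \<longrightarrow> p \<in> (\<Union>i\<in>I. A i))}"
      using assms(3) by (simp only: AE_lebesgue_iff_negligible)
    ultimately have "negligible (\<Union>((\<lambda>i. S \<inter> A i) ` I) \<union> {p. \<not> (p \<in> S \<longrightarrow> p \<in> (\<Union>i\<in>I. A i))})"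
      by (rule negligible_Un)
    then have "negligible S" by (rule negligible_subset) auto
    then show False using assms(1) by simp
  qed
  then show ?thesis using that by blast
qed

section \<open>Hausdorff measure of disjoint compact images\<close>

lemma compact_disjoint_separated:
  fixes S T :: "'x::metric_space set"
  assumes "compact S" "compact T" "S \<inter> T = {}"
  shows "\<exists>d>0. \<forall>x\<in>S. \<forall>y\<in>T. d \<le> dist x y"
proof (cases "S = {} \<or> T = {}")
  case True
  then show ?thesis by (intro exI[of _ 1]) auto
next
  case False
  have "continuous_on S (\<lambda>x. infdist x T)" by (intro continuous_intros)
  then obtain x where x: "x \<in> S" "\<And>y. y \<in> S \<Longrightarrow> infdist x T \<le> infdist y T"
    using continuous_attains_inf[OF assms(1), of "\<lambda>x. infdist x T"] False by blast
  have "x \<notin> T" using x(1) assms(3) by auto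
  then have "infdist x T \<noteq> 0"
    using in_closed_iff_infdist_zero[OF compact_imp_closed[OF assms(2)], of x] False by blast
  then have "0 < infdist x T" using infdist_nonneg[of x T] by linarith
  moreover have "infdist x T \<le> dist y z" if "y \<in> S" "z \<in> T" for y z
    using x(2)[OF that(1)] infdist_le[OF that(2), of y] by linarith
  ultimately show ?thesis by blast
qed

lemma hausdorff_cover:
  assumes "hausdorff_measure m A < \<infinity>" "0 < \<delta>"
  obtains C :: "nat \<Rightarrow> 'a::metric_space set" where "A \<subseteq> (\<Union>i. C i)" "\<And>i. bounded (C i)" "\<And>i. diameter (C i) \<le> \<delta>"
    "(\<Sum>i. if C i = {} then 0 else ennreal (unit_ball_vol (real m) * (diameter (C i) / 2) ^ m)) \<le> hausdorff_measure m A + 1"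
proof -
  have "hausdorff_content m \<delta> A \<le> hausdorff_measure m A"
    unfolding hausdorff_measure_def using assms(2) by (intro SUP_upper) auto
  \<comment> \<open>The slack 1 turns the infimum over covers into an actual cover; only the
    finiteness of the bound matters later.\<close>
  also have "\<dots> < hausdorff_measure m A + 1" using assms(1)
    by (cases "hausdorff_measure m A") (auto simp: ennreal_less_iff simp flip: ennreal_plus ennreal_1)
  finally show ?thesis
    unfolding hausdorff_content_def INF_less_iff using that by (auto intro: less_imp_le)
qed

text \<open>Compact sets that are pairwise disjoint are a positive distance apart, so a fine enough cover of
  \<open>A\<close> splits into covers of the pieces; this replaces the measurability of \<open>A\<close>.\<close>

lemma sum_outer_measure_le_hausdorff:
  fixes h :: "'s \<Rightarrow> 'a::euclidean_space \<Rightarrow> 'x::metric_space"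
  assumes J: "finite J" and S: "\<And>j. j \<in> J \<Longrightarrow> compact (S j)" "disjoint_family_on S J"
    and D: "\<And>j x. j \<in> J \<Longrightarrow> x \<in> D j \<Longrightarrow> h j x \<in> S j"
    and \<kappa>: "0 \<le> \<kappa>" "\<And>j x y. j \<in> J \<Longrightarrow> x \<in> D j \<Longrightarrow> y \<in> D j \<Longrightarrow> dist x y \<le> \<kappa> * dist (h j x) (h j y)"
    and A: "hausdorff_measure DIM('a) A < \<infinity>"
  shows "(\<Sum>j\<in>J. outer_measure_of lebesgue {x \<in> D j. h j x \<in> A}) \<le>
     ennreal ((2 * \<kappa>) ^ DIM('a)) * (hausdorff_measure DIM('a) A + 1)"
proof -
  have "\<exists>d>0. \<forall>i\<in>J. \<forall>j\<in>J. i \<noteq> j \<longrightarrow> (\<forall>x\<in>S i. \<forall>y\<in>S j. d \<le> dist x y)"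
  proof -
    have "\<exists>d>0. \<forall>x\<in>S i. \<forall>y\<in>S j. d \<le> dist x y" if "i \<in> J" "j \<in> J" "i \<noteq> j" for i j
      using S that by (intro compact_disjoint_separated) (auto simp: disjoint_family_on_def)
    then have "\<forall>p\<in>{p\<in>J \<times> J. fst p \<noteq> snd p}. \<exists>d>0. \<forall>x\<in>S (fst p). \<forall>y\<in>S (snd p). d \<le> dist x y" by auto
    from bchoice[OF this] obtain d where
      d: "\<forall>p\<in>{p\<in>J \<times> J. fst p \<noteq> snd p}. d p > 0 \<and> (\<forall>x\<in>S (fst p). \<forall>y\<in>S (snd p). d p \<le> dist x y)"
      by blast
    define d0 where "d0 = Min (insert 1 (d ` {p\<in>J \<times> J. fst p \<noteq> snd p}))"
    have fin: "finite {p\<in>J \<times> J. fst p \<noteq> snd p}" using J by simp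
    have "d0 > 0" unfolding d0_def using fin d by (subst Min_gr_iff) auto
    moreover have "d0 \<le> dist x y" if "i \<in> J" "j \<in> J" "i \<noteq> j" "x \<in> S i" "y \<in> S j" for i j x y
    proof -
      have "d0 \<le> d (i, j)" unfolding d0_def using fin that by (intro Min_le) auto
      also have "\<dots> \<le> dist x y" using d that by auto
      finally show ?thesis .
    qed
    ultimately show ?thesis by blast
  qed
  then obtain d where d: "d > 0" "\<And>i j x y. i \<in> J \<Longrightarrow> j \<in> J \<Longrightarrow> i \<noteq> j \<Longrightarrow> x \<in> S i \<Longrightarrow> y \<in> S j \<Longrightarrow> d \<le> dist x y"
    by blast
  obtain C where C: "A \<subseteq> (\<Union>i. C i)" "\<And>i. bounded (C i)" "\<And>i. diameter (C i) \<le> d / 2"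
    "(\<Sum>i. if C i = {} then 0 else ennreal (unit_ball_vol (real DIM('a)) * (diameter (C i) / 2) ^ DIM('a)))
       \<le> hausdorff_measure DIM('a) A + 1"
    using hausdorff_cover[OF A, of "d / 2"] d(1) by auto
  \<comment> \<open>The preimage of a set of diameter t within one piece lies in a ball of radius
    \<open>\<kappa>\<close> t. Its volume is \<open>(2 * \<kappa>) ^ DIM('a)\<close> times the
    Hausdorff weight, which uses the radius t / 2.\<close>
  define c where "c = ennreal ((2 * \<kappa>) ^ DIM('a))"
  define w where "w = (\<lambda>i. if C i = {} then 0 else ennreal (unit_ball_vol (real DIM('a)) * (diameter (C i) / 2) ^ DIM('a)))"
  \<comment> \<open>\<open>a j i\<close> charges the weight of \<open>C i\<close> to the piece
    \<open>S j\<close> that it meets. The mesh \<open>d / 2\<close> lies below the mutual distance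
    of the pieces, so no weight is charged twice.\<close>
  define a where "a = (\<lambda>j i. if C i \<inter> S j = {} then 0 else c * w i)"
  have piece: "outer_measure_of lebesgue {x \<in> D j. h j x \<in> A} \<le> (\<Sum>i. a j i)" if j: "j \<in> J" for j
  proof -
    have "\<exists>B\<in>sets lebesgue. {x \<in> D j. h j x \<in> C i} \<subseteq> B \<and> emeasure lebesgue B \<le> a j i" for i
    proof (cases "{x \<in> D j. h j x \<in> C i} = {}")
      case True
      then show ?thesis by (intro bexI[of _ "{}"]) auto
    next
      case False
      then obtain x where x: "x \<in> D j" "h j x \<in> C i" by auto
      have ne: "C i \<inter> S j \<noteq> {}" using D[OF j x(1)] x by auto
      have sub: "{x \<in> D j. h j x \<in> C i} \<subseteq> cball x (\<kappa> * diameter (C i))"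
      proof clarify
        fix y assume y: "y \<in> D j" "h j y \<in> C i"
        have "dist x y \<le> \<kappa> * dist (h j x) (h j y)" using \<kappa>(2)[OF j x(1) y(1)] .
        also have "\<dots> \<le> \<kappa> * diameter (C i)"
          using diameter_bounded_bound[OF C(2) x(2) y(2)] \<kappa>(1) by (rule mult_left_mono)
        finally show "y \<in> cball x (\<kappa> * diameter (C i))" by simp
      qed
      have dn: "0 \<le> diameter (C i)" using diameter_ge_0[OF C(2)] .
      have "emeasure lebesgue (cball x (\<kappa> * diameter (C i))) = ennreal (unit_ball_vol (real DIM('a)) * (\<kappa> * diameter (C i)) ^ DIM('a))"
        using \<kappa>(1) dn by (simp add: emeasure_cball)
      also have "\<dots> = ennreal ((2 * \<kappa>) ^ DIM('a) * (unit_ball_vol (real DIM('a)) * (diameter (C i) / 2) ^ DIM('a)))"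
        using power_mult_distrib[of "2 * \<kappa>" "diameter (C i) / 2" "DIM('a)"] by (simp add: mult_ac)
      also have "\<dots> = c * w i"
        using ne \<kappa>(1) by (auto simp: c_def w_def ennreal_mult')
      finally show ?thesis using sub ne by (intro bexI[of _ "cball x (\<kappa> * diameter (C i))"]) (auto simp: a_def)
    qed
    then obtain B where B: "\<And>i. B i \<in> sets lebesgue" "\<And>i. {x \<in> D j. h j x \<in> C i} \<subseteq> B i" "\<And>i. emeasure lebesgue (B i) \<le> a j i"
      by metis
    have "outer_measure_of lebesgue {x \<in> D j. h j x \<in> A} \<le> outer_measure_of lebesgue (\<Union>i. B i)"
    proof (rule outer_measure_of_mono, clarify)
      fix x assume x: "x \<in> D j" "h j x \<in> A"
      then obtain i where "h j x \<in> C i" using C(1) by blast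
      then have "x \<in> B i" using B(2)[of i] x(1) by blast
      then show "x \<in> (\<Union>i. B i)" by blast
    qed
    also have "\<dots> = emeasure lebesgue (\<Union>i. B i)" using B(1) by (intro outer_measure_of_eq sets.countable_UN) auto
    also have "\<dots> \<le> (\<Sum>i. emeasure lebesgue (B i))" using B(1) by (intro emeasure_subadditive_countably) auto
    also have "\<dots> \<le> (\<Sum>i. a j i)" using B(3) by (intro suminf_le) auto
    finally show ?thesis .
  qed
  have one: "(\<Sum>j\<in>J. a j i) \<le> c * w i" for i
  proof (cases "\<exists>j\<in>J. C i \<inter> S j \<noteq> {}")
    case True
    then obtain j x where j: "j \<in> J" "x \<in> C i" "x \<in> S j" by auto
    have "a l i = 0" if l: "l \<in> J - {j}" for l
    proof (rule ccontr)
      assume "a l i \<noteq> 0"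
      then obtain y where y: "y \<in> C i" "y \<in> S l" by (auto simp: a_def split: if_splits)
      have "d \<le> dist x y" using d(2)[of j l x y] j y l by auto
      also have "\<dots> \<le> d / 2" using diameter_bounded_bound[OF C(2) j(2) y(1)] C(3)[of i] by simp
      finally show False using d(1) by simp
    qed
    then have "(\<Sum>j\<in>J. a j i) = a j i" using J j(1) by (subst sum.remove[of J j]) auto
    then show ?thesis by (simp add: a_def)
  next
    case False
    then show ?thesis by (simp add: a_def)
  qed
  have "(\<Sum>j\<in>J. outer_measure_of lebesgue {x \<in> D j. h j x \<in> A}) \<le> (\<Sum>j\<in>J. \<Sum>i. a j i)"
    by (intro sum_mono piece)
  also have "\<dots> = (\<Sum>i. \<Sum>j\<in>J. a j i)" by (intro suminf_sum[symmetric]) auto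
  also have "\<dots> \<le> (\<Sum>i. c * w i)" by (intro suminf_le one) auto
  also have "\<dots> = c * (\<Sum>i. w i)" by simp
  also have "\<dots> \<le> c * (hausdorff_measure DIM('a) A + 1)" using C(4) by (intro mult_left_mono) (auto simp: w_def)
  finally show ?thesis by (simp add: c_def)
qed

definition positive_slice :: "('a::euclidean_space \<Rightarrow> 'b::euclidean_space) \<Rightarrow> 'b set \<Rightarrow> 'b \<Rightarrow> bool" where
  "positive_slice T E c \<longleftrightarrow> E \<subseteq> range (\<lambda>x. c + T x) \<and> \<not> negligible {x. c + T x \<in> E}"

text \<open>The weight of \<open>E\<close> at \<open>i\<close> is the outer measure of the slice
  parameters that \<open>f\<close> sends into \<open>A i\<close>. Disjointness of the images bounds
  the sum of the weights for each \<open>i\<close>; as the \<open>A i\<close> cover the target,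
  every \<open>E\<close> has nonzero weight somewhere.\<close>

lemma countable_disjoint_slice_images:
  fixes T :: "'a::euclidean_space \<Rightarrow> 'b::euclidean_space" and f :: "'b \<Rightarrow> 'x::metric_space"
  assumes sf: "hausdorff_sigma_finite DIM('a) (UNIV :: 'x set)"
    and T: "linear T" "\<And>x. norm (T x) = norm x"
    and f: "continuous_on K f" "0 \<le> \<kappa>"
      "\<And>p q. p \<in> K \<Longrightarrow> q \<in> K \<Longrightarrow> q - p \<in> range T \<Longrightarrow> dist p q \<le> \<kappa> * dist (f p) (f q)"
    and M: "\<And>E. E \<in> M \<Longrightarrow> compact E \<and> E \<subseteq> K \<and> (\<exists>c. positive_slice T E c)"
      "pairwise (\<lambda>E E'. disjnt (f ` E) (f ` E')) M"
  shows "countable M"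
proof -
  obtain A :: "nat \<Rightarrow> 'x set" where A: "UNIV = (\<Union>i. A i)" "\<And>i. hausdorff_measure DIM('a) (A i) < \<infinity>"
    using sf by (auto simp: hausdorff_sigma_finite_def)
  obtain c where c: "\<And>E. E \<in> M \<Longrightarrow> positive_slice T E (c E)" using M(1) by metis
  define D where "D = (\<lambda>E. {x. c E + T x \<in> E})"
  define h where "h = (\<lambda>E x. f (c E + T x))"
  show ?thesis
  proof (rule countable_if_bounded_weights[where w = "\<lambda>i E. outer_measure_of lebesgue {x \<in> D E. h E x \<in> A i}"
        and C = "\<lambda>i. ennreal ((2 * \<kappa>) ^ DIM('a)) * (hausdorff_measure DIM('a) (A i) + 1)"])
    fix i F assume F: "finite F" "F \<subseteq> M"
    show "(\<Sum>E\<in>F. outer_measure_of lebesgue {x \<in> D E. h E x \<in> A i}) \<le>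
        ennreal ((2 * \<kappa>) ^ DIM('a)) * (hausdorff_measure DIM('a) (A i) + 1)"
    proof (rule sum_outer_measure_le_hausdorff[where S = "\<lambda>E. f ` E"])
      show "compact (f ` E)" if "E \<in> F" for E
        using that M(1) F f(1) by (meson compact_continuous_image continuous_on_subset subsetD)
      show "disjoint_family_on (\<lambda>E. f ` E) F"
        using M(2) F by (auto simp: disjoint_family_on_def pairwise_def disjnt_def)
      show "dist x y \<le> \<kappa> * dist (h E x) (h E y)" if "E \<in> F" "x \<in> D E" "y \<in> D E" for E x y
      proof -
        have "c E + T y - (c E + T x) \<in> range T" by (simp add: linear_diff[OF T(1), symmetric])
        then have "dist (c E + T x) (c E + T y) \<le> \<kappa> * dist (h E x) (h E y)"
          using f(3)[of "c E + T x" "c E + T y"] that M(1) F by (auto simp: D_def h_def)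
        then show ?thesis by (simp add: dist_norm linear_diff[OF T(1), symmetric] T(2))
      qed
    qed (use F f A in \<open>auto simp: D_def h_def\<close>)
  next
    show "ennreal ((2 * \<kappa>) ^ DIM('a)) * (hausdorff_measure DIM('a) (A i) + 1) < \<infinity>" for i
      using A(2)[of i] by (simp add: ennreal_mult_less_top)
  next
    fix E assume E: "E \<in> M"
    show "\<exists>i. outer_measure_of lebesgue {x \<in> D E. h E x \<in> A i} \<noteq> 0"
    proof (rule ccontr)
      assume "\<not> ?thesis"
      then have 0: "outer_measure_of lebesgue {x \<in> D E. h E x \<in> A i} = 0" for i by simp
      have "negligible (\<Union>i. {x \<in> D E. h E x \<in> A i})"
        by (intro negligible_Union_nat negligible_if_outer_measure_0 0)
      moreover have "(\<Union>i. {x \<in> D E. h E x \<in> A i}) = D E" using A(1) by blast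
      ultimately show False using c[OF E] by (simp add: positive_slice_def D_def)
    qed
  qed
qed

text \<open>If all saturations of slices were null, removing those of a countable maximal family
  would leave a non-null Borel set \<open>P\<close>, and some slice of \<open>P\<close> would
  contain a non-null compact \<open>E\<close>. No point of \<open>P\<close> shares its value with a
  member of the family, so \<open>E\<close> could be added.\<close>

lemma slice_with_large_saturation:
  fixes T :: "'a::euclidean_space \<Rightarrow> 'b::euclidean_space" and f :: "'b \<Rightarrow> 'x::metric_space"
  assumes sf: "hausdorff_sigma_finite DIM('a) (UNIV :: 'x set)"
    and T: "linear T" "\<And>x. norm (T x) = norm x"
    and f: "continuous_on K f" "0 \<le> \<kappa>"
      "\<And>p q. p \<in> K \<Longrightarrow> q \<in> K \<Longrightarrow> q - p \<in> range T \<Longrightarrow> dist p q \<le> \<kappa> * dist (f p) (f q)"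
    and K: "compact K" "\<not> negligible K"
  obtains c where "compact {p \<in> K. f p \<in> f ` (K \<inter> range (\<lambda>x. c + T x))}"
    "\<not> negligible {p \<in> K. f p \<in> f ` (K \<inter> range (\<lambda>x. c + T x))}"
proof -
  let ?P = "\<lambda>E. {p \<in> K. f p \<in> f ` E}"
  let ?S = "\<lambda>c. {p \<in> K. f p \<in> f ` (K \<inter> range (\<lambda>x. c + T x))}"
  have cT: "continuous_on UNIV T" using T(1) by (rule linear_continuous_on[OF linear_linear[THEN iffD2]])
  have closed_pre: "compact (?P E)" if "compact E" "E \<subseteq> K" for E
  proof -
    have "closed (f ` E)"
      using that f(1) by (meson compact_continuous_image compact_imp_closed continuous_on_subset)
    then have "closed (K \<inter> f -` (f ` E))"
      using continuous_closed_preimage[OF f(1) compact_imp_closed[OF K(1)]] by blast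
    then have "compact (K \<inter> (K \<inter> f -` (f ` E)))" using K(1) by (rule compact_Int_closed[rotated])
    moreover have "K \<inter> (K \<inter> f -` (f ` E)) = ?P E" by auto
    ultimately show ?thesis by simp
  qed
  have slice_closed: "closed (range (\<lambda>x. c + T x))" for c
  proof -
    have "closed (range T)" using closed_subspace[OF linear_subspace_image[OF T(1) subspace_UNIV]] .
    then have "closed ((+) c ` range T)" by (rule closed_translation)
    then show ?thesis by (simp add: image_image)
  qed
  have "\<exists>c. \<not> negligible (?S c)"
  proof (rule ccontr)
    assume "\<not> ?thesis"
    then have null: "negligible (?S c)" for c by blast
    define F where "F = {E. compact E \<and> E \<subseteq> K \<and> (\<exists>c. positive_slice T E c)}"
    obtain M where M: "M \<subseteq> F" "pairwise (\<lambda>E E'. disjnt (f ` E) (f ` E')) M"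
      "\<forall>E\<in>F. (\<forall>E'\<in>M. disjnt (f ` E) (f ` E') \<and> disjnt (f ` E') (f ` E)) \<longrightarrow> E \<in> M"
      using maximal_pairwise_family[of F "\<lambda>E E'. disjnt (f ` E) (f ` E')"] by blast
    have cM: "countable M"
      by (rule countable_disjoint_slice_images[OF sf T f]) (use M in \<open>auto simp: F_def\<close>)
    define P where "P = K - (\<Union>E\<in>M. ?P E)"
    have "(\<Union>E\<in>M. ?P E) \<in> sets borel"
    proof -
      have "?P E \<in> sets borel" if "E \<in> M" for E
        using M(1) that by (intro borel_compact closed_pre) (auto simp: F_def)
      then show ?thesis by (intro sets.countable_UN'[OF cM]) auto
    qed
    then have P: "P \<in> sets borel" unfolding P_def using K(1) by (intro sets.Diff) (auto intro: borel_compact)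
    have "negligible (\<Union>E\<in>M. ?P E)"
    proof (rule negligible_countable_Union)
      show "countable (?P ` M)" using cM by simp
      fix X assume "X \<in> ?P ` M"
      then obtain E c where E: "E \<in> M" "X = ?P E" "E \<subseteq> K" "E \<subseteq> range (\<lambda>x. c + T x)"
        using M(1) by (auto simp: positive_slice_def F_def)
      show "negligible X" by (rule negligible_subset[OF null[of c]]) (use E in auto)
    qed
    then have "\<not> negligible P"
      using K(2) negligible_Un[of P "\<Union>E\<in>M. ?P E"] negligible_subset unfolding P_def by blast
    then obtain c where c: "\<not> negligible {x. c + T x \<in> P}"
      using negligible_if_negligible_slices[OF P cT] by blast
    have "{x. c + T x \<in> P} \<in> sets borel"
    proof -
      have "(\<lambda>x. c + T x) \<in> borel_measurable borel"
        by (intro borel_measurable_continuous_onI continuous_intros cT)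
      from measurable_sets[OF this P] show ?thesis by (simp add: vimage_def)
    qed
    then obtain Z where Z: "compact Z" "Z \<subseteq> {x. c + T x \<in> P}" "\<not> negligible Z"
      using nonnegligible_compact_subset[of "{x. c + T x \<in> P}"] c by auto
    define E where "E = (\<lambda>x. c + T x) ` Z"
    have "compact E"
      unfolding E_def by (intro compact_continuous_image Z(1) continuous_intros continuous_on_subset[OF cT]) auto
    moreover have "E \<subseteq> P" using Z(2) by (auto simp: E_def)
    moreover have "Z \<subseteq> {x. c + T x \<in> E}" by (auto simp: E_def)
    then have ps: "positive_slice T E c"
      using Z(3) negligible_subset by (auto simp: positive_slice_def E_def)
    moreover have "disjnt (f ` E) (f ` E') \<and> disjnt (f ` E') (f ` E)" if "E' \<in> M" for E'
    proof -
      have "f x \<notin> f ` E'" if "x \<in> E" for x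
        using \<open>E \<subseteq> P\<close> that \<open>E' \<in> M\<close> unfolding P_def by blast
      then have "f ` E \<subseteq> - (f ` E')" by (intro image_subsetI) simp
      then show ?thesis unfolding disjnt_def by blast
    qed
    moreover have "E \<subseteq> K" using \<open>E \<subseteq> P\<close> by (auto simp: P_def)
    ultimately have "E \<in> M" using M(3) unfolding F_def by blast
    \<comment> \<open>\<open>P\<close> avoids the saturation of every member of \<open>M\<close>,
      and \<open>E\<close> is contained in its own.\<close>
    then have "E \<inter> P = {}" unfolding P_def by blast
    then have "E = {}" using \<open>E \<subseteq> P\<close> by blast
    then show False using ps by (simp add: positive_slice_def)
  qed
  then obtain c where "\<not> negligible (?S c)" by blast
  moreover have "compact (?S c)"
    using K(1) slice_closed by (intro closed_pre compact_Int_closed) auto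
  ultimately show ?thesis using that by blast
qed

section \<open>Coordinate planes and diffeomorphisms\<close>

text \<open>For injective \<open>j\<close> this is the isometric inclusion of a coordinate plane,
  with left inverse \<open>coord_proj j\<close>. While the \<open>\<iota>\<close> of the theorem is
  fixed, \<open>j\<close> varies with the point of \<open>\<Omega>\<close>.\<close>

definition coord_incl :: "('m::finite \<Rightarrow> 'n::finite) \<Rightarrow> real ^ 'm \<Rightarrow> real ^ 'n" where
  "coord_incl j x = (\<Sum>l\<in>UNIV. x $ l *\<^sub>R axis (j l) 1)"

lemma linear_coord_incl: "linear (coord_incl j)"
  by (rule linearI) (simp_all add: coord_incl_def scaleR_add_left sum.distrib scaleR_sum_right)

lemma coord_incl_nth:
  assumes "inj j"
  shows "coord_incl j x $ j l = x $ l" and "i \<notin> range j \<Longrightarrow> coord_incl j x $ i = 0"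
proof -
  have "coord_incl j x $ j l = (\<Sum>k\<in>UNIV. if l = k then x $ k else 0)"
    unfolding coord_incl_def sum_component using assms
    by (intro sum.cong refl) (auto simp: axis_def inj_def)
  then show "coord_incl j x $ j l = x $ l" by simp
  assume "i \<notin> range j"
  then show "coord_incl j x $ i = 0"
    unfolding coord_incl_def sum_component by (intro sum.neutral) (auto simp: axis_def)
qed

lemma sum_UNIV_split_range:
  fixes j :: "'m::finite \<Rightarrow> 'n::finite" and F :: "'n \<Rightarrow> real"
  assumes "inj j"
  shows "(\<Sum>i\<in>UNIV. F i) = (\<Sum>l\<in>UNIV. F (j l)) + (\<Sum>i\<in>- range j. F i)"
proof -
  have "(\<Sum>i\<in>UNIV. F i) = (\<Sum>i\<in>range j. F i) + (\<Sum>i\<in>- range j. F i)"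
    using sum.subset_diff[of "range j" UNIV F] by (simp add: Compl_eq_Diff_UNIV add.commute)
  also have "(\<Sum>i\<in>range j. F i) = (\<Sum>l\<in>UNIV. F (j l))" using assms by (simp add: sum.reindex)
  finally show ?thesis .
qed

lemma norm_vec_sq: "(norm (x :: real ^ 'n::finite))\<^sup>2 = (\<Sum>i\<in>UNIV. (x $ i)\<^sup>2)"
  unfolding power2_norm_eq_inner inner_vec_def by (simp add: power2_eq_square)

lemma norm_coord_incl: "inj j \<Longrightarrow> norm (coord_incl j x) = norm x"
proof -
  assume j: "inj j"
  have "(norm (coord_incl j x))\<^sup>2 = (norm x)\<^sup>2"
    unfolding norm_vec_sq sum_UNIV_split_range[OF j] using coord_incl_nth[OF j] by simp
  then show ?thesis by (simp add: power2_eq_iff_nonneg)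
qed

lemma norm_coord_proj_le: "inj \<iota> \<Longrightarrow> norm (coord_proj \<iota> p) \<le> norm p"
proof -
  assume \<iota>: "inj \<iota>"
  have "(norm (coord_proj \<iota> p))\<^sup>2 \<le> (norm p)\<^sup>2"
    unfolding norm_vec_sq sum_UNIV_split_range[OF \<iota>] by (simp add: coord_proj_def sum_nonneg)
  then show ?thesis by (rule power2_le_imp_le) simp
qed

section \<open>Seminorms and the choice of a coordinate plane\<close>

lemma seminorm_subspace:
  assumes "seminorm \<sigma>"
  shows "subspace {v. \<sigma> v = 0}"
proof -
  have hom: "\<sigma> (c *\<^sub>R v) = \<bar>c\<bar> * \<sigma> v" and nonneg: "0 \<le> \<sigma> v" and tri: "\<sigma> (v + w) \<le> \<sigma> v + \<sigma> w" for c v w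
    using assms by (auto simp: seminorm_def)
  show ?thesis
  proof (rule subspaceI; clarsimp simp: hom)
    show "\<sigma> 0 = 0" using hom[of 0 0] by simp
    fix v w assume "\<sigma> v = 0" "\<sigma> w = 0"
    then show "\<sigma> (v + w) = 0" using tri[of v w] nonneg[of "v + w"] by simp
  qed
qed

lemma seminorm_continuous:
  fixes \<sigma> :: "'a::euclidean_space \<Rightarrow> real"
  assumes "seminorm \<sigma>"
  shows "continuous_on UNIV \<sigma>"
proof (rule convex_on_continuous)
  have hom: "\<sigma> (c *\<^sub>R v) = \<bar>c\<bar> * \<sigma> v" and tri: "\<sigma> (v + w) \<le> \<sigma> v + \<sigma> w" for c v w
    using assms by (auto simp: seminorm_def)
  show "convex_on UNIV \<sigma>"
  proof (rule convex_onI)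
    fix t :: real and x y assume "0 < t" "t < 1"
    then show "\<sigma> ((1 - t) *\<^sub>R x + t *\<^sub>R y) \<le> (1 - t) * \<sigma> x + t * \<sigma> y"
      using tri[of "(1 - t) *\<^sub>R x" "t *\<^sub>R y"] by (simp add: hom)
  qed simp
qed simp

text \<open>Exchange argument: a basis of the kernel is completed by standard basis vectors, and the
  added ones span a coordinate plane on which \<open>\<sigma>\<close> is a norm. Compactness of its
  unit sphere provides \<open>a\<close>.\<close>

lemma seminorm_coordinate_complement:
  fixes \<sigma> :: "real ^ 'n::finite \<Rightarrow> real"
  assumes \<sigma>: "seminorm \<sigma>" and rank: "seminorm_rank \<sigma> = CARD('m::finite)"
  obtains j :: "'m::finite \<Rightarrow> 'n" and a where "inj j" "0 < a" "\<And>x. a * norm x \<le> \<sigma> (coord_incl j x)"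
proof -
  define V where "V = {v. \<sigma> v = 0}"
  have V: "subspace V" unfolding V_def by (rule seminorm_subspace[OF \<sigma>])
  \<comment> \<open>The rank is a difference of natural numbers; that it is positive rules out
    truncation.\<close>
  have dimV: "dim V + CARD('m) = CARD('n)"
  proof -
    have "CARD('n) - dim V = CARD('m)" using rank by (simp add: seminorm_rank_def V_def)
    moreover have "0 < CARD('m)" by simp
    ultimately show ?thesis by linarith
  qed
  obtain B where B: "B \<subseteq> V" "independent B" "V \<subseteq> span B" "card B = dim V"
    using basis_exists[of V] by metis
  obtain B' where B': "B \<subseteq> B'" "B' \<subseteq> B \<union> Basis" "independent B'" "B \<union> Basis \<subseteq> span B'"
    using maximal_independent_subset_extend[OF _ B(2), of "B \<union> Basis"] by blast
  define Q where "Q = B' - B"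
  have Q: "Q \<subseteq> Basis" "B' = B \<union> Q" "B \<inter> Q = {}" using B' by (auto simp: Q_def)
  have spanB': "span B' = UNIV"
  proof -
    have "span Basis \<subseteq> span B'" using B'(4) by (intro span_minimal subspace_span) auto
    then show ?thesis by (auto simp: span_Basis)
  qed
  have finB': "finite B'" using B'(3) independent_imp_finite by blast
  have "card B' = CARD('n)"
    using dim_eq_card_independent[OF B'(3)] dim_span[of B'] spanB' by simp
  moreover have "card B' = card B + card Q"
    unfolding Q(2) using finB' Q by (intro card_Un_disjoint) auto
  ultimately have cardQ: "card Q = CARD('m)" using dimV B(4) by simp
  have "independent Q" using B'(3) by (rule independent_mono) (auto simp: Q_def)
  then have dimQ: "dim (span Q) = CARD('m)" using cardQ by (simp add: dim_eq_card_independent)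
  have "{x + y |x y. x \<in> V \<and> y \<in> span Q} = UNIV"
  proof -
    have "UNIV = span (B \<union> Q)" using spanB' Q by simp
    also have "\<dots> = {x + y |x y. x \<in> span B \<and> y \<in> span Q}" by (rule span_Un)
    also have "\<dots> \<subseteq> {x + y |x y. x \<in> V \<and> y \<in> span Q}"
      using span_minimal[OF B(1) V] by blast
    finally show ?thesis by blast
  qed
  \<comment> \<open>The sum of the two subspaces is everything and their dimensions add up to
    \<open>CARD('n)\<close>, so the dimension formula leaves 0 for the intersection.\<close>
  then have "dim (V \<inter> span Q) = 0"
    using dim_sums_Int[OF V subspace_span, of Q] dimQ dimV by simp
  then have int: "V \<inter> span Q \<subseteq> {0}" by (simp add: dim_eq_0)
  have Basis_eq: "(Basis :: (real ^ 'n) set) = range (\<lambda>i. axis i 1)"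
    by (auto simp: Basis_vec_def)
  then obtain I where I: "Q = (\<lambda>i. axis i 1) ` I" using Q(1) subset_imageE by metis
  have "inj_on (\<lambda>i. axis i 1 :: real ^ 'n) I" by (auto simp: inj_on_def axis_eq_axis)
  then have "card I = CARD('m)" using cardQ I by (simp add: card_image)
  then obtain j :: "'m \<Rightarrow> 'n" where j: "bij_betw j UNIV I"
    using finite_same_card_bij[of "UNIV :: 'm set" I] by auto
  have inj: "inj j" using j by (simp add: bij_betw_def)
  have inQ: "coord_incl j x \<in> span Q" for x
    unfolding coord_incl_def
  proof (intro span_sum span_scale span_base)
    fix l show "axis (j l) 1 \<in> Q" using j by (auto simp: I bij_betw_def)
  qed
  have pos: "0 < \<sigma> (coord_incl j x)" if "x \<noteq> 0" for x
  proof (rule ccontr)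
    assume "\<not> ?thesis"
    moreover have "0 \<le> \<sigma> (coord_incl j x)" using \<sigma> by (simp add: seminorm_def)
    ultimately have "coord_incl j x \<in> V" by (simp add: V_def)
    then have "norm (coord_incl j x) = 0" using int inQ by auto
    then show False using that by (simp add: norm_coord_incl[OF inj])
  qed
  have cont: "continuous_on S (\<lambda>x. \<sigma> (coord_incl j x))" for S
    by (rule continuous_on_compose2[OF seminorm_continuous[OF \<sigma>]])
       (auto intro: linear_continuous_on[OF linear_linear[THEN iffD2]] linear_coord_incl)
  have "sphere (0 :: real ^ 'm) 1 \<noteq> {}" by (simp add: sphere_eq_empty)
  then obtain x0 where x0: "x0 \<in> sphere (0 :: real ^ 'm) 1"
    "\<And>x. x \<in> sphere 0 1 \<Longrightarrow> \<sigma> (coord_incl j x0) \<le> \<sigma> (coord_incl j x)"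
    using continuous_attains_inf[OF compact_sphere _ cont] by metis
  show ?thesis
  proof (rule that[OF inj])
    show "0 < \<sigma> (coord_incl j x0)" using x0(1) by (intro pos) auto
    fix x :: "real ^ 'm"
    have hom: "\<sigma> (c *\<^sub>R v) = \<bar>c\<bar> * \<sigma> v" for c v using \<sigma> by (simp add: seminorm_def)
    show "\<sigma> (coord_incl j x0) * norm x \<le> \<sigma> (coord_incl j x)"
    proof (cases "x = 0")
      case True
      then show ?thesis using \<sigma> by (simp add: seminorm_def)
    next
      case False
      have "\<sigma> (coord_incl j x0) \<le> \<sigma> (coord_incl j (inverse (norm x) *\<^sub>R x))"
        using False by (intro x0(2)) simp
      also have "\<dots> = inverse (norm x) * \<sigma> (coord_incl j x)"
        by (simp add: linear_scale[OF linear_coord_incl] hom)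
      finally show ?thesis using False by (simp add: field_simps)
    qed
  qed
qed

text \<open>\<open>H\<close> is \<open>l / 2\<close>-Lipschitz on the whole space, so
  \<open>G\<close> shrinks distances at most by the factor \<open>l / 2\<close>, and
  \<open>G x = y\<close> is solved by a contraction. The same lower bound for the derivatives of
  \<open>G\<close> bounds their inverses uniformly, which makes these depend continuously on the
  point.\<close>

lemma C1_diffeomorphism_linear_perturbation:
  fixes L :: "'a::euclidean_space \<Rightarrow> 'a"
  assumes L: "linear L" "\<And>x. l * norm x \<le> norm (L x)" and l: "0 < l"
    and H: "\<And>x. (H has_derivative blinfun_apply (H' x)) (at x)" "continuous_on UNIV H'"
    and H': "\<And>x. norm (H' x) \<le> l / 2"
  shows "C1_diffeomorphism (\<lambda>x. L x + H x)"
proof -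
  define G where "G = (\<lambda>x. L x + H x)"
  have bL: "bounded_linear L" using L(1) by (simp add: linear_linear)
  define G' where "G' = (\<lambda>x. Blinfun L + H' x)"
  have BL: "blinfun_apply (Blinfun L) = L" using bL by (rule bounded_linear_Blinfun_apply)
  have G'_apply: "blinfun_apply (G' x) h = L h + blinfun_apply (H' x) h" for x h
    by (simp add: G'_def BL blinfun.add_left)
  have derG: "(G has_derivative blinfun_apply (G' x)) (at x)" for x
  proof -
    have "(G has_derivative (\<lambda>h. L h + blinfun_apply (H' x) h)) (at x)"
      unfolding G_def by (intro has_derivative_add bounded_linear_imp_has_derivative[OF bL] H(1))
    then show ?thesis by (simp add: G'_apply[abs_def])
  qed
  have cG': "continuous_on UNIV G'" unfolding G'_def by (intro continuous_intros H(2))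
  have HL: "norm (H x - H y) \<le> l / 2 * norm (x - y)" for x y
  proof (rule differentiable_bound[where S = UNIV])
    show "(H has_derivative blinfun_apply (H' x)) (at x within UNIV)" for x using H(1) by simp
    show "onorm (blinfun_apply (H' x)) \<le> l / 2" for x using H'[of x] by (simp add: norm_blinfun.rep_eq)
  qed auto
  have injL: "inj L"
  proof (rule injI)
    fix x y assume "L x = L y"
    then have "L (x - y) = 0" by (simp add: linear_diff[OF L(1)])
    then have "l * norm (x - y) \<le> 0" using L(2)[of "x - y"] by simp
    then show "x = y" using l by (simp add: mult_le_0_iff)
  qed
  have lower: "l / 2 * norm (x - y) \<le> norm (G x - G y)" for x y
  proof -
    have "G x - G y = L (x - y) + (H x - H y)" by (simp add: G_def linear_diff[OF L(1)])
    then have "norm (L (x - y)) - norm (H x - H y) \<le> norm (G x - G y)" by (metis norm_diff_ineq)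
    then show ?thesis using L(2)[of "x - y"] HL[of x y] by simp
  qed
  have injG: "inj G"
  proof (rule injI)
    fix x y assume "G x = G y"
    then have "l / 2 * norm (x - y) \<le> 0" using lower[of x y] by simp
    then show "x = y" using l by (simp add: mult_le_0_iff)
  qed
  obtain M where M: "linear M" "\<And>x. M (L x) = x" "\<And>y. L (M y) = y"
    using linear_injective_isomorphism[OF L(1) injL] by metis
  have Mb: "norm (M y) \<le> norm y / l" for y
    using L(2)[of "M y"] l by (simp add: M field_simps)
  have surjG: "surj G"
  proof (rule surjI)
    fix y
    \<comment> \<open>This is \<open>G x = y\<close> solved for the linear part; \<open>M\<close>
      has norm at most \<open>1 / l\<close> and \<open>H\<close> Lipschitz constant
      \<open>l / 2\<close>, hence the factor 1/2.\<close>
    have "\<exists>!x. M (y - H x) = x"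
    proof (rule banach_fix_type[of "1 / 2"])
      show "\<forall>x z. dist (M (y - H x)) (M (y - H z)) \<le> 1 / 2 * dist x z"
      proof (intro allI)
        fix x z
        have "M (y - H x) - M (y - H z) = M (H z - H x)" by (simp add: linear_diff[OF M(1), symmetric])
        then have "dist (M (y - H x)) (M (y - H z)) \<le> norm (H z - H x) / l" using Mb[of "H z - H x"] by (simp add: dist_norm)
        also have "\<dots> \<le> (l / 2 * norm (z - x)) / l" using HL[of z x] l by (intro divide_right_mono) auto
        also have "\<dots> = 1 / 2 * dist x z" using l by (simp add: dist_norm norm_minus_commute)
        finally show "dist (M (y - H x)) (M (y - H z)) \<le> 1 / 2 * dist x z" .
      qed
    qed auto
    then obtain x where "M (y - H x) = x" by blast
    then have "G x = y" using M(3)[of "y - H x"] by (simp add: G_def)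
    then show "G (SOME x. G x = y) = y" by (rule someI)
  qed
  have bij: "bij G" using injG surjG by (simp add: bij_def)
  have lower': "l / 2 * norm h \<le> norm (blinfun_apply (G' x) h)" for x h
  proof -
    have "norm (blinfun_apply (H' x) h) \<le> l / 2 * norm h"
      using norm_blinfun[of "H' x" h] mult_right_mono[OF H'[of x] norm_ge_zero[of h]] by linarith
    moreover have "norm (L h) - norm (blinfun_apply (H' x) h) \<le> norm (blinfun_apply (G' x) h)"
      unfolding G'_apply by (rule norm_diff_ineq)
    ultimately show ?thesis using L(2)[of h] by simp
  qed
  have "\<exists>N. linear N \<and> (\<forall>h. N (blinfun_apply (G' x) h) = h) \<and> (\<forall>h. blinfun_apply (G' x) (N h) = h)" for x
  proof -
    have lin: "linear (blinfun_apply (G' x))" using blinfun.bounded_linear_right linear_linear by blast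
    have "inj (blinfun_apply (G' x))"
    proof (rule injI)
      fix h k assume "blinfun_apply (G' x) h = blinfun_apply (G' x) k"
      then have "blinfun_apply (G' x) (h - k) = 0" by (simp add: blinfun.diff_right)
      then have "l / 2 * norm (h - k) \<le> 0" using lower'[of "h - k" x] by simp
      then show "h = k" using l by (simp add: mult_le_0_iff)
    qed
    from linear_injective_isomorphism[OF lin this] show ?thesis by metis
  qed
  then obtain N where N: "\<And>x. linear (N x)" "\<And>x h. N x (blinfun_apply (G' x) h) = h"
    "\<And>x h. blinfun_apply (G' x) (N x h) = h" by metis
  have Nb: "norm (N x h) \<le> 2 / l * norm h" for x h
    using lower'[of "N x h" x] l by (simp add: N field_simps)
  define N' where "N' = (\<lambda>x. Blinfun (N x))"
  have N'_apply: "blinfun_apply (N' x) = N x" for x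
    unfolding N'_def using N(1) by (intro bounded_linear_Blinfun_apply) (simp add: linear_linear)
  have N'_lip: "norm (N' x - N' y) \<le> (2 / l * (2 / l)) * norm (G' x - G' y)" for x y
  proof (rule norm_blinfun_bound)
    fix h
    \<comment> \<open>Resolvent identity: the difference of the inverses is \<open>N x\<close> after
      \<open>G' y - G' x\<close> after \<open>N y\<close>, and both inverses have norm at most
      \<open>2 / l\<close>.\<close>
    let ?d = "blinfun_apply (G' y) (N y h) - blinfun_apply (G' x) (N y h)"
    have "N x h - N y h = N x ?d"
      by (simp add: N linear_diff[OF N(1)])
    then have "norm (N x h - N y h) \<le> 2 / l * norm ?d"
      using Nb by simp
    moreover have "norm ?d \<le> norm (G' x - G' y) * norm (N y h)"
      using norm_blinfun[of "G' x - G' y" "N y h"] by (simp add: blinfun.diff_left norm_minus_commute)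
    moreover have "norm (G' x - G' y) * norm (N y h) \<le> norm (G' x - G' y) * (2 / l * norm h)"
      using Nb by (intro mult_left_mono) auto
    ultimately have "norm (N x h - N y h) \<le> 2 / l * (norm (G' x - G' y) * (2 / l * norm h))"
      using l by (meson divide_nonneg_pos mult_left_mono order_trans zero_le_numeral)
    then show "norm (blinfun_apply (N' x - N' y) h) \<le> (2 / l * (2 / l)) * norm (G' x - G' y) * norm h"
      by (simp add: blinfun.diff_left N'_apply mult_ac)
  qed (use l in simp)
  have Ginv: "G (inv G y) = y" for y using surjG by (simp add: surj_f_inv_f)
  have cinv: "continuous_on UNIV (inv G)"
  proof -
    have "(2 / l)-lipschitz_on UNIV (inv G)"
    proof (rule lipschitz_onI)
      fix x y
      show "dist (inv G x) (inv G y) \<le> 2 / l * dist x y"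
        using lower[of "inv G x" "inv G y"] l by (simp add: Ginv dist_norm field_simps)
    qed (use l in simp)
    then show ?thesis by (rule lipschitz_on_continuous_on)
  qed
  have cN: "continuous_on UNIV N'"
    unfolding continuous_on_def
  proof
    fix x
    have "(G' \<longlongrightarrow> G' x) (at x)" using cG' by (simp add: continuous_on_def)
    then have "((\<lambda>y. (2 / l * (2 / l)) * norm (G' y - G' x)) \<longlongrightarrow> (2 / l * (2 / l)) * norm (G' x - G' x)) (at x)"
      by (intro tendsto_intros)
    then have "((\<lambda>y. N' y - N' x) \<longlongrightarrow> 0) (at x)"
      by (intro Lim_null_comparison[OF always_eventually[rule_format, OF N'_lip]]) simp
    then show "(N' \<longlongrightarrow> N' x) (at x within UNIV)" by (simp add: LIM_zero_iff)
  qed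
  have "C1_map (inv G)"
    unfolding C1_map_def
  proof (intro exI[of _ "\<lambda>y. N' (inv G y)"] conjI allI)
    show "continuous_on UNIV (\<lambda>y. N' (inv G y))"
      by (rule continuous_on_compose2[OF cN cinv]) auto
    fix y
    show "(inv G has_derivative blinfun_apply (N' (inv G y))) (at y)"
    proof (rule has_derivative_inverse_basic[where T = UNIV and f = G])
      show "(G has_derivative blinfun_apply (G' (inv G y))) (at (inv G y))" by (rule derG)
      show "bounded_linear (blinfun_apply (N' (inv G y)))" by (rule blinfun.bounded_linear_right)
      show "blinfun_apply (N' (inv G y)) \<circ> blinfun_apply (G' (inv G y)) = id" by (auto simp: N'_apply N fun_eq_iff)
      show "continuous (at y) (inv G)" using cinv by (simp add: continuous_on_eq_continuous_at)
    qed (auto simp: Ginv)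
  qed
  moreover have "C1_map G" unfolding C1_map_def using derG cG' by blast
  ultimately show ?thesis using bij unfolding C1_diffeomorphism_def G_def by blast
qed

section \<open>Factorization\<close>

text \<open>Confines a set to the scale at which a pointwise estimate is valid, so that the estimate
  holds for every pair of its points.\<close>

lemma nonnegligible_Int_small_open:
  fixes S :: "'a::euclidean_space set"
  assumes "\<not> negligible S" "0 < r"
  obtains U where "open U" "\<not> negligible (S \<inter> U)" "\<And>p q. p \<in> U \<Longrightarrow> q \<in> U \<Longrightarrow> dist p q < r"
proof -
  obtain D :: "'a set" where D: "countable D" "\<And>X. open X \<Longrightarrow> X \<noteq> {} \<Longrightarrow> \<exists>v\<in>D. v \<in> X"
    using countable_dense_setE by blast
  have cover: "x \<in> (\<Union>c\<in>D. ball c (r / 2))" for x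
  proof -
    obtain c where "c \<in> D" "c \<in> ball x (r / 2)" using D(2)[of "ball x (r / 2)"] assms(2) by auto
    then show ?thesis by (auto simp: dist_commute)
  qed
  have "AE p in lebesgue. p \<in> S \<longrightarrow> p \<in> (\<Union>c\<in>D. ball c (r / 2))"
    by (intro AE_I2 impI cover)
  then obtain c where c: "\<not> negligible (S \<inter> ball c (r / 2))"
    by (rule nonnegligible_AE_Union[OF assms(1) D(1)])
  have "dist p q < r" if "p \<in> ball c (r / 2)" "q \<in> ball c (r / 2)" for p q
    using that dist_triangle[of p q c] by (simp add: dist_commute)
  then show ?thesis by (rule that[OF open_ball c])
qed

text \<open>\<open>\<kappa>\<close> is both the constant and the reciprocal of the scale, so integer
  values exhaust all cases. The second point ranges over \<open>\<Omega>\<close>: the derivative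
  estimate needs it outside the compact set under study.\<close>

definition noncollapsed_set ::
    "('b::real_normed_vector \<Rightarrow> 'x::metric_space) \<Rightarrow> 'b set \<Rightarrow> ('a::real_normed_vector \<Rightarrow> 'b) \<Rightarrow> real \<Rightarrow> 'b set" where
  "noncollapsed_set f \<Omega> T \<kappa> =
     {p \<in> \<Omega>. \<forall>x. p + T x \<in> \<Omega> \<longrightarrow> norm x < 1 / \<kappa> \<longrightarrow> norm x \<le> \<kappa> * dist (f (p + T x)) (f p)}"

text \<open>For each fixed \<open>x\<close> the violations form an open set, and so does their union
  over all \<open>x\<close>; the set is therefore closed relative to
  \<open>\<Omega>\<close>.\<close>

lemma borel_noncollapsed_set:
  assumes \<Omega>: "open \<Omega>" and f: "continuous_on \<Omega> f"
  shows "noncollapsed_set f \<Omega> T \<kappa> \<in> sets borel"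
proof -
  define B where "B = (\<lambda>x. {p \<in> \<Omega> \<inter> {p. p + T x \<in> \<Omega>}. \<kappa> * dist (f (p + T x)) (f p) < norm x})"
  have "open (B x)" for x
  proof -
    have "open ((\<lambda>p. p + T x) -` \<Omega>)" by (intro open_vimage \<Omega> continuous_intros)
    then have U: "open (\<Omega> \<inter> {p. p + T x \<in> \<Omega>})" using \<Omega> by (simp add: vimage_def open_Int)
    have "continuous_on (\<Omega> \<inter> {p. p + T x \<in> \<Omega>}) (\<lambda>p. f (p + T x))"
      by (rule continuous_on_compose2[OF f]) (auto intro!: continuous_intros)
    moreover have "continuous_on (\<Omega> \<inter> {p. p + T x \<in> \<Omega>}) f" by (rule continuous_on_subset[OF f]) auto
    ultimately have "continuous_on (\<Omega> \<inter> {p. p + T x \<in> \<Omega>}) (\<lambda>p. \<kappa> * dist (f (p + T x)) (f p))"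
      by (intro continuous_intros)
    then have "\<exists>A. open A \<and> A \<inter> (\<Omega> \<inter> {p. p + T x \<in> \<Omega>}) = B x"
      unfolding B_def by (intro open_Collect_less_Int) (auto intro: continuous_intros)
    then show ?thesis using U by (metis open_Int)
  qed
  then have "open (\<Union>x\<in>{x. norm x < 1 / \<kappa>}. B x)" by blast
  moreover have "noncollapsed_set f \<Omega> T \<kappa> = \<Omega> - (\<Union>x\<in>{x. norm x < 1 / \<kappa>}. B x)"
    by (auto simp: noncollapsed_set_def B_def not_less)
  ultimately show ?thesis using \<Omega> by auto
qed

lemma metric_differential_noncollapsed:
  fixes f :: "'b::euclidean_space \<Rightarrow> 'x::metric_space" and T :: "'a::real_normed_vector \<Rightarrow> 'b"
  assumes \<Omega>: "p \<in> \<Omega>" and md: "has_metric_differential f \<sigma> p \<Omega>"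
    and T: "\<And>x. norm (T x) = norm x" and a: "0 < a" "\<And>x. a * norm x \<le> \<sigma> (T x)"
  obtains k where "p \<in> noncollapsed_set f \<Omega> T (real (Suc k))"
proof -
  have "\<forall>\<^sub>F y in at p within \<Omega>. dist ((dist (f y) (f p) - \<sigma> (y - p)) / norm (y - p)) 0 < a / 2"
    using md a(1) unfolding has_metric_differential_def by (intro tendstoD) auto
  then obtain d where d: "d > 0" "\<And>y. y \<in> \<Omega> \<Longrightarrow> y \<noteq> p \<Longrightarrow> dist y p < d \<Longrightarrow>
      \<bar>(dist (f y) (f p) - \<sigma> (y - p)) / norm (y - p)\<bar> < a / 2"
    unfolding eventually_at by auto
  \<comment> \<open>Below \<open>d\<close> the differential approximates with error
    \<open>a / 2\<close>, which leaves a lower bound \<open>a / 2 * norm x\<close>; one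
    \<open>k\<close> takes care of both scale and constant.\<close>
  obtain k where k: "1 / real (Suc k) < min d (a / 2)" using nat_approx_posE[of "min d (a / 2)"] d(1) a(1) by auto
  have "p \<in> noncollapsed_set f \<Omega> T (real (Suc k))"
    unfolding noncollapsed_set_def
  proof (intro CollectI conjI \<Omega> allI impI)
    fix x assume x: "p + T x \<in> \<Omega>" "norm x < 1 / real (Suc k)"
    show "norm x \<le> real (Suc k) * dist (f (p + T x)) (f p)"
    proof (cases "x = 0")
      case False
      then have ne: "norm (T x) > 0" by (simp add: T)
      then have "p + T x \<noteq> p" by auto
      moreover have "dist (p + T x) p < d" using x(2) k by (simp add: dist_norm T)
      ultimately have "\<bar>(dist (f (p + T x)) (f p) - \<sigma> (T x)) / norm (T x)\<bar> < a / 2"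
        using d(2)[OF x(1)] by simp
      then have "\<bar>dist (f (p + T x)) (f p) - \<sigma> (T x)\<bar> < a / 2 * norm x"
        using ne by (simp add: abs_divide T pos_divide_less_eq)
      then have "a / 2 * norm x \<le> dist (f (p + T x)) (f p)"
      proof -
        have "a / 2 * norm x = a * norm x / 2" by simp
        then show ?thesis using a(2)[of x] \<open>\<bar>dist (f (p + T x)) (f p) - \<sigma> (T x)\<bar> < a / 2 * norm x\<close> by linarith
      qed
      moreover have "1 / real (Suc k) * norm x \<le> a / 2 * norm x" using k by (intro mult_right_mono) auto
      ultimately have "1 / real (Suc k) * norm x \<le> dist (f (p + T x)) (f p)" by linarith
      then show ?thesis by (simp add: field_simps)
    qed simp
  qed
  then show ?thesis by (rule that)
qed

text \<open>Form of the density substitute for all directions at once, by Rademacher's theorem: the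
  distance function has a minimum at each point of \<open>K\<close>.\<close>

lemma AE_infdist_derivative_0:
  fixes K :: "'a::euclidean_space set"
  shows "AE p in lebesgue. p \<in> K \<longrightarrow> ((\<lambda>y. infdist y K) has_derivative (\<lambda>_. 0)) (at p)"
proof -
  have "1-lipschitz_on UNIV (\<lambda>x. infdist x K)"
    by (rule lipschitz_onI) (auto simp: dist_real_def infdist_triangle_abs)
  from lipschitz_AE_has_derivative_real[OF this] show ?thesis
  proof (rule eventually_mono, intro impI)
    fix p assume "\<exists>A. ((\<lambda>y. infdist y K) has_derivative A) (at p)" and p: "p \<in> K"
    then obtain A where A: "((\<lambda>y. infdist y K) has_derivative A) (at p)" by blast
    have "A = (\<lambda>_. 0)"
      by (rule differential_zero_maxmin[OF UNIV_I open_UNIV A]) (simp add: p infdist_nonneg)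
    then show "((\<lambda>y. infdist y K) has_derivative (\<lambda>_. 0)) (at p)" using A by simp
  qed
qed

text \<open>The point \<open>y = p + T (t *\<^sub>R x)\<close> may lie outside \<open>K\<close>,
  where \<open>g\<close> says nothing about \<open>f\<close>. A nearest point \<open>q\<close> of
  \<open>K\<close> is o(t)-close to \<open>y\<close>, so the increment of \<open>f\<close> from
  \<open>p\<close> to \<open>q\<close> is still about \<open>t * norm x / \<kappa>\<close>, while
  \<open>fg\<close> bounds it by \<open>M\<close> times an increment of \<open>g\<close> close to
  \<open>t * norm (A (T x))\<close>.\<close>

lemma noncollapsed_derivative_lower_bound:
  fixes f :: "'b::euclidean_space \<Rightarrow> 'x::metric_space" and T :: "'a::real_normed_vector \<Rightarrow> 'b"
    and g :: "'b \<Rightarrow> 'c::real_normed_vector"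
  assumes \<Omega>: "open \<Omega>" and K: "closed K" "K \<subseteq> \<Omega>" "p \<in> K"
    and T: "linear T" "\<And>x. norm (T x) = norm x"
    and f: "M-lipschitz_on \<Omega> f" and g: "\<Lambda>-lipschitz_on UNIV g"
    and A: "(g has_derivative A) (at p)"
    and dens: "((\<lambda>y. infdist y K) has_derivative (\<lambda>_. 0)) (at p)"
    and fg: "\<And>q. q \<in> K \<Longrightarrow> dist (f q) (f p) \<le> M * norm (g q - g p)"
    and p: "p \<in> noncollapsed_set f \<Omega> T \<kappa>" and \<kappa>: "0 < \<kappa>"
  shows "norm x \<le> \<kappa> * M * norm (A (T x))"
proof (cases "x = 0")
  case False
  have M: "0 \<le> M" using lipschitz_on_nonneg[OF f] .
  have \<Lambda>: "0 \<le> \<Lambda>" using lipschitz_on_nonneg[OF g] .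
  have linA: "linear A" using A by (rule has_derivative_linear)
  \<comment> \<open>Collects three errors: replacing \<open>y\<close> by \<open>q\<close> in
    \<open>f\<close> and in \<open>g\<close> (the latter with factor \<open>\<Lambda>\<close>), and
    the differentiability error of \<open>g\<close>.\<close>
  define c where "c = \<kappa> * M * ((2 + \<Lambda>) * norm x)"
  have c: "0 \<le> c" using M \<Lambda> \<kappa> by (simp add: c_def)
  have bound: "norm x \<le> \<kappa> * M * norm (A (T x)) + c * \<epsilon>" if \<epsilon>: "0 < \<epsilon>" for \<epsilon>
  proof -
    obtain d1 where d1: "d1 > 0" "\<And>y. norm (y - p) < d1 \<Longrightarrow> \<bar>infdist y K\<bar> \<le> \<epsilon> * norm (y - p)"
      using dens \<epsilon> K(3) unfolding has_derivative_at_alt by auto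
    obtain d2 where d2: "d2 > 0" "\<And>y. norm (y - p) < d2 \<Longrightarrow> norm (g y - g p - A (y - p)) \<le> \<epsilon> * norm (y - p)"
      using A \<epsilon> unfolding has_derivative_at_alt by blast
    obtain d3 where d3: "d3 > 0" "ball p d3 \<subseteq> \<Omega>" using \<Omega> K by (meson openE subsetD)
    \<comment> \<open>\<open>1 / \<kappa>\<close> is the scale built into
      \<open>noncollapsed_set\<close>; below, \<open>t\<close> places \<open>y\<close> at distance
      \<open>\<mu> / 2\<close> from \<open>p\<close>.\<close>
    define \<mu> where "\<mu> = Min {d1, d2, d3, 1 / \<kappa>}"
    have \<mu>: "0 < \<mu>" "\<mu> \<le> d1" "\<mu> \<le> d2" "\<mu> \<le> d3" "\<mu> \<le> 1 / \<kappa>"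
      using d1(1) d2(1) d3(1) \<kappa> by (auto simp: \<mu>_def)
    define t where "t = \<mu> / (2 * norm x)"
    have t0: "t > 0" using \<mu>(1) False by (simp add: t_def)
    have tx: "t * norm x = \<mu> / 2" using False by (simp add: t_def)
    have t: "t * norm x < d1" "t * norm x < d2" "t * norm x < d3" "t * norm x < 1 / \<kappa>"
      unfolding tx using \<mu> by linarith+
    define s where "s = \<epsilon> * (t * norm x)"
    define y where "y = p + T (t *\<^sub>R x)"
    have ny: "norm (y - p) = t * norm x" using t0 by (simp add: y_def T)
    have y\<Omega>: "y \<in> \<Omega>" using d3(2) t(3) ny by (auto simp: dist_norm norm_minus_commute)
    obtain q where q: "q \<in> K" "infdist y K = dist y q" using infdist_attains_inf[OF K(1), of y] K(3) by blast
    have yq: "dist y q \<le> s" using d1(2)[of y] t(1) ny q(2) by (simp add: s_def)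
    have "norm (t *\<^sub>R x) < 1 / \<kappa>" using t(4) t0 by simp
    then have "norm (t *\<^sub>R x) \<le> \<kappa> * dist (f (p + T (t *\<^sub>R x))) (f p)"
      using p y\<Omega> unfolding noncollapsed_set_def y_def by blast
    then have 1: "t * norm x \<le> \<kappa> * dist (f y) (f p)" using t0 by (simp add: y_def)
    have "dist (f y) (f p) \<le> dist (f y) (f q) + dist (f q) (f p)" by (rule dist_triangle)
    also have "dist (f y) (f q) \<le> M * s"
      using lipschitz_onD[OF f y\<Omega>, of q] q(1) K(2) mult_left_mono[OF yq M] by auto
    finally have 2: "dist (f y) (f p) \<le> M * s + M * norm (g q - g p)" using fg[OF q(1)] by simp
    have "norm (g q - g p) \<le> norm (g q - g y) + (norm (g y - g p - A (y - p)) + norm (A (y - p)))"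
      using norm_triangle_ineq[of "g q - g y" "g y - g p"] norm_triangle_ineq[of "g y - g p - A (y - p)" "A (y - p)"] by simp
    moreover have "norm (g q - g y) \<le> \<Lambda> * s"
      using lipschitz_onD[OF g, of q y] mult_left_mono[OF yq \<Lambda>] by (simp add: dist_norm norm_minus_commute)
    moreover have "norm (g y - g p - A (y - p)) \<le> s" using d2(2)[of y] t(2) ny by (simp add: s_def)
    moreover have "norm (A (y - p)) = t * norm (A (T x))"
      using t0 by (simp add: y_def linear_scale[OF T(1)] linear_scale[OF linA])
    ultimately have 3: "norm (g q - g p) \<le> \<Lambda> * s + (s + t * norm (A (T x)))"
      by linarith
    have "dist (f y) (f p) \<le> M * s + M * (\<Lambda> * s + (s + t * norm (A (T x))))"
      using 2 mult_left_mono[OF 3 M] by linarith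
    then have "\<kappa> * dist (f y) (f p) \<le> \<kappa> * (M * s + M * (\<Lambda> * s + (s + t * norm (A (T x)))))"
      using \<kappa> by (intro mult_left_mono) auto
    also have "\<dots> = t * (\<kappa> * M * norm (A (T x)) + c * \<epsilon>)"
      by (simp add: c_def s_def algebra_simps)
    finally have "t * norm x \<le> t * (\<kappa> * M * norm (A (T x)) + c * \<epsilon>)" using 1 by linarith
    then show ?thesis using t0 by simp
  qed
  show ?thesis
  proof (rule field_le_epsilon)
    fix e :: real assume e: "0 < e"
    have "c * (e / (c + 1)) \<le> e" using c e by (simp add: field_simps)
    then show "norm x \<le> \<kappa> * M * norm (A (T x)) + e" using bound[of "e / (c + 1)"] c e by simp
  qed
qed (use \<kappa> lipschitz_on_nonneg[OF f] in simp)

section \<open>Straightening by a global diffeomorphism\<close>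

lemma norm_vec_lambda_le:
  fixes v :: "'m::finite \<Rightarrow> real"
  assumes "\<And>l. \<bar>v l\<bar> \<le> B"
  shows "norm (\<chi> l. v l) \<le> real CARD('m) * B"
proof -
  have "norm (\<chi> l. v l) \<le> (\<Sum>l\<in>UNIV. \<bar>v l\<bar>)" using norm_le_l1_cart[of "\<chi> l. v l"] by simp
  also have "\<dots> \<le> (\<Sum>l\<in>(UNIV :: 'm set). B)" by (intro sum_mono assms)
  finally show ?thesis by simp
qed

text \<open>The linear part \<open>L\<close> has the functionals \<open>a l\<close> as its
  \<open>\<iota>\<close>-coordinates and copies the coordinates outside the range of
  \<open>j\<close> into the others. It is injective because the functionals control the plane of
  \<open>j\<close>. The functions \<open>h l\<close> perturb only the
  \<open>\<iota>\<close>-coordinates.\<close>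

lemma straightening_diffeomorphism:
  fixes \<iota> j :: "'m::finite \<Rightarrow> 'n::finite" and a :: "'m \<Rightarrow> real ^ 'n" and h :: "'m \<Rightarrow> real ^ 'n \<Rightarrow> real"
  assumes inj: "inj \<iota>" "inj j" and b: "0 < b" "\<And>x. b * norm x \<le> norm (\<chi> l. a l \<bullet> coord_incl j x)"
    and R: "\<And>l. norm (a l) \<le> R"
    and h: "\<And>l. continuous_on UNIV (g l)" "\<And>l x. (h l has_derivative (\<lambda>v. g l x \<bullet> v)) (at x)"
    and \<epsilon>: "\<And>l x. norm (g l x) \<le> \<epsilon>" "real CARD('m) * \<epsilon> \<le> 1 / (1 + (1 + real CARD('m) * R) / b) / 2"
  obtains G :: "real ^ 'n \<Rightarrow> real ^ 'n" where "C1_diffeomorphism G" "\<And>p. coord_proj \<iota> (G p) = (\<chi> l. a l \<bullet> p + h l p)"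
proof -
  define m where "m = real CARD('m)"
  have R0: "0 \<le> R" using R norm_ge_zero order_trans by blast
  have m0: "0 \<le> m" by (simp add: m_def)
  \<comment> \<open>Bounds \<open>norm p\<close> by a multiple of \<open>norm (L p)\<close>: the
    part of \<open>p\<close> off the plane costs 1, and the part in the plane
    \<open>(1 + m * R) / b\<close>, since the functionals also see the former.\<close>
  define d where "d = 1 + (1 + m * R) / b"
  have d: "0 < d" using b(1) R0 m0 by (simp add: d_def add_pos_nonneg)
  \<comment> \<open>Both complements have n - m elements and are empty for m = n.\<close>
  have "card (- range \<iota>) = card (- range j)"
    using inj by (simp add: Compl_eq_Diff_UNIV card_Diff_subset card_image)
  then obtain \<beta> where \<beta>: "bij_betw \<beta> (- range \<iota>) (- range j)"
    using finite_same_card_bij[of "- range \<iota>" "- range j"] by auto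
  define L where "L = (\<lambda>p :: real ^ 'n. \<chi> i. if i \<in> range \<iota> then a (inv \<iota> i) \<bullet> p else p $ \<beta> i)"
  have L\<iota>: "L p $ \<iota> l = a l \<bullet> p" for p l using inj(1) by (simp add: L_def)
  have L\<beta>: "L p $ i = p $ \<beta> i" if "i \<notin> range \<iota>" for p i using that by (simp add: L_def)
  have linL: "linear L" by (rule linearI) (auto simp: L_def vec_eq_iff inner_add_right)
  have lower: "1 / d * norm p \<le> norm (L p)" for p
  proof -
    define x where "x = coord_proj j p"
    define p' where "p' = p - coord_incl j x"
    have p'j: "p' $ j l = 0" for l
      by (simp add: p'_def x_def coord_incl_nth[OF inj(2)] coord_proj_def)
    have p'c: "p' $ i = p $ i" if "i \<in> - range j" for i
      using that by (simp add: p'_def coord_incl_nth(2)[OF inj(2)])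
    have "(norm p')\<^sup>2 = (\<Sum>i\<in>- range j. (p $ i)\<^sup>2)"
      unfolding norm_vec_sq sum_UNIV_split_range[OF inj(2)] using p'j p'c by simp
    also have "\<dots> = (\<Sum>i\<in>- range \<iota>. (L p $ i)\<^sup>2)"
      using sum.reindex_bij_betw[OF \<beta>, of "\<lambda>i. (p $ i)\<^sup>2"] L\<beta> by simp
    also have "\<dots> \<le> (norm (L p))\<^sup>2"
      unfolding norm_vec_sq sum_UNIV_split_range[OF inj(1)] by (simp add: sum_nonneg)
    finally have 1: "norm p' \<le> norm (L p)" by (rule power2_le_imp_le) simp
    have "coord_proj \<iota> (L p) = (\<chi> l. a l \<bullet> coord_incl j x) + (\<chi> l. a l \<bullet> p')"
      by (simp add: vec_eq_iff coord_proj_def L\<iota> p'_def inner_diff_right)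
    then have "(\<chi> l. a l \<bullet> coord_incl j x) = coord_proj \<iota> (L p) - (\<chi> l. a l \<bullet> p')" by simp
    then have "norm (\<chi> l. a l \<bullet> coord_incl j x) \<le> norm (coord_proj \<iota> (L p)) + norm (\<chi> l. a l \<bullet> p')"
      by (metis norm_triangle_ineq4)
    also have "norm (\<chi> l. a l \<bullet> p') \<le> m * (R * norm p')"
      unfolding m_def
    proof (rule norm_vec_lambda_le)
      fix l show "\<bar>a l \<bullet> p'\<bar> \<le> R * norm p'"
        using Cauchy_Schwarz_ineq2[of "a l" p'] mult_right_mono[OF R[of l] norm_ge_zero[of p']] by linarith
    qed
    also have "m * (R * norm p') \<le> m * (R * norm (L p))" using 1 m0 R0 by (intro mult_left_mono) auto
    also have "norm (coord_proj \<iota> (L p)) \<le> norm (L p)" by (rule norm_coord_proj_le[OF inj(1)])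
    finally have "b * norm x \<le> (1 + m * R) * norm (L p)" using b(2)[of x] by (simp add: algebra_simps)
    then have 2: "norm x \<le> (1 + m * R) / b * norm (L p)" using b(1) by (simp add: field_simps)
    have "norm p \<le> norm x + norm p'"
      using norm_triangle_ineq[of "coord_incl j x" p'] by (simp add: p'_def norm_coord_incl[OF inj(2)])
    then have "norm p \<le> d * norm (L p)" using 1 2 by (simp add: d_def distrib_right)
    then show ?thesis using d by (simp add: field_simps)
  qed
  define H where "H = (\<lambda>p. \<Sum>l\<in>UNIV. h l p *\<^sub>R axis (\<iota> l) (1 :: real))"
  define H' where "H' = (\<lambda>p. \<Sum>l\<in>UNIV. blinfun_scaleR_left (axis (\<iota> l) (1 :: real)) o\<^sub>L blinfun_inner_right (g l p))"
  have H'_apply: "blinfun_apply (H' p) v = (\<Sum>l\<in>UNIV. (g l p \<bullet> v) *\<^sub>R axis (\<iota> l) 1)" for p v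
    by (simp add: H'_def blinfun.sum_left)
  have "C1_diffeomorphism (\<lambda>p. L p + H p)"
  proof (rule C1_diffeomorphism_linear_perturbation[OF linL lower])
    show "0 < 1 / d" using d by simp
    show "(H has_derivative blinfun_apply (H' x)) (at x)" for x
    proof -
      have "(H has_derivative (\<lambda>v. \<Sum>l\<in>UNIV. (g l x \<bullet> v) *\<^sub>R axis (\<iota> l) 1)) (at x)"
        unfolding H_def by (intro has_derivative_sum has_derivative_scaleR_left h(2))
      then show ?thesis by (simp add: H'_apply[abs_def])
    qed
    show "continuous_on UNIV H'"
      unfolding H'_def
      by (intro continuous_on_sum bounded_bilinear.continuous_on[OF bounded_bilinear_blinfun_compose] continuous_on_const
          bounded_linear.continuous_on[OF bounded_linear_blinfun_inner_right] h(1))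
    fix x
    have "norm (H' x) \<le> m * \<epsilon>"
    proof (rule norm_blinfun_bound)
      have "0 \<le> \<epsilon>" using \<epsilon>(1) norm_ge_zero order_trans by blast
      then show "0 \<le> m * \<epsilon>" using m0 by simp
      fix v
      have "norm (blinfun_apply (H' x) v) \<le> (\<Sum>l\<in>(UNIV :: 'm set). \<epsilon> * norm v)"
        unfolding H'_apply
      proof (rule sum_norm_le)
        fix l
        show "norm ((g l x \<bullet> v) *\<^sub>R axis (\<iota> l) (1 :: real)) \<le> \<epsilon> * norm v"
          using Cauchy_Schwarz_ineq2[of "g l x" v] mult_right_mono[OF \<epsilon>(1)[of l x] norm_ge_zero[of v]] by simp
      qed
      then show "norm (blinfun_apply (H' x) v) \<le> m * \<epsilon> * norm v" by (simp add: m_def)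
    qed
    then show "norm (H' x) \<le> 1 / d / 2" using \<epsilon>(2) by (simp add: d_def m_def)
  qed
  moreover have "coord_proj \<iota> (L p + H p) = (\<chi> l. a l \<bullet> p + h l p)" for p
  proof -
    have "H p $ \<iota> l = (\<Sum>k\<in>UNIV. if l = k then h k p else 0)" for l
      unfolding H_def sum_component using inj(1) by (intro sum.cong refl) (auto simp: axis_def inj_def)
    then show ?thesis by (simp add: vec_eq_iff coord_proj_def L\<iota>)
  qed
  ultimately show ?thesis by (rule that)
qed

lemma has_derivative_vec_lambda_real:
  fixes u :: "'m::finite \<Rightarrow> 'a::real_normed_vector \<Rightarrow> real"
  assumes "\<And>l. (u l has_derivative A l) (at p)"
  shows "((\<lambda>p. \<chi> l. u l p) has_derivative (\<lambda>h. \<chi> l. A l h)) (at p)"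
proof (rule has_derivative_componentwise_within[THEN iffD2], rule ballI)
  fix i :: "real ^ 'm" assume "i \<in> Basis"
  then obtain l where "i = axis l 1" by (auto simp: Basis_vec_def)
  then show "((\<lambda>p. (\<chi> l. u l p) \<bullet> i) has_derivative (\<lambda>h. (\<chi> l. A l h) \<bullet> i)) (at p)"
    using assms[of l] by (simp add: inner_axis)
qed

lemma lipschitz_vec_lambda:
  fixes u :: "'m::finite \<Rightarrow> 'a::real_normed_vector \<Rightarrow> real"
  assumes "\<And>l. \<Lambda>-lipschitz_on S (u l)"
  shows "(real CARD('m) * \<Lambda>)-lipschitz_on S (\<lambda>p. \<chi> l. u l p)"
proof (rule lipschitz_onI)
  fix x y assume "x \<in> S" "y \<in> S"
  then have "norm (\<chi> l. u l x - u l y) \<le> real CARD('m) * (\<Lambda> * dist x y)"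
    using lipschitz_onD[OF assms] by (intro norm_vec_lambda_le) (simp add: dist_real_def)
  moreover have "(\<chi> l. u l x) - (\<chi> l. u l y) = (\<chi> l. u l x - u l y)" by (simp add: vec_eq_iff)
  ultimately show "dist (\<chi> l. u l x) (\<chi> l. u l y) \<le> real CARD('m) * \<Lambda> * dist x y" by (simp add: dist_norm)
qed (use lipschitz_on_nonneg[OF assms] in simp)

text \<open>On a small piece \<open>u l\<close> differs from a fixed functional \<open>a l\<close>
  by an \<open>e\<close>-Lipschitz function, whose C^1 approximation has gradient at most
  \<open>2 * e\<close>. Passing from the derivatives to the slopes \<open>a l\<close> costs half of
  the lower bound \<open>2 * b\<close>.\<close>

lemma straightening_piece:
  fixes \<iota> j :: "'m::finite \<Rightarrow> 'n::finite" and u :: "'m \<Rightarrow> real ^ 'n \<Rightarrow> real"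
  assumes inj: "inj \<iota>" "inj j" and K: "compact K" "\<not> negligible K"
    and u: "\<And>l. \<Lambda>-lipschitz_on UNIV (u l)" and b: "0 < b"
    and AE: "AE p in lebesgue. p \<in> K \<longrightarrow> (\<forall>A. (\<forall>l. (u l has_derivative A l) (at p)) \<longrightarrow>
       (\<forall>x. 2 * b * norm x \<le> norm (\<chi> l. A l (coord_incl j x))))"
  obtains K' G where "compact K'" "K' \<subseteq> K" "\<not> negligible K'" "C1_diffeomorphism G"
    "\<And>p. p \<in> K' \<Longrightarrow> coord_proj \<iota> (G p) = (\<chi> l. u l p)"
proof -
  define m where "m = real CARD('m)"
  have m: "0 < m" by (simp add: m_def)
  define R where "R = \<Lambda> + 1"
  have \<Lambda>: "0 \<le> \<Lambda>" using lipschitz_on_nonneg[OF u] .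
  define s where "s = 1 / (1 + (1 + m * R) / b)"
  have s: "0 < s" using b m \<Lambda> by (simp add: s_def R_def add_pos_nonneg)
  \<comment> \<open>The bound 1 keeps the slopes within \<open>R\<close>, \<open>b / m\<close>
    preserves the lower bound \<open>b\<close> for them, and \<open>s / (4 * m)\<close> makes a
    correction of gradient \<open>2 * e\<close> admissible for the diffeomorphism.\<close>
  define e where "e = Min {1, b / m, s / (4 * m)}"
  have e: "0 < e" "e \<le> 1" "e \<le> b / m" "e \<le> s / (4 * m)" using b m s by (auto simp: e_def)
  have me: "m * e \<le> b" "m * (2 * e) \<le> s / 2" using e(3,4) m by (auto simp: field_simps)
  obtain D :: "(real ^ 'n) set" where D: "countable D" "\<And>X. open X \<Longrightarrow> X \<noteq> {} \<Longrightarrow> \<exists>v\<in>D. v \<in> X"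
    using countable_dense_setE by blast
  define good where "good = {a :: 'm \<Rightarrow> real ^ 'n. (\<forall>l. a l \<in> D \<and> norm (a l) \<le> R) \<and>
      (\<forall>x. b * norm x \<le> norm (\<chi> l. a l \<bullet> coord_incl j x))}"
  define W where "W = (\<lambda>(a, k). \<Inter>l. slope_set (u l) (a l) e (1 / real (Suc k)))"
  have "countable (PiE (UNIV :: 'm set) (\<lambda>_. D))" using D(1) by (intro countable_PiE) auto
  then have "countable good" by (rule countable_subset[rotated]) (auto simp: good_def)
  then have cI: "countable (good \<times> (UNIV :: nat set))" by auto
  have "AE p in lebesgue. \<forall>l\<in>(UNIV :: 'm set). \<exists>A. (u l has_derivative A) (at p)"
    using lipschitz_AE_has_derivative_real[OF u] by (intro AE_finite_allI) auto
  with AE have cover: "AE p in lebesgue. p \<in> K \<longrightarrow> p \<in> (\<Union>i\<in>good \<times> UNIV. W i)"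
  proof eventually_elim
    case (elim p)
    show ?case
    proof
      assume p: "p \<in> K"
      obtain A where A: "\<And>l. (u l has_derivative A l) (at p)" using elim(2) by (metis UNIV_I)
      have lowA: "2 * b * norm x \<le> norm (\<chi> l. A l (coord_incl j x))" for x using elim(1) p A by blast
      have "\<exists>a k. a \<in> D \<and> p \<in> slope_set (u l) a e (1 / real (Suc k)) \<and> (\<forall>h. \<bar>A l h - a \<bullet> h\<bar> \<le> e * norm h)" for l
      proof -
        obtain a k where "a \<in> D" "p \<in> slope_set (u l) a e (1 / real (Suc k))" "\<And>h. \<bar>A l h - a \<bullet> h\<bar> \<le> e * norm h"
          by (rule differentiable_in_slope_set[OF A[of l] e(1) D(2)]; blast)
        then show ?thesis by blast
      qed
      then obtain a k where ak: "\<And>l. a l \<in> D" "\<And>l. p \<in> slope_set (u l) (a l) e (1 / real (Suc (k l)))"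
        "\<And>l h. \<bar>A l h - a l \<bullet> h\<bar> \<le> e * norm h"
        by metis
      define k0 where "k0 = Max (range k)"
      have "p \<in> slope_set (u l) (a l) e (1 / real (Suc k0))" for l
      proof -
        have "k l \<le> k0" by (simp add: k0_def)
        then have "1 / real (Suc k0) \<le> 1 / real (Suc (k l))" by (simp add: field_simps)
        from slope_set_mono[OF this, of "u l" "a l" e] ak(2) show ?thesis by blast
      qed
      then have "p \<in> W (a, k0)" by (simp add: W_def)
      moreover have "norm (a l) \<le> R" for l
        using norm_slope_le[OF u ak(2), of l] e by (simp add: R_def)
      moreover have "b * norm x \<le> norm (\<chi> l. a l \<bullet> coord_incl j x)" (is "_ \<le> norm ?a") for x
      proof -
        let ?A = "\<chi> l. A l (coord_incl j x)" and ?D = "\<chi> l. A l (coord_incl j x) - a l \<bullet> coord_incl j x"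
        have "norm ?D \<le> m * (e * norm x)"
          unfolding m_def using ak(3)[of _ "coord_incl j x"] by (intro norm_vec_lambda_le) (simp add: norm_coord_incl[OF inj(2)])
        also have "\<dots> \<le> b * norm x" using mult_right_mono[OF me(1) norm_ge_zero[of x]] by (simp add: mult.assoc)
        finally have "norm ?D \<le> b * norm x" .
        moreover have eq: "?A = ?D + ?a"
          by (simp add: vec_eq_iff)
        have "norm ?A \<le> norm ?D + norm ?a"
          by (subst eq) (rule norm_triangle_ineq)
        ultimately show ?thesis using lowA[of x] by simp
      qed
      ultimately have "a \<in> good" "p \<in> W (a, k0)" using ak(1) by (auto simp: good_def)
      then show "p \<in> (\<Union>i\<in>good \<times> UNIV. W i)" by blast
    qed
  qed
  obtain i where "i \<in> good \<times> UNIV" "\<not> negligible (K \<inter> W i)"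
    by (rule nonnegligible_AE_Union[OF K(2) cI cover])
  then obtain a k where a: "a \<in> good" and nn: "\<not> negligible (K \<inter> W (a, k))" by auto
  \<comment> \<open>With diameter below \<open>1 / real (Suc k)\<close>, the slope inequality
    applies to all pairs of points of the piece and becomes a Lipschitz bound.\<close>
  obtain V where V: "open V" "\<not> negligible (K \<inter> W (a, k) \<inter> V)"
    "\<And>p q. p \<in> V \<Longrightarrow> q \<in> V \<Longrightarrow> dist p q < 1 / real (Suc k)"
    by (rule nonnegligible_Int_small_open[OF nn, of "1 / real (Suc k)"]) (simp, blast)
  have "closed (W (a, k))"
    unfolding W_def using u by (auto intro!: closed_INT closed_slope_set lipschitz_on_continuous_on)
  moreover have "closed K" using K(1) by (rule compact_imp_closed)
  ultimately have "K \<inter> W (a, k) \<inter> V \<in> sets lebesgue"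
    using V(1) by (intro sets.Int) auto
  then obtain B where B: "compact B" "B \<subseteq> K \<inter> W (a, k) \<inter> V" "\<not> negligible B"
    using nonnegligible_compact_subset V(2) by metis
  have lipB: "e-lipschitz_on B (\<lambda>p. u l p - a l \<bullet> p)" for l
  proof (rule lipschitz_onI)
    fix p q assume pq: "p \<in> B" "q \<in> B"
    then have "dist p q < 1 / real (Suc k)" using B(2) by (intro V(3)) auto
    then have "norm (p - q) \<le> 1 / real (Suc k)" by (simp add: dist_norm)
    moreover have "q \<in> slope_set (u l) (a l) e (1 / real (Suc k))" using pq B(2) by (auto simp: W_def)
    ultimately have "\<bar>u l p - u l q - a l \<bullet> (p - q)\<bar> \<le> e * norm (p - q)" by (intro slope_setD)
    then show "dist (u l p - a l \<bullet> p) (u l q - a l \<bullet> q) \<le> e * dist p q"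
      by (simp add: dist_real_def dist_norm inner_diff_right algebra_simps)
  qed (use e in simp)
  have lmB: "B \<in> lmeasurable" using B(1) by (rule lmeasurable_compact)
  have mB: "0 < measure lebesgue B"
    using B(3) lmB by (simp add: negligible_iff_measure zero_less_measure_iff)
  \<comment> \<open>The \<open>m\<close> exceptional sets together cost at most half of
    \<open>B\<close>.\<close>
  define \<eta> where "\<eta> = measure lebesgue B / (2 * m)"
  have \<eta>: "0 < \<eta>" using mB m by (simp add: \<eta>_def)
  define \<Phi> where "\<Phi> = (\<lambda>l h g N. continuous_on UNIV g \<and> (\<forall>x. (h has_derivative (\<lambda>v. g x \<bullet> v)) (at x)) \<and>
     (\<forall>x. norm (g x) \<le> 2 * e) \<and> N \<in> sets lebesgue \<and> {p \<in> B. h p \<noteq> u l p - a l \<bullet> p} \<subseteq> N \<and>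
     emeasure lebesgue N \<le> ennreal \<eta>)"
  have "\<exists>h g N. \<Phi> l h g N" for l
    unfolding \<Phi>_def
    by (rule lusin_C1[OF lipB e(1) lmB compact_imp_bounded[OF B(1)] \<eta>, of l]) blast
  then obtain h g N where \<Phi>: "\<And>l. \<Phi> l (h l) (g l) (N l)" by metis
  have h: "\<And>l. continuous_on UNIV (g l)" "\<And>l x. (h l has_derivative (\<lambda>v. g l x \<bullet> v)) (at x)"
    "\<And>l x. norm (g l x) \<le> 2 * e"
    and N: "\<And>l. N l \<in> sets lebesgue" "\<And>l. {p \<in> B. h l p \<noteq> u l p - a l \<bullet> p} \<subseteq> N l" "\<And>l. emeasure lebesgue (N l) \<le> ennreal \<eta>"
    using \<Phi> unfolding \<Phi>_def by blast+
  have ad: "\<And>x. b * norm x \<le> norm (\<chi> l. a l \<bullet> coord_incl j x)" "\<And>l. norm (a l) \<le> R" using a by (auto simp: good_def)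
  have "real CARD('m) * (2 * e) \<le> 1 / (1 + (1 + real CARD('m) * R) / b) / 2" using me(2) by (simp add: s_def m_def)
  then obtain G where G: "C1_diffeomorphism G" "\<And>p. coord_proj \<iota> (G p) = (\<chi> l. a l \<bullet> p + h l p)"
    by (rule straightening_diffeomorphism[where a = a and h = h and g = g, OF inj b ad h]; blast)
  let ?U = "\<Union>l. N l"
  have "\<not> negligible (B - ?U)"
  proof
    assume neg: "negligible (B - ?U)"
    have UN: "?U \<in> sets lebesgue" using N(1) by (intro sets.finite_UN) auto
    have "emeasure lebesgue B \<le> emeasure lebesgue ((B - ?U) \<union> ?U)"
      using lmB UN by (intro emeasure_mono) auto
    also have "\<dots> \<le> emeasure lebesgue (B - ?U) + emeasure lebesgue ?U"
      using lmB UN by (intro emeasure_subadditive) auto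
    also have "emeasure lebesgue (B - ?U) = 0" using neg by (auto simp: negligible_iff_null_sets)
    also have "emeasure lebesgue ?U \<le> (\<Sum>l\<in>UNIV. emeasure lebesgue (N l))"
      using N(1) by (intro emeasure_subadditive_finite) auto
    also have "\<dots> \<le> (\<Sum>l\<in>(UNIV :: 'm set). ennreal \<eta>)" by (intro sum_mono N(3))
    also have "\<dots> = ennreal (m * \<eta>)" using \<eta> by (simp add: m_def ennreal_of_nat_eq_real_of_nat ennreal_mult')
    finally have "measure lebesgue B \<le> m * \<eta>"
      using lmB \<eta> m by (simp add: emeasure_eq_measure2 ennreal_le_iff)
    then show False using mB m by (simp add: \<eta>_def)
  qed
  moreover have "B - ?U \<in> sets lebesgue"
    using lmB N(1) by (intro sets.Diff sets.finite_UN) auto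
  ultimately obtain K' where K': "compact K'" "K' \<subseteq> B - ?U" "\<not> negligible K'"
    using nonnegligible_compact_subset by metis
  show ?thesis
  proof (rule that[OF K'(1) _ K'(3) G(1)])
    show "K' \<subseteq> K" using K'(2) B(2) by blast
    fix p assume "p \<in> K'"
    then have "h l p = u l p - a l \<bullet> p" for l using K'(2) N(2)[of l] by blast
    then show "coord_proj \<iota> (G p) = (\<chi> l. u l p)" by (simp add: G(2))
  qed
qed

definition factors_through_projection ::
    "('m::finite \<Rightarrow> 'n::finite) \<Rightarrow> (real ^ 'n \<Rightarrow> 'x::metric_space) \<Rightarrow> (real ^ 'n) set \<Rightarrow> bool" where
  "factors_through_projection \<iota> f K \<longleftrightarrow>
     (\<exists>(G :: real ^ 'n \<Rightarrow> real ^ 'n) (\<phi> :: real ^ 'm \<Rightarrow> 'x).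
        C1_diffeomorphism G \<and> bi_lipschitz_on (coord_proj \<iota> ` G ` K) \<phi> \<and>
        (\<forall>q \<in> G ` K. (f \<circ> inv G) q = (\<phi> \<circ> coord_proj \<iota>) q))"

lemma factorization_on_noncollapsed_set:
  fixes f :: "real ^ 'n::finite \<Rightarrow> 'x::metric_space" and \<iota> j :: "'m::finite \<Rightarrow> 'n"
  assumes inj: "inj \<iota>" "inj j" and sf: "hausdorff_sigma_finite CARD('m) (UNIV :: 'x set)"
    and \<Omega>: "open \<Omega>" and f: "M-lipschitz_on \<Omega> f" and M: "0 < M" and \<kappa>: "0 < \<kappa>"
    and S: "S \<in> sets lebesgue" "S \<subseteq> noncollapsed_set f \<Omega> (coord_incl j) \<kappa>" "\<not> negligible S"
  obtains K where "compact K" "K \<subseteq> S" "\<not> negligible K" "factors_through_projection \<iota> f K"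
proof -
  let ?T = "coord_incl j :: real ^ 'm \<Rightarrow> real ^ 'n"
  have T: "linear ?T" "\<And>x. norm (?T x) = norm x"
    using linear_coord_incl norm_coord_incl[OF inj(2)] by auto
  have S\<Omega>: "S \<subseteq> \<Omega>" using S(2) by (auto simp: noncollapsed_set_def)
  \<comment> \<open>Diameter below \<open>1 / \<kappa>\<close> brings any two points on a common
    slice within the scale of \<open>noncollapsed_set\<close>.\<close>
  obtain V where V: "open V" "\<not> negligible (S \<inter> V)" "\<And>p q. p \<in> V \<Longrightarrow> q \<in> V \<Longrightarrow> dist p q < 1 / \<kappa>"
    by (rule nonnegligible_Int_small_open[OF S(3), of "1 / \<kappa>"]) (use \<kappa> in simp, blast)
  have "S \<inter> V \<in> sets lebesgue" using S(1) V(1) by (intro sets.Int) auto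
  then obtain K1 where K1: "compact K1" "K1 \<subseteq> S \<inter> V" "\<not> negligible K1"
    using nonnegligible_compact_subset V(2) by metis
  have K1\<Omega>: "K1 \<subseteq> \<Omega>" using K1(2) S\<Omega> by blast
  have slice: "dist p q \<le> \<kappa> * dist (f p) (f q)" if pq: "p \<in> K1" "q \<in> K1" "q - p \<in> range ?T" for p q
  proof -
    obtain x where x: "q - p = ?T x" using pq(3) by auto
    then have q: "q = p + ?T x" by (simp add: algebra_simps)
    have "dist p q < 1 / \<kappa>" using pq K1(2) by (intro V(3)) auto
    then have "norm x < 1 / \<kappa>" by (simp add: q dist_norm T(2))
    moreover have "p \<in> noncollapsed_set f \<Omega> ?T \<kappa>" using pq(1) K1(2) S(2) by blast
    moreover have "p + ?T x \<in> \<Omega>" using pq(2) K1\<Omega> q by blast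
    ultimately have "norm x \<le> \<kappa> * dist (f (p + ?T x)) (f p)" unfolding noncollapsed_set_def by blast
    then show ?thesis by (simp add: q dist_norm T(2) dist_commute)
  qed
  have cf: "continuous_on K1 f" using f K1\<Omega> by (meson continuous_on_subset lipschitz_on_continuous_on)
  have sf': "hausdorff_sigma_finite DIM(real ^ 'm) (UNIV :: 'x set)" using sf by simp
  obtain c where K2': "compact {p \<in> K1. f p \<in> f ` (K1 \<inter> range (\<lambda>x. c + ?T x))}"
    "\<not> negligible {p \<in> K1. f p \<in> f ` (K1 \<inter> range (\<lambda>x. c + ?T x))}"
    by (rule slice_with_large_saturation[OF sf' T cf less_imp_le[OF \<kappa>] slice K1(1,3)])
  define K2 where "K2 = {p \<in> K1. f p \<in> f ` (K1 \<inter> range (\<lambda>x. c + ?T x))}"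
  have K2: "compact K2" "\<not> negligible K2" "K2 \<subseteq> K1" using K2' by (auto simp: K2_def)
  define \<phi> where "\<phi> = (\<lambda>x. f (c + ?T x))"
  define Z where "Z = {x. c + ?T x \<in> K1}"
  have dT: "dist (?T x) (?T y) = dist x y" for x y
    by (simp add: dist_norm T(2) flip: linear_diff[OF T(1)])
  have \<phi>_lower: "dist x y \<le> \<kappa> * dist (\<phi> x) (\<phi> y)" if "x \<in> Z" "y \<in> Z" for x y
  proof -
    have "c + ?T y - (c + ?T x) \<in> range ?T" by (simp flip: linear_diff[OF T(1)])
    then show ?thesis using slice[of "c + ?T x" "c + ?T y"] that by (simp add: Z_def \<phi>_def dT)
  qed
  have \<phi>_upper: "dist (\<phi> x) (\<phi> y) \<le> M * dist x y" if "x \<in> Z" "y \<in> Z" for x y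
    using lipschitz_onD[OF f, of "c + ?T x" "c + ?T y"] that K1\<Omega> by (auto simp: Z_def \<phi>_def dT)
  have "\<forall>p\<in>K2. \<exists>x. x \<in> Z \<and> \<phi> x = f p" by (auto simp: K2_def Z_def \<phi>_def)
  \<comment> \<open>\<open>g0\<close> is \<open>f\<close> read in the chart \<open>\<phi>\<close>;
    the choice is unique on \<open>K2\<close>, as \<open>\<phi>\<close> is injective on
    \<open>Z\<close>.\<close>
  then obtain g0 where g0: "\<And>p. p \<in> K2 \<Longrightarrow> g0 p \<in> Z" "\<And>p. p \<in> K2 \<Longrightarrow> \<phi> (g0 p) = f p" by metis
  have g0_lip: "dist (g0 p) (g0 q) \<le> \<kappa> * M * dist p q" if pq: "p \<in> K2" "q \<in> K2" for p q
  proof -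
    have "dist (g0 p) (g0 q) \<le> \<kappa> * dist (f p) (f q)" using \<phi>_lower[of "g0 p" "g0 q"] g0 pq by simp
    also have "\<dots> \<le> \<kappa> * (M * dist p q)"
      using lipschitz_onD[OF f, of p q] pq K2(3) K1\<Omega> \<kappa> by (intro mult_left_mono) auto
    finally show ?thesis by simp
  qed
  have \<kappa>M: "0 < \<kappa> * M" using \<kappa> M by simp
  \<comment> \<open>The differentiability and approximation results concern real functions on the
    whole space, so the coordinates of \<open>g0\<close> are extended one by one.\<close>
  have "\<exists>v. (\<kappa> * M)-lipschitz_on UNIV v \<and> (\<forall>p\<in>K2. v p = g0 p $ l)" for l
  proof -
    have "(\<kappa> * M)-lipschitz_on K2 (\<lambda>p. g0 p $ l)"
    proof (rule lipschitz_onI)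
      fix p q assume pq: "p \<in> K2" "q \<in> K2"
      show "dist (g0 p $ l) (g0 q $ l) \<le> \<kappa> * M * dist p q"
        using dist_vec_nth_le[of "g0 p" l "g0 q"] g0_lip[OF pq] by linarith
    qed (use \<kappa>M in simp)
    then show ?thesis
      using compact_imp_bounded[OF K2(1)] \<kappa>M by (rule lipschitz_extension_compact_support) blast
  qed
  then obtain u where u: "\<And>l. (\<kappa> * M)-lipschitz_on UNIV (u l)" "\<And>l p. p \<in> K2 \<Longrightarrow> u l p = g0 p $ l" by metis
  have g: "(\<chi> l. u l p) = g0 p" if "p \<in> K2" for p using u(2)[OF that] by (simp add: vec_eq_iff)
  \<comment> \<open>Chosen so that \<open>2 * b\<close> is the lower bound
    \<open>1 / (\<kappa> * M)\<close> of \<open>noncollapsed_derivative_lower_bound\<close>.\<close>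
  define b where "b = 1 / (2 * (\<kappa> * M))"
  have b: "0 < b" using \<kappa>M by (simp add: b_def)
  have "AE p in lebesgue. p \<in> K2 \<longrightarrow> (\<forall>A. (\<forall>l. (u l has_derivative A l) (at p)) \<longrightarrow>
       (\<forall>x. 2 * b * norm x \<le> norm (\<chi> l. A l (?T x))))"
    using AE_infdist_derivative_0[of K2]
  proof (rule eventually_mono, intro impI allI)
    fix p A x
    assume "p \<in> K2 \<longrightarrow> ((\<lambda>y. infdist y K2) has_derivative (\<lambda>_. 0)) (at p)"
      and p: "p \<in> K2" and A: "\<forall>l. (u l has_derivative A l) (at p)"
    then have dens: "((\<lambda>y. infdist y K2) has_derivative (\<lambda>_. 0)) (at p)" by blast
    have derg: "((\<lambda>p. \<chi> l. u l p) has_derivative (\<lambda>h. \<chi> l. A l h)) (at p)"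
      using A by (intro has_derivative_vec_lambda_real) blast
    have "norm x \<le> \<kappa> * M * norm (\<chi> l. A l (?T x))"
    proof (rule noncollapsed_derivative_lower_bound[OF \<Omega> compact_imp_closed[OF K2(1)] _ p T f lipschitz_vec_lambda[OF u(1)] derg dens _ _ \<kappa>])
      show "K2 \<subseteq> \<Omega>" using K2(3) K1\<Omega> by blast
      show "p \<in> noncollapsed_set f \<Omega> ?T \<kappa>" using p K2(3) K1(2) S(2) by blast
      fix q assume q: "q \<in> K2"
      show "dist (f q) (f p) \<le> M * norm ((\<chi> l. u l q) - (\<chi> l. u l p))"
        using \<phi>_upper[of "g0 q" "g0 p"] g0 p q by (simp add: g dist_norm)
    qed
    then show "2 * b * norm x \<le> norm (\<chi> l. A l (?T x))"
      using \<kappa>M by (simp add: b_def field_simps)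
  qed
  then obtain K' G where K': "compact K'" "K' \<subseteq> K2" "\<not> negligible K'" and G: "C1_diffeomorphism G"
    "\<And>p. p \<in> K' \<Longrightarrow> coord_proj \<iota> (G p) = (\<chi> l. u l p)"
    by (rule straightening_piece[where u = u and j = j, OF inj K2(1,2) u(1) b]; blast)
  have Gg: "coord_proj \<iota> (G p) = g0 p" if "p \<in> K'" for p using G(2)[OF that] g that K'(2) by auto
  have "bi_lipschitz_on (coord_proj \<iota> ` G ` K') \<phi>"
    unfolding bi_lipschitz_on_def
  proof (intro exI[of _ "max 1 (max \<kappa> M)"] conjI ballI)
    fix x y assume "x \<in> coord_proj \<iota> ` G ` K'" "y \<in> coord_proj \<iota> ` G ` K'"
    then have xy: "x \<in> Z" "y \<in> Z" using Gg g0(1) K'(2) by auto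
    have "dist x y \<le> \<kappa> * dist (\<phi> x) (\<phi> y)" by (rule \<phi>_lower[OF xy])
    also have "\<dots> \<le> max 1 (max \<kappa> M) * dist (\<phi> x) (\<phi> y)" by (intro mult_right_mono) auto
    finally show "dist x y / max 1 (max \<kappa> M) \<le> dist (\<phi> x) (\<phi> y)"
      by (subst pos_divide_le_eq) (auto simp: mult.commute)
    have "M * dist x y \<le> max 1 (max \<kappa> M) * dist x y" by (intro mult_right_mono) auto
    then show "dist (\<phi> x) (\<phi> y) \<le> max 1 (max \<kappa> M) * dist x y" using \<phi>_upper[OF xy] by linarith
  qed simp
  moreover have "(f \<circ> inv G) q = (\<phi> \<circ> coord_proj \<iota>) q" if qK: "q \<in> G ` K'" for q
  proof -
    obtain p where p: "p \<in> K'" "q = G p" using qK by auto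
    have "inj G" using G(1) by (simp add: C1_diffeomorphism_def bij_def)
    then have "(f \<circ> inv G) q = f p" using p by simp
    also have "\<dots> = \<phi> (g0 p)" using g0(2) p K'(2) by auto
    finally show ?thesis using Gg p by simp
  qed
  ultimately have "factors_through_projection \<iota> f K'"
    unfolding factors_through_projection_def using G(1) by blast
  moreover have "K' \<subseteq> S" using K'(2) K2(3) K1(2) by blast
  ultimately show ?thesis using that K' by blast
qed

text \<open>A maximal disjoint family of non-null good compact sets is countable, because balls have
  finite measure. If its remainder were not null, \<open>piece\<close> would supply one more
  member.\<close>

lemma exhaustion_by_disjoint_compact_sets:
  fixes \<Omega> :: "'a::euclidean_space set"
  assumes \<Omega>: "\<Omega> \<in> sets lebesgue"
    and piece: "\<And>S. S \<in> sets lebesgue \<Longrightarrow> S \<subseteq> \<Omega> \<Longrightarrow> \<not> negligible S \<Longrightarrow>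
      \<exists>K. compact K \<and> K \<subseteq> S \<and> \<not> negligible K \<and> P K"
  obtains \<K> where "countable \<K>" "pairwise disjnt \<K>" "\<And>K. K \<in> \<K> \<Longrightarrow> compact K \<and> K \<subseteq> \<Omega> \<and> P K"
    "negligible (\<Omega> - \<Union>\<K>)"
proof -
  define A where "A = {K. compact K \<and> K \<subseteq> \<Omega> \<and> \<not> negligible K \<and> P K}"
  obtain \<K> where \<K>: "\<K> \<subseteq> A" "pairwise disjnt \<K>"
    "\<forall>K\<in>A. (\<forall>K'\<in>\<K>. disjnt K K' \<and> disjnt K' K) \<longrightarrow> K \<in> \<K>"
    using maximal_pairwise_family[of A disjnt] by blast
  have meas: "K \<in> sets lebesgue" if "K \<in> \<K>" for K
    using that \<K>(1) by (auto simp: A_def intro: fmeasurableD lmeasurable_compact)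
  have "countable \<K>"
  proof (rule countable_if_bounded_weights[where w = "\<lambda>i K. emeasure lebesgue (K \<inter> cball 0 (real i))"
        and C = "\<lambda>i. emeasure lebesgue (cball (0 :: 'a) (real i))"])
    fix i F assume F: "finite F" "F \<subseteq> \<K>"
    have "K \<inter> cball 0 (real i) \<in> sets lebesgue" if "K \<in> F" for K
      using that F(2) meas by (intro sets.Int) auto
    moreover have "disjoint_family_on (\<lambda>K. K \<inter> cball 0 (real i)) F"
      unfolding disjoint_family_on_def
    proof (intro ballI impI)
      fix K K' assume "K \<in> F" "K' \<in> F" "K \<noteq> K'"
      then have "disjnt K K'" using F(2) \<K>(2) by (meson pairwiseD subsetD)
      then show "K \<inter> cball 0 (real i) \<inter> (K' \<inter> cball 0 (real i)) = {}" by (auto simp: disjnt_def)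
    qed
    ultimately have "(\<Sum>K\<in>F. emeasure lebesgue (K \<inter> cball 0 (real i))) = emeasure lebesgue (\<Union>K\<in>F. K \<inter> cball 0 (real i))"
      using F(1) by (intro sum_emeasure) auto
    also have "\<dots> \<le> emeasure lebesgue (cball (0 :: 'a) (real i))"
      by (intro emeasure_mono) auto
    finally show "(\<Sum>K\<in>F. emeasure lebesgue (K \<inter> cball 0 (real i))) \<le> emeasure lebesgue (cball (0 :: 'a) (real i))" .
  next
    show "emeasure lebesgue (cball (0 :: 'a) (real i)) < \<infinity>" for i
      using emeasure_lborel_cball_finite[of "0 :: 'a" "real i"] by simp
  next
    fix K assume K: "K \<in> \<K>"
    show "\<exists>i. emeasure lebesgue (K \<inter> cball 0 (real i)) \<noteq> 0"
    proof (rule ccontr)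
      assume "\<not> ?thesis"
      then have "negligible (K \<inter> cball 0 (real i))" for i
        using meas[OF K] by (auto simp: negligible_iff_null_sets null_sets_def)
      then have "negligible (\<Union>i. K \<inter> cball 0 (real i))" by (rule negligible_Union_nat)
      moreover have "(\<Union>i. K \<inter> cball 0 (real i)) = K" by (auto intro!: real_arch_simple)
      ultimately show False using K \<K>(1) by (auto simp: A_def)
    qed
  qed
  moreover have "negligible (\<Omega> - \<Union>\<K>)"
  proof (rule ccontr)
    assume neg: "\<not> negligible (\<Omega> - \<Union>\<K>)"
    have "\<Union>\<K> \<in> sets lebesgue" using \<open>countable \<K>\<close> meas by (intro sets.countable_Union) auto
    then have "\<Omega> - \<Union>\<K> \<in> sets lebesgue" using \<Omega> by (intro sets.Diff)
    then obtain K where K: "compact K" "K \<subseteq> \<Omega> - \<Union>\<K>" "\<not> negligible K" "P K"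
      using piece[of "\<Omega> - \<Union>\<K>"] neg by blast
    have "disjnt K K' \<and> disjnt K' K" if "K' \<in> \<K>" for K' using K(2) that by (auto simp: disjnt_def)
    moreover have "K \<in> A" using K by (auto simp: A_def)
    ultimately have "K \<in> \<K>" using \<K>(3) by blast
    then have "K = {}" using K(2) by blast
    then show False using K(3) by simp
  qed
  moreover have "compact K \<and> K \<subseteq> \<Omega> \<and> P K" if "K \<in> \<K>" for K using that \<K>(1) by (auto simp: A_def)
  ultimately show ?thesis using \<K>(2) that by blast
qed

theorem theorem1p6:
  fixes f :: "real ^ 'n::finite \<Rightarrow> 'x::metric_space"
    and \<Omega> :: "(real ^ 'n) set"
    and \<iota> :: "'m::finite \<Rightarrow> 'n"
  assumes "inj \<iota>"
    and "hausdorff_sigma_finite CARD('m) (UNIV :: 'x set)"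
    and "open \<Omega>"
    and "\<exists>L. L-lipschitz_on \<Omega> f"
    and "AE p in lebesgue. p \<in> \<Omega> \<longrightarrow>
           metrically_differentiable f p \<Omega> \<and> seminorm_rank (md f p \<Omega>) = CARD('m)"
  shows "\<exists>\<K> :: (real ^ 'n) set set.
           countable \<K> \<and> pairwise disjnt \<K> \<and>
           (\<forall>K\<in>\<K>. compact K \<and> K \<subseteq> \<Omega>) \<and>
           \<Omega> - \<Union>\<K> \<in> null_sets lebesgue \<and>
           (\<forall>K\<in>\<K>. \<exists>(G :: real ^ 'n \<Rightarrow> real ^ 'n) (\<phi> :: real ^ 'm \<Rightarrow> 'x).
              C1_diffeomorphism G \<and>
              bi_lipschitz_on (coord_proj \<iota> ` G ` K) \<phi> \<and>
              (\<forall>q \<in> G ` K. (f \<circ> inv G) q = (\<phi> \<circ> coord_proj \<iota>) q))"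
proof -
  obtain L where L: "L-lipschitz_on \<Omega> f" using assms(4) by blast
  \<comment> \<open>A positive constant is required for the Lipschitz extension and for the division
    by \<open>\<kappa> * M\<close>.\<close>
  define M where "M = max L 1"
  have M: "M-lipschitz_on \<Omega> f" "0 < M" using L by (auto simp: M_def intro: lipschitz_on_le)
  have cf: "continuous_on \<Omega> f" using L by (rule lipschitz_on_continuous_on)
  \<comment> \<open>Finitely many coordinate planes and integer constants: countably many
    noncollapsed sets cover almost all of \<open>\<Omega>\<close>, so every non-null
    \<open>S\<close> meets one of them in a non-null set.\<close>
  define I where "I = {j :: 'm \<Rightarrow> 'n. inj j} \<times> (UNIV :: nat set)"
  have "countable {j :: 'm \<Rightarrow> 'n. inj j}" by (rule countable_finite) simp
  then have cI: "countable I" unfolding I_def by auto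
  define N where "N = (\<lambda>(j :: 'm \<Rightarrow> 'n, k). noncollapsed_set f \<Omega> (coord_incl j) (real (Suc k)))"
  have cover: "AE p in lebesgue. p \<in> \<Omega> \<longrightarrow> p \<in> (\<Union>i\<in>I. N i)"
    using assms(5)
  proof (rule eventually_mono, intro impI)
    fix p assume "p \<in> \<Omega> \<longrightarrow> metrically_differentiable f p \<Omega> \<and> seminorm_rank (md f p \<Omega>) = CARD('m)" and p: "p \<in> \<Omega>"
    then obtain \<sigma> where \<sigma>: "has_metric_differential f \<sigma> p \<Omega>" "seminorm_rank (md f p \<Omega>) = CARD('m)"
      by (auto simp: metrically_differentiable_def)
    have sn: "seminorm \<sigma>" using \<sigma>(1) by (simp add: has_metric_differential_def)
    have rank: "seminorm_rank \<sigma> = CARD('m)" using \<sigma> md_eq[OF assms(3) p \<sigma>(1)] by simp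
    obtain j :: "'m \<Rightarrow> 'n" and a where j: "inj j" "0 < a" "\<And>x. a * norm x \<le> \<sigma> (coord_incl j x)"
      by (rule seminorm_coordinate_complement[OF sn rank]; blast)
    obtain k where "p \<in> noncollapsed_set f \<Omega> (coord_incl j) (real (Suc k))"
      by (rule metric_differential_noncollapsed[OF p \<sigma>(1) norm_coord_incl[OF j(1)] j(2,3)])
    then show "p \<in> (\<Union>i\<in>I. N i)" using j(1) unfolding I_def N_def by blast
  qed
  have piece: "\<exists>K. compact K \<and> K \<subseteq> S \<and> \<not> negligible K \<and> factors_through_projection \<iota> f K"
    if S: "S \<in> sets lebesgue" "S \<subseteq> \<Omega>" "\<not> negligible S" for S
  proof -
    have "AE p in lebesgue. p \<in> S \<longrightarrow> p \<in> (\<Union>i\<in>I. N i)"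
      using cover S(2) by (auto elim: eventually_mono)
    then obtain i where i: "i \<in> I" "\<not> negligible (S \<inter> N i)"
      by (rule nonnegligible_AE_Union[OF S(3) cI])
    then obtain j k where jk: "i = (j, k)" "inj j" by (auto simp: I_def)
    note i(2)
    moreover have "S \<inter> N i \<in> sets lebesgue"
      using S(1) borel_noncollapsed_set[OF assms(3) cf, of "coord_incl j" "real (Suc k)"]
      by (intro sets.Int) (auto simp: N_def jk(1))
    moreover have "S \<inter> N i \<subseteq> noncollapsed_set f \<Omega> (coord_incl j) (real (Suc k))"
      by (auto simp: N_def jk(1))
    moreover have "0 < real (Suc k)" by simp
    ultimately obtain K where "compact K" "K \<subseteq> S \<inter> N i" "\<not> negligible K" "factors_through_projection \<iota> f K"
      using factorization_on_noncollapsed_set[OF assms(1) jk(2) assms(2,3) M] by metis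
    then show ?thesis by blast
  qed
  have "\<Omega> \<in> sets lebesgue" using assms(3) by simp
  then obtain \<K> where "countable \<K>" "pairwise disjnt \<K>"
    "\<And>K. K \<in> \<K> \<Longrightarrow> compact K \<and> K \<subseteq> \<Omega> \<and> factors_through_projection \<iota> f K" "negligible (\<Omega> - \<Union>\<K>)"
    using exhaustion_by_disjoint_compact_sets[OF _ piece] by blast
  then show ?thesis
    unfolding factors_through_projection_def negligible_iff_null_sets by (intro exI[of _ \<K>]) blast
qed

end
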